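(* Let $G$ be a compact Lie group with maximal torus $\mathbb T$, $\mathbb N=N_G(\mathbb T)$ and $\mathbb W=\mathbb N/\mathbb T$. The model for toral spectra for the group $\mathbb N$ simplifies to give $$\mathcal A(\mathbb N,toral)=\mathcal A(\mathbb T)[\mathbb W].$$
   Context: Conventions. All subgroups are closed; cohomology is unreduced with rational coefficients; rings and modules are graded. Let $\Gamma$ be a compact Lie group with maximal torus $\mathbb T$ and $\mathbb W=N_\Gamma(\mathbb T)/\mathbb T$ (for $\Gamma=G$ and $\Gamma=\mathbb N=N_G(\mathbb T)$ these have the same $\mathbb T$ and $\mathbb W$). A subgroup $L\subseteq K$ of $\mathbb T$ is cotoral in $K$ if $K/L$ is a torus (possibly trivial). A flag $E=(K_0\supset\cdots\supset K_s)$ ($s\ge 0$) is a finite strictly decreasing chain of subgroups of $\mathbb T$ with all inclusions cotoral; flags are ordered by inclusion. $(K)$ is the length-$0$ flag, and we write $M(K)$ for $M((K))$. $\mathbb W$ acts on flags on the right by $K^w=w^{-1}Kw$. For a flag $E$ put $N_\Gamma(E)=\bigcap_i N_\Gamma(K_i)$, $W_\Gamma(E)=N_\Gamma(E)/K_s$, with identity component $W_\Gamma^e(E)$. $\mathbb W_E=(N_\Gamma(\mathbb T)\cap N_\Gamma(E))/\mathbb T$ is the stabilizer of $E$; it is the Weyl group of $W_\Gamma(E)$ with respect to its maximal torus $\mathbb T/K_s$, and $\mathbb W_E^e\trianglelefteq \mathbb W_E$ is the Weyl group of $W_\Gamma^e(E)$ with respect to $\mathbb T/K_s$ (this depends on $\Gamma$).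 Rings. For $K\supseteq L$ cotoral, $\mathcal E_{K/L}=\{e(V): V\text{ a complex representation of }\mathbb T/L,\ V^K=0\}\subseteq H^*(B\mathbb T/L)$. Put $R_a(E)=\mathcal E_{K_0/K_s}^{-1}H^*(B\mathbb T/K_s)$, a covariant functor on flags via inflation, with ring maps $w_m:R_a(E)\to R_a(E^w)$ induced by conjugation. Put $R_{inv}(E)=R_a(E)^{\mathbb W_E^e}$. Modules. An $R_{inv}$-module $M$ consists of $R_{inv}(E)$-modules $M(E)$, functorial structure maps $M(F)\to M(E)$ for $F\subseteq E$ that are linear over $R_{inv}(F)\to R_{inv}(E)$, and semilinear maps $w_m:M(E)\to M(E^w)$ ($w\in\mathbb W$) compatible with the structure maps, with $e_m=1$ and $(vw)_m$ equal to $v_m$ followed by $w_m$, such that $\mathbb W_E^e$ acts trivially on $M(E)$. $M$ is quasi-coherent if for every $E=(K_0\supset\cdots\supset K_s)$ the map $R_{inv}(E)\otimes_{R_{inv}(K_s)}M(K_s)\to M(E)$ is an isomorphism, and extended if $R_{inv}(E)\otimes_{R_{inv}(K_0)}M(K_0)\to M(E)$ is an isomorphism; qce means both. $M$ (quasi-coherent) is $\mathcal F$-continuous if for each $K\subseteq\mathbb T$ there is a specified factorization of $M(K)\to\prod_{L}\mathcal E_{K/L}^{-1}R_a(L)\otimes_{R_{inv}(L)}M(L)$ through $\mathcal E_K^{-1}\prod_{L}R_a(L)\otimes_{R_{inv}(L)}M(L)$, the products being over $L$ cotoral in $K$, and these factorizations are compatible with composition. Here $\mathcal E_K$ consists of $e(V)$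 for representations $V$ of $\mathbb T$ with $V^K=0$, with $e(V)$ acting on the $L$-factor as $e(V^L)\in H^*(B\mathbb T/L)$ (with the evident degree shifts). $\mathcal A(\Gamma,toral)$ is the category of qce, $\mathcal F$-continuous $R_{inv}$-modules and maps compatible with all this structure. $\mathcal A(\mathbb T)[\mathbb W]$ is the category of qce, $\mathcal F$-continuous $\mathbb W$-equivariant $R_a$-modules: the same definitions with $R_a$ in place of $R_{inv}$, with equivariant semilinear maps $w_m$, and no triviality condition. *)

theory Defs
  imports "HOL-Homology.Homology" "HOL-Analysis.Analysis" "HOL-Algebra.QuotRing" "HOL-Algebra.Module"
    "HOL-Algebra.Group_Action" "HOL-Algebra.Free_Abelian_Groups"
begin

section \<open>Compact Lie groups and tori\<close>

primrec Ck_on :: "nat \<Rightarrow> 'a::real_normed_vector set \<Rightarrow> ('a \<Rightarrow> 'b::real_normed_vector) \<Rightarrow> bool" where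
  "Ck_on 0 S f \<longleftrightarrow> continuous_on S f"
| "Ck_on (Suc k) S f \<longleftrightarrow>
     (\<forall>x\<in>S. f differentiable (at x)) \<and> (\<forall>v. Ck_on k S (\<lambda>x. frechet_derivative f (at x) v))"

text \<open>Smoothness on an arbitrary subset of a Euclidean space, by local smooth extension.  It is
  only applied to relatively open subsets of linear subspaces, where it is the usual notion.\<close>

definition smooth_map_on :: "'a::real_normed_vector set \<Rightarrow> ('a \<Rightarrow> 'b::real_normed_vector) \<Rightarrow> bool" where
  "smooth_map_on A f \<longleftrightarrow>
     (\<forall>x\<in>A. \<exists>U F. open U \<and> x \<in> U \<and> (\<forall>k. Ck_on k U F) \<and> (\<forall>y\<in>U \<inter> A. F y = f y))"

definition topological_group :: "('a, 'c) monoid_scheme \<Rightarrow> 'a topology \<Rightarrow> bool" where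
  "topological_group A Y \<longleftrightarrow> group A \<and> topspace Y = carrier A \<and>
     continuous_map (prod_topology Y Y) Y (\<lambda>(x, y). x \<otimes>\<^bsub>A\<^esub> y) \<and>
     continuous_map Y Y (\<lambda>x. inv\<^bsub>A\<^esub> x)"

text \<open>\<open>C\<close> is a smooth atlas with charts \<open>(U, \<phi>)\<close>.  The model space is a linear subspace \<open>V\<close> of a
  Euclidean space, because the class \<open>euclidean_space\<close> has no type of dimension 0 and
  finite groups have to be included.\<close>

definition compact_lie_group ::
  "'g monoid \<Rightarrow> 'g topology \<Rightarrow> 'e::euclidean_space set \<Rightarrow> ('g set \<times> ('g \<Rightarrow> 'e)) set \<Rightarrow> bool" where
  "compact_lie_group G X V C \<longleftrightarrow>
     topological_group G X \<and> compact_space X \<and> Hausdorff_space X \<and> subspace V \<and>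
     (\<Union>(U, \<phi>)\<in>C. U) = carrier G \<and>
     (\<forall>(U, \<phi>)\<in>C. openin X U \<and> openin (top_of_set V) (\<phi> ` U) \<and>
        homeomorphic_map (subtopology X U) (top_of_set (\<phi> ` U)) \<phi>) \<and>
     (\<forall>(U, \<phi>)\<in>C. \<forall>(U', \<phi>')\<in>C. smooth_map_on (\<phi> ` (U \<inter> U')) (\<lambda>a. \<phi>' (inv_into U \<phi> a))) \<and>
     (\<forall>(U, \<phi>)\<in>C. \<forall>(U', \<phi>')\<in>C. \<forall>(U'', \<phi>'')\<in>C.
        smooth_map_on
          {(a, b). a \<in> \<phi> ` U \<and> b \<in> \<phi>' ` U' \<and> inv_into U \<phi> a \<otimes>\<^bsub>G\<^esub> inv_into U' \<phi>' b \<in> U''}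
          (\<lambda>(a, b). \<phi>'' (inv_into U \<phi> a \<otimes>\<^bsub>G\<^esub> inv_into U' \<phi>' b))) \<and>
     (\<forall>(U, \<phi>)\<in>C. \<forall>(U', \<phi>')\<in>C.
        smooth_map_on {a \<in> \<phi> ` U. inv\<^bsub>G\<^esub> (inv_into U \<phi> a) \<in> U'}
          (\<lambda>a. \<phi>' (inv\<^bsub>G\<^esub> (inv_into U \<phi> a))))"

definition quotient_topology :: "'a topology \<Rightarrow> ('a \<Rightarrow> 'b) \<Rightarrow> 'b topology" where
  "quotient_topology X q =
     topology (\<lambda>U. U \<subseteq> q ` topspace X \<and> openin X {x \<in> topspace X. q x \<in> U})"

text \<open>A torus is a compact connected abelian Lie group.  The predicate is only applied to closed
  subgroups of compact Lie groups and to quotients of those by closed normal subgroups, and these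
  are automatically Lie groups.\<close>

definition torus_group :: "('a, 'c) monoid_scheme \<Rightarrow> 'a topology \<Rightarrow> bool" where
  "torus_group A Y \<longleftrightarrow>
     topological_group A Y \<and> comm_group A \<and> compact_space Y \<and> connected_space Y"

definition torus_in :: "'g monoid \<Rightarrow> 'g topology \<Rightarrow> 'g set \<Rightarrow> bool" where
  "torus_in G X S \<longleftrightarrow>
     subgroup S G \<and> closedin X S \<and> torus_group (G\<lparr>carrier := S\<rparr>) (subtopology X S)"

definition maximal_torus :: "'g monoid \<Rightarrow> 'g topology \<Rightarrow> 'g set \<Rightarrow> bool" where
  "maximal_torus G X T \<longleftrightarrow> torus_in G X T \<and> (\<forall>S. torus_in G X S \<and> T \<subseteq> S \<longrightarrow> S = T)"

definition weyl :: "'a monoid \<Rightarrow> 'a set \<Rightarrow> 'a set monoid" where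
  "weyl H S = (H\<lparr>carrier := normalizer H S\<rparr>) Mod S"


section \<open>Graded rings and modules\<close>

record 'a graded_ring = "'a ring" +
  rcomp :: "int \<Rightarrow> 'a set"

record ('r, 'm) graded_module = "('r, 'm) module" +
  mcomp :: "int \<Rightarrow> 'm set"

definition is_graded_module :: "'r graded_ring \<Rightarrow> ('r, 'm) graded_module \<Rightarrow> bool" where
  "is_graded_module R M \<longleftrightarrow>
     Module.module R M \<and>
     (\<forall>n. subgroup (mcomp M n) (add_monoid M)) \<and>
     (\<forall>m\<in>carrier M. \<exists>!h :: int \<Rightarrow> 'm. (\<forall>n. h n \<in> mcomp M n) \<and>
        finite {n. h n \<noteq> \<zero>\<^bsub>M\<^esub>} \<and> m = finsum M h {n. h n \<noteq> \<zero>\<^bsub>M\<^esub>}) \<and>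
     (\<forall>i j. \<forall>r\<in>rcomp R i. \<forall>m\<in>mcomp M j. r \<odot>\<^bsub>M\<^esub> m \<in> mcomp M (i + j))"

text \<open>Additive maps of degree 0 that are semilinear along \<open>\<theta>\<close>.\<close>

definition graded_semilinear ::
  "'r graded_ring \<Rightarrow> ('r \<Rightarrow> 'r) \<Rightarrow> ('r, 'm) graded_module \<Rightarrow> ('r, 'm) graded_module \<Rightarrow> ('m \<Rightarrow> 'm) \<Rightarrow> bool"
where
  "graded_semilinear R \<theta> M M' f \<longleftrightarrow>
     f \<in> hom (add_monoid M) (add_monoid M') \<and>
     (\<forall>n. f ` mcomp M n \<subseteq> mcomp M' n) \<and>
     (\<forall>r\<in>carrier R. \<forall>m\<in>carrier M. f (r \<odot>\<^bsub>M\<^esub> m) = \<theta> r \<odot>\<^bsub>M'\<^esub> f m)"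

definition fraction :: "('r, 'c) ring_scheme \<Rightarrow> 'r set \<Rightarrow> 'r \<Rightarrow> 'r \<Rightarrow> ('r \<times> 'r) set" where
  "fraction R S r s = {(r', s'). r' \<in> carrier R \<and> s' \<in> S \<and>
     (\<exists>u\<in>S. u \<otimes>\<^bsub>R\<^esub> (s' \<otimes>\<^bsub>R\<^esub> r) = u \<otimes>\<^bsub>R\<^esub> (s \<otimes>\<^bsub>R\<^esub> r'))}"

definition loc_ring :: "'r graded_ring \<Rightarrow> 'r set \<Rightarrow> ('r \<times> 'r) set graded_ring" where
  "loc_ring R S =
    \<lparr>carrier = {fraction R S r s | r s. r \<in> carrier R \<and> s \<in> S},
     monoid.mult = (\<lambda>P Q. \<Union>(r, s)\<in>P. \<Union>(r', s')\<in>Q. fraction R S (r \<otimes>\<^bsub>R\<^esub> r') (s \<otimes>\<^bsub>R\<^esub> s')),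
     one = fraction R S \<one>\<^bsub>R\<^esub> \<one>\<^bsub>R\<^esub>,
     zero = fraction R S \<zero>\<^bsub>R\<^esub> \<one>\<^bsub>R\<^esub>,
     add = (\<lambda>P Q. \<Union>(r, s)\<in>P. \<Union>(r', s')\<in>Q.
              fraction R S ((s' \<otimes>\<^bsub>R\<^esub> r) \<oplus>\<^bsub>R\<^esub> (s \<otimes>\<^bsub>R\<^esub> r')) (s \<otimes>\<^bsub>R\<^esub> s')),
     rcomp = (\<lambda>n. {fraction R S r s | r s d. s \<in> S \<and> s \<in> rcomp R d \<and>
                      r \<in> carrier R \<and> r \<in> rcomp R (n + d)})\<rparr>"

definition loc_map ::
  "'r graded_ring \<Rightarrow> 'r set \<Rightarrow> 'q graded_ring \<Rightarrow> 'q set \<Rightarrow> ('r \<Rightarrow> 'q) \<Rightarrow> ('r \<times> 'r) set \<Rightarrow> ('q \<times> 'q) set" where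
  "loc_map R S R' S' f P =
     \<Union>{fraction R' S' (f r) (f s) | r s. r \<in> carrier R \<and> s \<in> S \<and> P = fraction R S r s}"

text \<open>The tensor product \<open>A \<otimes>\<^sub>R M\<close> along a ring map \<open>f : R \<rightarrow> A\<close>, as a graded \<open>A\<close>-module.
  The fields \<open>mult\<close> and \<open>one\<close> of a module record carry no meaning.\<close>

definition tensor_rel ::
  "'r graded_ring \<Rightarrow> 'a graded_ring \<Rightarrow> ('r \<Rightarrow> 'a) \<Rightarrow> ('r, 'm) graded_module \<Rightarrow> ('a \<times> 'm \<Rightarrow>\<^sub>0 int) set" where
  "tensor_rel R A f M =
     generate (free_Abelian_group (carrier A \<times> carrier M))
      ({frag_of (a \<oplus>\<^bsub>A\<^esub> a', m) - frag_of (a, m) - frag_of (a', m) | a a' m.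
          a \<in> carrier A \<and> a' \<in> carrier A \<and> m \<in> carrier M} \<union>
       {frag_of (a, m \<oplus>\<^bsub>M\<^esub> m') - frag_of (a, m) - frag_of (a, m') | a m m'.
          a \<in> carrier A \<and> m \<in> carrier M \<and> m' \<in> carrier M} \<union>
       {frag_of (a \<otimes>\<^bsub>A\<^esub> f r, m) - frag_of (a, r \<odot>\<^bsub>M\<^esub> m) | a r m.
          a \<in> carrier A \<and> r \<in> carrier R \<and> m \<in> carrier M})"

definition tensor_class ::
  "'r graded_ring \<Rightarrow> 'a graded_ring \<Rightarrow> ('r \<Rightarrow> 'a) \<Rightarrow> ('r, 'm) graded_module \<Rightarrow>
   ('a \<times> 'm \<Rightarrow>\<^sub>0 int) \<Rightarrow> ('a \<times> 'm \<Rightarrow>\<^sub>0 int) set" where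
  "tensor_class R A f M c =
     tensor_rel R A f M #>\<^bsub>free_Abelian_group (carrier A \<times> carrier M)\<^esub> c"

definition tensor ::
  "'r graded_ring \<Rightarrow> 'a graded_ring \<Rightarrow> ('r \<Rightarrow> 'a) \<Rightarrow> ('r, 'm) graded_module \<Rightarrow>
   ('a, ('a \<times> 'm \<Rightarrow>\<^sub>0 int) set) graded_module" where
  "tensor R A f M =
    (let F = free_Abelian_group (carrier A \<times> carrier M); Q = F Mod tensor_rel R A f M in
    \<lparr>carrier = carrier Q, monoid.mult = undefined, one = undefined,
     zero = \<one>\<^bsub>Q\<^esub>, add = (\<otimes>\<^bsub>Q\<^esub>),
     module.smult = (\<lambda>a P. \<Union>c\<in>P.
        tensor_class R A f M (frag_extend (\<lambda>(a', m). frag_of (a \<otimes>\<^bsub>A\<^esub> a', m)) c)),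
     mcomp = (\<lambda>n. tensor_class R A f M `
        generate F {frag_of (a, m) | a m i j. i + j = n \<and>
                      a \<in> carrier A \<and> a \<in> rcomp A i \<and> m \<in> carrier M \<and> m \<in> mcomp M j})\<rparr>)"

text \<open>The map induced by \<open>a \<otimes> m \<mapsto> g a \<otimes> h m\<close> into the tensor product given by \<open>R', A', f', M'\<close>.\<close>

definition tensor_map ::
  "'r graded_ring \<Rightarrow> 'a graded_ring \<Rightarrow> ('r \<Rightarrow> 'a) \<Rightarrow> ('r, 'm) graded_module \<Rightarrow>
   ('b \<Rightarrow> 'a) \<Rightarrow> ('k \<Rightarrow> 'm) \<Rightarrow> ('b \<times> 'k \<Rightarrow>\<^sub>0 int) set \<Rightarrow> ('a \<times> 'm \<Rightarrow>\<^sub>0 int) set" where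
  "tensor_map R' A' f' M' g h P =
     (\<Union>c\<in>P. tensor_class R' A' f' M' (frag_extend (\<lambda>(a, m). frag_of (g a, h m)) c))"

text \<open>The map \<open>A \<otimes>\<^sub>R M \<rightarrow> M'\<close>, \<open>a \<otimes> m \<mapsto> a \<odot> h m\<close>.\<close>

definition tensor_eval ::
  "('a, 'k) graded_module \<Rightarrow> ('m \<Rightarrow> 'k) \<Rightarrow> ('a \<times> 'm \<Rightarrow>\<^sub>0 int) set \<Rightarrow> 'k" where
  "tensor_eval M' h P = the_elem
     ((\<lambda>c. finsum M' (\<lambda>p. [Poly_Mapping.lookup c p] \<cdot>\<^bsub>M'\<^esub> (fst p \<odot>\<^bsub>M'\<^esub> h (snd p))) (Poly_Mapping.keys c)) ` P)"


section \<open>Rational singular cohomology\<close>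

text \<open>\<open>\<phi> p\<close> is the degree \<open>p\<close> part of a cochain \<open>\<phi>\<close>, extended by 0 to functions that are not
  singular simplices.\<close>

type_synonym 'b cochain = "nat \<Rightarrow> ((nat \<Rightarrow> real) \<Rightarrow> 'b) \<Rightarrow> rat"

definition front_face :: "nat \<Rightarrow> ((nat \<Rightarrow> real) \<Rightarrow> 'b) \<Rightarrow> (nat \<Rightarrow> real) \<Rightarrow> 'b" where
  "front_face p \<sigma> = restrict \<sigma> (standard_simplex p)"

definition back_face :: "nat \<Rightarrow> nat \<Rightarrow> ((nat \<Rightarrow> real) \<Rightarrow> 'b) \<Rightarrow> (nat \<Rightarrow> real) \<Rightarrow> 'b" where
  "back_face p q \<sigma> = restrict (\<lambda>t. \<sigma> (\<lambda>i. if i < p then 0 else t (i - p))) (standard_simplex q)"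

definition cochain_ring :: "'b topology \<Rightarrow> 'b cochain ring" where
  "cochain_ring X =
    \<lparr>carrier = {\<phi>. finite {p. \<phi> p \<noteq> (\<lambda>_. 0)} \<and> (\<forall>p \<sigma>. \<not> singular_simplex p X \<sigma> \<longrightarrow> \<phi> p \<sigma> = 0)},
     monoid.mult = (\<lambda>\<phi> \<psi> n \<sigma>. if singular_simplex n X \<sigma>
               then \<Sum>p\<le>n. \<phi> p (front_face p \<sigma>) * \<psi> (n - p) (back_face p (n - p) \<sigma>) else 0),
     one = (\<lambda>p \<sigma>. if p = 0 \<and> singular_simplex 0 X \<sigma> then 1 else 0),
     zero = (\<lambda>p \<sigma>. 0),
     add = (\<lambda>\<phi> \<psi> p \<sigma>. \<phi> p \<sigma> + \<psi> p \<sigma>)\<rparr>"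

definition coboundary :: "'b topology \<Rightarrow> 'b cochain \<Rightarrow> 'b cochain" where
  "coboundary X \<phi> n \<sigma> =
     (if 0 < n \<and> singular_simplex n X \<sigma>
      then \<Sum>k\<le>n. (-1) ^ k * \<phi> (n - 1) (singular_face n k \<sigma>) else 0)"

definition cocycles :: "'b topology \<Rightarrow> 'b cochain set" where
  "cocycles X = {\<phi> \<in> carrier (cochain_ring X). coboundary X \<phi> = (\<lambda>p \<sigma>. 0)}"

definition coboundaries :: "'b topology \<Rightarrow> 'b cochain set" where
  "coboundaries X = coboundary X ` carrier (cochain_ring X)"

definition cohomology_class :: "'b topology \<Rightarrow> 'b cochain \<Rightarrow> 'b cochain set" where
  "cohomology_class X \<phi> = coboundaries X +>\<^bsub>cochain_ring X\<^esub> \<phi>"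

definition cohomology :: "'b topology \<Rightarrow> 'b cochain set graded_ring" where
  "cohomology X =
    (let Q = (cochain_ring X\<lparr>carrier := cocycles X\<rparr>) Quot coboundaries X in
    \<lparr>carrier = carrier Q, monoid.mult = monoid.mult Q, one = one Q, zero = zero Q, add = add Q,
     rcomp = (\<lambda>n. cohomology_class X ` {\<phi> \<in> cocycles X. \<forall>p. int p \<noteq> n \<longrightarrow> \<phi> p = (\<lambda>_. 0)})\<rparr>)"

definition cochain_pullback :: "'b topology \<Rightarrow> ('b \<Rightarrow> 'c) \<Rightarrow> 'c cochain \<Rightarrow> 'b cochain" where
  "cochain_pullback Y f \<phi> p \<sigma> = (if singular_simplex p Y \<sigma> then \<phi> p (simplex_map p f \<sigma>) else 0)"

definition cohomology_map :: "'b topology \<Rightarrow> ('b \<Rightarrow> 'c) \<Rightarrow> 'c cochain set \<Rightarrow> 'b cochain set" where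
  "cohomology_map Y f c = (\<Union>\<phi>\<in>c. cohomology_class Y (cochain_pullback Y f \<phi>))"


section \<open>Classifying spaces\<close>

text \<open>Milnor's infinite join: \<open>x i = Some (s, g)\<close> stands for the \<open>i\<close>-th coordinate \<open>s g\<close> with weight
  \<open>s > 0\<close>, and \<open>x i = None\<close> for weight 0.  The topology is the coarsest one making the weights and
  the partially defined coordinates continuous.\<close>

type_synonym 'a milnor = "nat \<Rightarrow> (real \<times> 'a) option"

definition milnor_weight :: "'a milnor \<Rightarrow> nat \<Rightarrow> real" where
  "milnor_weight x i = (case x i of None \<Rightarrow> 0 | Some (s, g) \<Rightarrow> s)"

definition milnor_points :: "('a, 'c) monoid_scheme \<Rightarrow> 'a milnor set" where
  "milnor_points A = {x. finite (dom x) \<and>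
     (\<forall>i s g. x i = Some (s, g) \<longrightarrow> 0 < s \<and> g \<in> carrier A) \<and> (\<Sum>i\<in>dom x. milnor_weight x i) = 1}"

definition universal_space :: "('a, 'c) monoid_scheme \<Rightarrow> 'a topology \<Rightarrow> 'a milnor topology" where
  "universal_space A Y = topology_generated_by
     ({{x \<in> milnor_points A. milnor_weight x i \<in> U} | i U. open U} \<union>
      {{x \<in> milnor_points A. \<exists>s g. x i = Some (s, g) \<and> g \<in> U} | i U. openin Y U})"

definition milnor_act :: "('a, 'c) monoid_scheme \<Rightarrow> 'a milnor \<Rightarrow> 'a \<Rightarrow> 'a milnor" where
  "milnor_act A x a = (\<lambda>i. map_option (\<lambda>(s, g). (s, g \<otimes>\<^bsub>A\<^esub> a)) (x i))"

definition milnor_orbit :: "('a, 'c) monoid_scheme \<Rightarrow> 'a milnor \<Rightarrow> 'a milnor set" where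
  "milnor_orbit A x = milnor_act A x ` carrier A"

definition classifying_space :: "('a, 'c) monoid_scheme \<Rightarrow> 'a topology \<Rightarrow> 'a milnor set topology" where
  "classifying_space A Y = quotient_topology (universal_space A Y) (milnor_orbit A)"

text \<open>The map of classifying spaces induced by a homomorphism \<open>f\<close> with target \<open>A'\<close>.\<close>

definition classifying_map ::
  "('b, 'c) monoid_scheme \<Rightarrow> ('a \<Rightarrow> 'b) \<Rightarrow> 'a milnor set \<Rightarrow> 'b milnor set" where
  "classifying_map A' f b =
     (\<Union>x\<in>b. milnor_orbit A' (\<lambda>i. map_option (\<lambda>(s, g). (s, f g)) (x i)))"


section \<open>Complex representations and Euler classes\<close>

text \<open>A representation is carried by a finite-dimensional complex subspace of \<open>nat \<Rightarrow> complex\<close> (with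
  the product topology), so that fixed points are again representations.  Up to isomorphism
  these are all finite-dimensional representations.\<close>

type_synonym cvec = "nat \<Rightarrow> complex"

record 'a rep =
  rep_space :: "cvec set"
  rep_act :: "'a \<Rightarrow> cvec \<Rightarrow> cvec"

definition lincomb :: "nat \<Rightarrow> (nat \<Rightarrow> complex) \<Rightarrow> (nat \<Rightarrow> cvec) \<Rightarrow> cvec" where
  "lincomb n c b = (\<lambda>i. \<Sum>j<n. c j * b j i)"

definition cbasis :: "cvec set \<Rightarrow> nat \<Rightarrow> (nat \<Rightarrow> cvec) \<Rightarrow> bool" where
  "cbasis V n b \<longleftrightarrow> V = range (\<lambda>c. lincomb n c b) \<and>
     (\<forall>c. lincomb n c b = (\<lambda>_. 0) \<longrightarrow> (\<forall>j<n. c j = 0))"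

definition rep_dim :: "'a rep \<Rightarrow> nat" where
  "rep_dim \<rho> = (THE n. \<exists>b. cbasis (rep_space \<rho>) n b)"

definition complex_rep :: "('a, 'c) monoid_scheme \<Rightarrow> 'a topology \<Rightarrow> 'a rep \<Rightarrow> bool" where
  "complex_rep A Y \<rho> \<longleftrightarrow>
     (\<exists>n b. cbasis (rep_space \<rho>) n b) \<and>
     (\<forall>a\<in>carrier A. \<forall>u\<in>rep_space \<rho>. \<forall>v\<in>rep_space \<rho>. \<forall>c.
        rep_act \<rho> a (\<lambda>i. c * u i + v i) = (\<lambda>i. c * rep_act \<rho> a u i + rep_act \<rho> a v i)) \<and>
     (\<forall>v\<in>rep_space \<rho>. rep_act \<rho> \<one>\<^bsub>A\<^esub> v = v) \<and>
     (\<forall>a\<in>carrier A. \<forall>b\<in>carrier A. \<forall>v\<in>rep_space \<rho>.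
        rep_act \<rho> (a \<otimes>\<^bsub>A\<^esub> b) v = rep_act \<rho> a (rep_act \<rho> b v)) \<and>
     continuous_map (prod_topology Y (top_of_set (rep_space \<rho>))) (top_of_set (rep_space \<rho>))
       (\<lambda>(a, v). rep_act \<rho> a v)"

definition rep_fixed :: "'a rep \<Rightarrow> 'a set \<Rightarrow> cvec set" where
  "rep_fixed \<rho> L = {v \<in> rep_space \<rho>. \<forall>l\<in>L. rep_act \<rho> l v = v}"

definition zero_rep :: "'a rep" where
  "zero_rep = \<lparr>rep_space = {\<lambda>_. 0}, rep_act = (\<lambda>a v. v)\<rparr>"

text \<open>Direct sum, with the two summands in the even and the odd coordinates.\<close>

definition rep_sum :: "'a rep \<Rightarrow> 'a rep \<Rightarrow> 'a rep" where
  "rep_sum \<rho> \<rho>' =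
    \<lparr>rep_space = {w. (\<lambda>j. w (2 * j)) \<in> rep_space \<rho> \<and> (\<lambda>j. w (2 * j + 1)) \<in> rep_space \<rho>'},
     rep_act = (\<lambda>a w i. if even i then rep_act \<rho> a (\<lambda>j. w (2 * j)) (i div 2)
                         else rep_act \<rho>' a (\<lambda>j. w (2 * j + 1)) (i div 2))\<rparr>"

text \<open>The bundle \<open>EA \<times>\<^sub>A V \<rightarrow> BA\<close>.\<close>

definition borel_point :: "('a, 'c) monoid_scheme \<Rightarrow> 'a rep \<Rightarrow> 'a milnor \<times> cvec \<Rightarrow> ('a milnor \<times> cvec) set" where
  "borel_point A \<rho> p =
     (\<lambda>a. (milnor_act A (fst p) a, rep_act \<rho> (inv\<^bsub>A\<^esub> a) (snd p))) ` carrier A"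

definition borel_space ::
  "('a, 'c) monoid_scheme \<Rightarrow> 'a topology \<Rightarrow> 'a rep \<Rightarrow> ('a milnor \<times> cvec) set topology" where
  "borel_space A Y \<rho> =
     quotient_topology (prod_topology (universal_space A Y) (top_of_set (rep_space \<rho>))) (borel_point A \<rho>)"

definition borel_nonzero :: "('a, 'c) monoid_scheme \<Rightarrow> 'a rep \<Rightarrow> ('a milnor \<times> cvec) set set" where
  "borel_nonzero A \<rho> = borel_point A \<rho> ` (milnor_points A \<times> (rep_space \<rho> - {\<lambda>_. 0}))"

text \<open>For a complex basis \<open>b\<close> of \<open>V\<close> the affine \<open>2n\<close>-simplex with vertices
  \<open>-(1+i)(b\<^sub>0 + \<dots> + b\<^bsub>n-1\<^esub>), b\<^sub>0, i b\<^sub>0, b\<^sub>1, i b\<^sub>1, \<dots>\<close> has 0 in its interior and is positively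
  oriented, so it represents the generator of \<open>H\<^bsub>2n\<^esub>(V, V - 0)\<close> given by the complex orientation.
  \<open>orientation_simplex\<close> places it in the fibre of the bundle over the orbit of \<open>x\<close>.\<close>

definition orientation_simplex ::
  "('a, 'c) monoid_scheme \<Rightarrow> 'a rep \<Rightarrow> 'a milnor \<Rightarrow> nat \<Rightarrow> (nat \<Rightarrow> cvec) \<Rightarrow>
   (nat \<Rightarrow> real) \<Rightarrow> ('a milnor \<times> cvec) set" where
  "orientation_simplex A \<rho> x n b =
     (\<lambda>t\<in>standard_simplex (2 * n).
        borel_point A \<rho> (x, lincomb n (\<lambda>j. Complex (t (2 * j + 1) - t 0) (t (2 * j + 2) - t 0)) b))"

text \<open>Relative cocycles of \<open>(EA \<times>\<^sub>A V, EA \<times>\<^sub>A (V - 0))\<close> representing the Thom class.\<close>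

definition thom_cocycle ::
  "('a, 'c) monoid_scheme \<Rightarrow> 'a topology \<Rightarrow> 'a rep \<Rightarrow> ('a milnor \<times> cvec) set cochain \<Rightarrow> bool" where
  "thom_cocycle A Y \<rho> \<phi> \<longleftrightarrow>
     \<phi> \<in> cocycles (borel_space A Y \<rho>) \<and>
     (\<forall>p. p \<noteq> 2 * rep_dim \<rho> \<longrightarrow> \<phi> p = (\<lambda>_. 0)) \<and>
     (\<forall>p \<sigma>. singular_simplex p (subtopology (borel_space A Y \<rho>) (borel_nonzero A \<rho>)) \<sigma> \<longrightarrow> \<phi> p \<sigma> = 0) \<and>
     (\<forall>x\<in>milnor_points A. \<forall>b. cbasis (rep_space \<rho>) (rep_dim \<rho>) b \<longrightarrow>
        \<phi> (2 * rep_dim \<rho>) (orientation_simplex A \<rho> x (rep_dim \<rho>) b) = 1)"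

text \<open>The Euler class is the restriction of the Thom class to the zero section.  All Thom cocycles
  give the same cohomology class (a coset of coboundaries), so the union is this class.\<close>

definition zero_section :: "'a milnor set \<Rightarrow> ('a milnor \<times> cvec) set" where
  "zero_section b = b \<times> {\<lambda>_. 0}"

definition euler_class ::
  "('a, 'c) monoid_scheme \<Rightarrow> 'a topology \<Rightarrow> 'a rep \<Rightarrow> 'a milnor set cochain set" where
  "euler_class A Y \<rho> =
     \<Union>{cohomology_class (classifying_space A Y)
          (cochain_pullback (classifying_space A Y) zero_section \<phi>) | \<phi>. thom_cocycle A Y \<rho> \<phi>}"


section \<open>Flags of subgroups and the coefficient rings\<close>

text \<open>A flag \<open>K\<^sub>0 \<supset> \<dots> \<supset> K\<^sub>s\<close> is the list \<open>[K\<^sub>0, \<dots>, K\<^sub>s]\<close>.  A quotient of a subgroup of \<open>\<Gamma>\<close> by \<open>L\<close> consists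
  of right cosets \<open>L #> g\<close>; all homomorphisms below between such quotients are given by
  operations on cosets as subsets of \<open>\<Gamma>\<close>.\<close>

type_synonym 'g flag = "'g set list"
type_synonym 'g hcls = "'g set milnor set cochain set"
type_synonym 'g coeff = "('g hcls \<times> 'g hcls) set"

locale toral_setup =
  fixes \<Gamma> :: "'g monoid" (structure) and X :: "'g topology" and T :: "'g set"
begin

definition W :: "'g set monoid" where
  "W = weyl \<Gamma> T"

definition toral_subgroup :: "'g set \<Rightarrow> bool" where
  "toral_subgroup K \<longleftrightarrow> subgroup K \<Gamma> \<and> K \<subseteq> T \<and> closedin X K"

definition cotoral :: "'g set \<Rightarrow> 'g set \<Rightarrow> bool" where
  "cotoral L K \<longleftrightarrow> toral_subgroup L \<and> toral_subgroup K \<and> L \<subseteq> K \<and>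
     torus_group ((\<Gamma>\<lparr>carrier := K\<rparr>) Mod L) (quotient_topology (subtopology X K) (\<lambda>k. L #> k))"

definition flag :: "'g flag \<Rightarrow> bool" where
  "flag E \<longleftrightarrow> E \<noteq> [] \<and> (\<forall>K\<in>set E. toral_subgroup K) \<and>
     sorted_wrt (\<lambda>K L. L \<subset> K \<and> cotoral L K) E"

definition subgroup_conj :: "'g set \<Rightarrow> 'g set \<Rightarrow> 'g set" where
  "subgroup_conj w K = {inv n \<otimes> k \<otimes> n | n k. n \<in> w \<and> k \<in> K}"

definition flag_conj :: "'g set \<Rightarrow> 'g flag \<Rightarrow> 'g flag" where
  "flag_conj w E = map (subgroup_conj w) E"

definition flag_normalizer :: "'g flag \<Rightarrow> 'g set" where
  "flag_normalizer E = (\<Inter>K\<in>set E. normalizer \<Gamma> K)"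

definition flag_group :: "'g flag \<Rightarrow> 'g set monoid" where
  "flag_group E = (\<Gamma>\<lparr>carrier := flag_normalizer E\<rparr>) Mod last E"

definition flag_group_topology :: "'g flag \<Rightarrow> 'g set topology" where
  "flag_group_topology E =
     quotient_topology (subtopology X (flag_normalizer E)) (\<lambda>g. last E #> g)"

definition flag_group_id_comp :: "'g flag \<Rightarrow> 'g set monoid" where
  "flag_group_id_comp E = (flag_group E)\<lparr>carrier :=
     connected_component_of_set (flag_group_topology E) \<one>\<^bsub>flag_group E\<^esub>\<rparr>"

text \<open>An element of the Weyl group of the identity component with respect to \<open>T/K\<^sub>s\<close> is a coset of
  \<open>T/K\<^sub>s\<close>; its union is the corresponding coset of \<open>T\<close>, an element of \<open>W\<close>.\<close>

definition W_id_comp :: "'g flag \<Rightarrow> 'g set set" where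
  "W_id_comp E = \<Union> ` carrier (weyl (flag_group_id_comp E) ((\<lambda>t. last E #> t) ` T))"

definition quot :: "'g set \<Rightarrow> 'g set monoid" where
  "quot L = (\<Gamma>\<lparr>carrier := T\<rparr>) Mod L"

definition quot_topology :: "'g set \<Rightarrow> 'g set topology" where
  "quot_topology L = quotient_topology (subtopology X T) (\<lambda>t. L #> t)"

definition B :: "'g set \<Rightarrow> 'g set milnor set topology" where
  "B L = classifying_space (quot L) (quot_topology L)"

definition H :: "'g set \<Rightarrow> 'g hcls graded_ring" where
  "H L = cohomology (B L)"

definition euler :: "'g set \<Rightarrow> 'g set rep \<Rightarrow> 'g hcls" where
  "euler L V = euler_class (quot L) (quot_topology L) V"

definition quot_rep :: "'g set \<Rightarrow> 'g set \<Rightarrow> 'g set rep \<Rightarrow> bool" where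
  "quot_rep K L V \<longleftrightarrow> complex_rep (quot L) (quot_topology L) V \<and>
     rep_fixed V ((\<lambda>k. L #> k) ` K) = {\<lambda>_. 0}"

definition Eul :: "'g set \<Rightarrow> 'g set \<Rightarrow> 'g hcls set" where
  "Eul K L = euler L ` Collect (quot_rep K L)"

definition Ra :: "'g flag \<Rightarrow> 'g coeff graded_ring" where
  "Ra = (\<lambda>E\<in>Collect flag. loc_ring (H (last E)) (Eul (hd E) (last E)))"

text \<open>Inflation \<open>H\<^sup>*(BT/L) \<rightarrow> H\<^sup>*(BT/L')\<close> for \<open>L' \<subseteq> L\<close>.\<close>

definition infl :: "'g set \<Rightarrow> 'g set \<Rightarrow> 'g hcls \<Rightarrow> 'g hcls" where
  "infl L L' = cohomology_map (B L') (classifying_map (quot L) (\<lambda>D. L <#> D))"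

definition Ra_map :: "'g flag \<Rightarrow> 'g flag \<Rightarrow> 'g coeff \<Rightarrow> 'g coeff" where
  "Ra_map F E = loc_map (H (last F)) (Eul (hd F) (last F)) (H (last E)) (Eul (hd E) (last E))
     (infl (last F) (last E))"

text \<open>The conjugation \<open>T/K\<^sup>w \<rightarrow> T/K\<close>, \<open>t \<mapsto> n t n\<^sup>-\<^sup>1\<close> for \<open>n \<in> w\<close>, which does not depend on \<open>n\<close> since \<open>T\<close> is abelian.\<close>

definition coset_conj :: "'g set \<Rightarrow> 'g set \<Rightarrow> 'g set" where
  "coset_conj w D = {n \<otimes> d \<otimes> inv n | n d. n \<in> w \<and> d \<in> D}"

definition Ra_conj :: "'g set \<Rightarrow> 'g flag \<Rightarrow> 'g coeff \<Rightarrow> 'g coeff" where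
  "Ra_conj w E =
    (let E' = flag_conj w E in
     loc_map (H (last E)) (Eul (hd E) (last E)) (H (last E')) (Eul (hd E') (last E'))
       (cohomology_map (B (last E')) (classifying_map (quot (last E)) (coset_conj w))))"

definition Rinv :: "'g flag \<Rightarrow> 'g coeff graded_ring" where
  "Rinv = (\<lambda>E\<in>Collect flag.
     let I = {x \<in> carrier (Ra E). \<forall>w\<in>W_id_comp E. Ra_conj w E x = x} in
     (Ra E)\<lparr>carrier := I, rcomp := (\<lambda>n. rcomp (Ra E) n \<inter> I)\<rparr>)"

end


section \<open>The categories of modules\<close>

type_synonym ('g, 'm) tens = "('g coeff \<times> 'm \<Rightarrow>\<^sub>0 int) set"
type_synonym ('g, 'm) frac_family = "(('g set \<Rightarrow> ('g, 'm) tens) \<times> 'g rep) set"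

text \<open>\<open>fac M K n\<close> is the degree \<open>n\<close> part of the specified factorization at \<open>K\<close>.\<close>

record ('g, 'm) toral_module =
  Md :: "'g flag \<Rightarrow> ('g coeff, 'm) graded_module"
  str :: "'g flag \<Rightarrow> 'g flag \<Rightarrow> 'm \<Rightarrow> 'm"
  wact :: "'g set \<Rightarrow> 'g flag \<Rightarrow> 'm \<Rightarrow> 'm"
  fac :: "'g set \<Rightarrow> int \<Rightarrow> 'm \<Rightarrow> ('g, 'm) frac_family"

record ('o, 'a) cat =
  Ob :: "'o set"
  Hom :: "'o \<Rightarrow> 'o \<Rightarrow> 'a set"
  Ident :: "'o \<Rightarrow> 'a"
  Comp :: "'o \<Rightarrow> 'a \<Rightarrow> 'a \<Rightarrow> 'a"

context toral_setup
begin

text \<open>In this context \<open>R\<close> is a system of subrings \<open>R(E)\<close> of \<open>R\<^sub>a(E)\<close>, stable under \<open>Ra_map\<close> and \<open>Ra_conj\<close>; it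
  is \<open>Rinv\<close> for the toral model and \<open>Ra\<close> for the equivariant model.\<close>

definition equivariant_module ::
  "('g flag \<Rightarrow> 'g coeff graded_ring) \<Rightarrow> ('g, 'm) toral_module \<Rightarrow> bool" where
  "equivariant_module R M \<longleftrightarrow>
     (\<forall>E. flag E \<longrightarrow> is_graded_module (R E) (Md M E)) \<and>
     (\<forall>F E. flag F \<and> flag E \<and> set F \<subseteq> set E \<longrightarrow>
        graded_semilinear (R F) (Ra_map F E) (Md M F) (Md M E) (str M F E)) \<and>
     (\<forall>E m. flag E \<and> m \<in> carrier (Md M E) \<longrightarrow> str M E E m = m) \<and>
     (\<forall>D F E m. flag D \<and> flag F \<and> flag E \<and> set D \<subseteq> set F \<and> set F \<subseteq> set E \<and> m \<in> carrier (Md M D) \<longrightarrow>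
        str M F E (str M D F m) = str M D E m) \<and>
     (\<forall>w\<in>carrier W. \<forall>E. flag E \<longrightarrow>
        graded_semilinear (R E) (Ra_conj w E) (Md M E) (Md M (flag_conj w E)) (wact M w E)) \<and>
     (\<forall>w\<in>carrier W. \<forall>F E. \<forall>m\<in>carrier (Md M F). flag F \<and> flag E \<and> set F \<subseteq> set E \<longrightarrow>
        wact M w E (str M F E m) = str M (flag_conj w F) (flag_conj w E) (wact M w F m)) \<and>
     (\<forall>E. \<forall>m\<in>carrier (Md M E). flag E \<longrightarrow> wact M \<one>\<^bsub>W\<^esub> E m = m) \<and>
     (\<forall>v\<in>carrier W. \<forall>w\<in>carrier W. \<forall>E. \<forall>m\<in>carrier (Md M E). flag E \<longrightarrow>
        wact M (v \<otimes>\<^bsub>W\<^esub> w) E m = wact M w (flag_conj v E) (wact M v E m))"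

definition id_comp_acts_trivially :: "('g, 'm) toral_module \<Rightarrow> bool" where
  "id_comp_acts_trivially M \<longleftrightarrow>
     (\<forall>E. flag E \<longrightarrow> (\<forall>w\<in>W_id_comp E. \<forall>m\<in>carrier (Md M E). wact M w E m = m))"

text \<open>For \<open>K \<in> E\<close> the map \<open>R(E) \<otimes>\<^bsub>R(K)\<^esub> M(K) \<rightarrow> M(E)\<close> is an isomorphism.\<close>

definition base_change_iso ::
  "('g flag \<Rightarrow> 'g coeff graded_ring) \<Rightarrow> ('g, 'm) toral_module \<Rightarrow> 'g flag \<Rightarrow> 'g set \<Rightarrow> bool" where
  "base_change_iso R M E K \<longleftrightarrow>
     bij_betw (tensor_eval (Md M E) (str M [K] E))
       (carrier (tensor (R [K]) (R E) (Ra_map [K] E) (Md M [K]))) (carrier (Md M E))"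

definition quasi_coherent :: "('g flag \<Rightarrow> 'g coeff graded_ring) \<Rightarrow> ('g, 'm) toral_module \<Rightarrow> bool" where
  "quasi_coherent R M \<longleftrightarrow> (\<forall>E. flag E \<longrightarrow> base_change_iso R M E (last E))"

definition extended :: "('g flag \<Rightarrow> 'g coeff graded_ring) \<Rightarrow> ('g, 'm) toral_module \<Rightarrow> bool" where
  "extended R M \<longleftrightarrow> (\<forall>E. flag E \<longrightarrow> base_change_iso R M E (hd E))"

text \<open>The module \<open>N(L) = R\<^sub>a(L) \<otimes>\<^bsub>R(L)\<^esub> M(L)\<close>, and the unit \<open>H\<^sup>*(BT/L) \<rightarrow> R\<^sub>a(L)\<close> (localization at \<open>e(0) = 1\<close>).\<close>

definition N :: "('g flag \<Rightarrow> 'g coeff graded_ring) \<Rightarrow> ('g, 'm) toral_module \<Rightarrow> 'g set \<Rightarrow>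
    ('g coeff, ('g, 'm) tens) graded_module" where
  "N R M L = tensor (R [L]) (Ra [L]) (\<lambda>r. r) (Md M [L])"

definition \<eta> :: "'g set \<Rightarrow> 'g hcls \<Rightarrow> 'g coeff" where
  "\<eta> L h = fraction (H L) (Eul L L) h \<one>\<^bsub>H L\<^esub>"

definition cotorals :: "'g set \<Rightarrow> 'g set set" where
  "cotorals K = {L. cotoral L K}"

text \<open>The degenerate chain \<open>K \<supseteq> K\<close> is read as the flag \<open>(K)\<close>.\<close>

definition pair_flag :: "'g set \<Rightarrow> 'g set \<Rightarrow> 'g flag" where
  "pair_flag K L = (if L = K then [K] else [K, L])"

definition denominator :: "'g set \<Rightarrow> 'g rep \<Rightarrow> bool" where
  "denominator K V \<longleftrightarrow> complex_rep (\<Gamma>\<lparr>carrier := T\<rparr>) (subtopology X T) V \<and> rep_fixed V K = {\<lambda>_. 0}"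

definition fixed_rep :: "'g rep \<Rightarrow> 'g set \<Rightarrow> 'g set rep" where
  "fixed_rep V L = \<lparr>rep_space = rep_fixed V L, rep_act = (\<lambda>D. rep_act V (SOME t. t \<in> D))\<rparr>"

definition infl_rep :: "'g set \<Rightarrow> 'g set rep \<Rightarrow> 'g rep" where
  "infl_rep L V = \<lparr>rep_space = rep_space V, rep_act = (\<lambda>t. rep_act V (L #> t))\<rparr>"

definition euler_fixed :: "'g rep \<Rightarrow> 'g set \<Rightarrow> 'g coeff" where
  "euler_fixed V L = \<eta> L (euler L (fixed_rep V L))"

text \<open>\<open>\<E>\<^sub>K\<^sup>-\<^sup>1 \<Prod>\<^bsub>L\<in>J\<^esub> N(L)\<close> as a graded abelian group.  In degree \<open>n\<close> it consists of fractions \<open>x / e(V)\<close>,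
  where multiplication by \<open>e(V)\<close> raises the degree in the \<open>L\<close>-factor by \<open>2 dim V\<^sup>L\<close>; thus \<open>x\<^sub>L\<close> has degree
  \<open>n + 2 dim V\<^sup>L\<close>.  Each degree is a group written multiplicatively (as a \<open>monoid\<close> record).\<close>

definition numerators ::
  "('g flag \<Rightarrow> 'g coeff graded_ring) \<Rightarrow> ('g, 'm) toral_module \<Rightarrow> 'g set set \<Rightarrow> int \<Rightarrow> 'g rep \<Rightarrow>
   ('g set \<Rightarrow> ('g, 'm) tens) set" where
  "numerators R M J n V = (\<Pi>\<^sub>E L\<in>J. mcomp (N R M L) (n + 2 * int (rep_dim (fixed_rep V L))))"

definition frac_prod ::
  "('g flag \<Rightarrow> 'g coeff graded_ring) \<Rightarrow> ('g, 'm) toral_module \<Rightarrow> 'g set \<Rightarrow> 'g set set \<Rightarrow> int \<Rightarrow>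
   ('g set \<Rightarrow> ('g, 'm) tens) \<Rightarrow> 'g rep \<Rightarrow> ('g, 'm) frac_family" where
  "frac_prod R M K J n x V = {(y, V'). denominator K V' \<and> y \<in> numerators R M J n V' \<and>
     (\<exists>U. denominator K U \<and> (\<forall>L\<in>J.
        euler_fixed U L \<odot>\<^bsub>N R M L\<^esub> (euler_fixed V' L \<odot>\<^bsub>N R M L\<^esub> x L) =
        euler_fixed U L \<odot>\<^bsub>N R M L\<^esub> (euler_fixed V L \<odot>\<^bsub>N R M L\<^esub> y L)))}"

definition loc_prod ::
  "('g flag \<Rightarrow> 'g coeff graded_ring) \<Rightarrow> ('g, 'm) toral_module \<Rightarrow> 'g set \<Rightarrow> 'g set set \<Rightarrow> int \<Rightarrow>
   ('g, 'm) frac_family monoid" where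
  "loc_prod R M K J n =
    \<lparr>carrier = {frac_prod R M K J n x V | x V. denominator K V \<and> x \<in> numerators R M J n V},
     monoid.mult = (\<lambda>P Q. \<Union>(x, V)\<in>P. \<Union>(y, V')\<in>Q. frac_prod R M K J n
        (\<lambda>L\<in>J. (euler_fixed V' L \<odot>\<^bsub>N R M L\<^esub> x L) \<oplus>\<^bsub>N R M L\<^esub> (euler_fixed V L \<odot>\<^bsub>N R M L\<^esub> y L))
        (rep_sum V V')),
     one = frac_prod R M K J n (\<lambda>L\<in>J. \<zero>\<^bsub>N R M L\<^esub>) zero_rep\<rparr>"

text \<open>The action of \<open>r = a / e(V) \<in> \<E>\<^bsub>K/L\<^esub>\<^sup>-\<^sup>1 H\<^sup>*(BT/L)\<close> of degree \<open>i\<close>, for \<open>J\<close> consisting of subgroups of \<open>L\<close>: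
  \<open>a\<close> acts on the \<open>L'\<close>-factor through inflation, and \<open>e(V)\<close> is inverted as the Euler class of the inflated
  representation.\<close>

definition loc_prod_smult ::
  "('g flag \<Rightarrow> 'g coeff graded_ring) \<Rightarrow> ('g, 'm) toral_module \<Rightarrow> 'g set \<Rightarrow> 'g set \<Rightarrow> 'g set set \<Rightarrow>
   int \<Rightarrow> 'g coeff \<Rightarrow> int \<Rightarrow> ('g, 'm) frac_family \<Rightarrow> ('g, 'm) frac_family" where
  "loc_prod_smult R M K L J i r n P = (THE Q. \<exists>a V x U.
     quot_rep K L V \<and> a \<in> rcomp (H L) (i + 2 * int (rep_dim V)) \<and>
     r = fraction (H L) (Eul K L) a (euler L V) \<and>
     denominator K U \<and> x \<in> numerators R M J n U \<and> P = frac_prod R M K J n x U \<and>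
     Q = frac_prod R M K J (i + n) (\<lambda>L'\<in>J. \<eta> L' (infl L L' a) \<odot>\<^bsub>N R M L'\<^esub> x L')
           (rep_sum (infl_rep L V) U))"

text \<open>The map \<open>\<E>\<^sub>K\<^sup>-\<^sup>1 \<Prod>\<^bsub>L\<in>J\<^esub> N(L) \<rightarrow> \<E>\<^bsub>K'\<^esub>\<^sup>-\<^sup>1 \<Prod>\<^bsub>L\<in>J'\<^esub> N'(L)\<close> induced by maps \<open>h L\<close>, where \<open>J' \<subseteq> J\<close>
  and \<open>K \<subseteq> K'\<close>.\<close>

definition loc_prod_map ::
  "('g flag \<Rightarrow> 'g coeff graded_ring) \<Rightarrow> ('g, 'm) toral_module \<Rightarrow> 'g set \<Rightarrow> 'g set set \<Rightarrow>
   ('g, 'm) toral_module \<Rightarrow> 'g set \<Rightarrow> 'g set set \<Rightarrow> ('g set \<Rightarrow> ('g, 'm) tens \<Rightarrow> ('g, 'm) tens) \<Rightarrow>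
   int \<Rightarrow> ('g, 'm) frac_family \<Rightarrow> ('g, 'm) frac_family" where
  "loc_prod_map R M K J M' K' J' h n P = (THE Q. \<exists>x V.
     denominator K V \<and> x \<in> numerators R M J n V \<and> P = frac_prod R M K J n x V \<and>
     Q = frac_prod R M' K' J' n (\<lambda>L\<in>J'. h L (x L)) V)"

text \<open>\<open>\<E>\<^bsub>K/L\<^esub>\<^sup>-\<^sup>1 R\<^sub>a(L) \<otimes>\<^bsub>R(L)\<^esub> M(L)\<close>, where \<open>\<E>\<^bsub>K/L\<^esub>\<^sup>-\<^sup>1 R\<^sub>a(L)\<close> is \<open>R\<^sub>a(K \<supseteq> L)\<close>.\<close>

definition N_loc :: "('g flag \<Rightarrow> 'g coeff graded_ring) \<Rightarrow> ('g, 'm) toral_module \<Rightarrow> 'g set \<Rightarrow> 'g set \<Rightarrow>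
    ('g coeff, ('g, 'm) tens) graded_module" where
  "N_loc R M K L =
     tensor (R [L]) (Ra (pair_flag K L)) (Ra_map [L] (pair_flag K L)) (Md M [L])"

text \<open>The \<open>L\<close>-component of \<open>M(K) \<rightarrow> \<Prod>\<^sub>L \<E>\<^bsub>K/L\<^esub>\<^sup>-\<^sup>1 R\<^sub>a(L) \<otimes>\<^bsub>R(L)\<^esub> M(L)\<close>, namely
  \<open>M(K) \<rightarrow> M(K \<supseteq> L) \<cong> R(K \<supseteq> L) \<otimes>\<^bsub>R(L)\<^esub> M(L) \<rightarrow> R\<^sub>a(K \<supseteq> L) \<otimes>\<^bsub>R(L)\<^esub> M(L)\<close>.\<close>

definition to_N_loc ::
  "('g flag \<Rightarrow> 'g coeff graded_ring) \<Rightarrow> ('g, 'm) toral_module \<Rightarrow> 'g set \<Rightarrow> 'g set \<Rightarrow> 'm \<Rightarrow> ('g, 'm) tens" where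
  "to_N_loc R M K L m =
    (let E = pair_flag K L in
     tensor_map (R [L]) (Ra E) (Ra_map [L] E) (Md M [L]) (\<lambda>r. r) (\<lambda>m. m)
       (inv_into (carrier (tensor (R [L]) (R E) (Ra_map [L] E) (Md M [L])))
          (tensor_eval (Md M E) (str M [L] E)) (str M [K] E m)))"

text \<open>The \<open>L\<close>-component \<open>x / e(V) \<mapsto> x\<^sub>L / e(V\<^sup>L)\<close> of the comparison map.\<close>

definition loc_prod_component ::
  "('g flag \<Rightarrow> 'g coeff graded_ring) \<Rightarrow> ('g, 'm) toral_module \<Rightarrow> 'g set \<Rightarrow> 'g set \<Rightarrow> int \<Rightarrow>
   ('g, 'm) frac_family \<Rightarrow> ('g, 'm) tens" where
  "loc_prod_component R M K L n P = (THE q. \<exists>x V.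
     denominator K V \<and> x \<in> numerators R M (cotorals K) n V \<and> P = frac_prod R M K (cotorals K) n x V \<and>
     q = fraction (H L) (Eul K L) \<one>\<^bsub>H L\<^esub> (euler L (fixed_rep V L)) \<odot>\<^bsub>N_loc R M K L\<^esub>
           tensor_map (R [L]) (Ra (pair_flag K L)) (Ra_map [L] (pair_flag K L)) (Md M [L])
             (Ra_map [L] (pair_flag K L)) (\<lambda>m. m) (x L))"

definition is_factorization ::
  "('g flag \<Rightarrow> 'g coeff graded_ring) \<Rightarrow> ('g, 'm) toral_module \<Rightarrow> 'g set \<Rightarrow> bool" where
  "is_factorization R M K \<longleftrightarrow>
     (\<forall>n. fac M K n \<in> hom ((add_monoid (Md M [K]))\<lparr>carrier := mcomp (Md M [K]) n\<rparr>)
                           (loc_prod R M K (cotorals K) n)) \<and>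
     (\<forall>i n. \<forall>r\<in>rcomp (R [K]) i. \<forall>m\<in>mcomp (Md M [K]) n.
        fac M K (i + n) (r \<odot>\<^bsub>Md M [K]\<^esub> m) =
        loc_prod_smult R M K K (cotorals K) i r n (fac M K n m)) \<and>
     (\<forall>n. \<forall>m\<in>mcomp (Md M [K]) n. \<forall>L\<in>cotorals K.
        loc_prod_component R M K L n (fac M K n m) = to_N_loc R M K L m)"

text \<open>Compatibility with composition: for \<open>L\<close> cotoral in \<open>K\<close> the square
  \<open>M(K) \<rightarrow> \<E>\<^sub>K\<^sup>-\<^sup>1 \<Prod>\<^bsub>L' \<subseteq> K\<^esub> N(L') \<rightarrow> \<E>\<^sub>K\<^sup>-\<^sup>1 \<Prod>\<^bsub>L' \<subseteq> L\<^esub> N(L')\<close> and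
  \<open>M(K) \<rightarrow> M(K \<supseteq> L) \<cong> R(K \<supseteq> L) \<otimes>\<^bsub>R(L)\<^esub> M(L) \<rightarrow> \<E>\<^sub>K\<^sup>-\<^sup>1 \<Prod>\<^bsub>L' \<subseteq> L\<^esub> N(L')\<close> commutes, the last map being
  \<open>r \<otimes> m' \<mapsto> r \<odot> fac m'\<close>.  An element of \<open>R(K \<supseteq> L) \<otimes>\<^bsub>R(L)\<^esub> M(L)\<close> is written as a sum of \<open>r\<^sub>j \<otimes> m'\<^sub>j\<close> with
  \<open>r\<^sub>j\<close> and \<open>m'\<^sub>j\<close> homogeneous.\<close>

definition factorizations_compose ::
  "('g flag \<Rightarrow> 'g coeff graded_ring) \<Rightarrow> ('g, 'm) toral_module \<Rightarrow> 'g set \<Rightarrow> 'g set \<Rightarrow> bool" where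
  "factorizations_compose R M K L \<longleftrightarrow>
     (\<forall>n. \<forall>m\<in>mcomp (Md M [K]) n. \<forall>(k::nat) r m' i.
        (\<forall>j<k. r j \<in> rcomp (R (pair_flag K L)) (i j) \<and> m' j \<in> mcomp (Md M [L]) (n - i j)) \<and>
        str M [K] (pair_flag K L) m =
          (\<Oplus>\<^bsub>Md M (pair_flag K L)\<^esub>j\<in>{..<k}.
             r j \<odot>\<^bsub>Md M (pair_flag K L)\<^esub> str M [L] (pair_flag K L) (m' j)) \<longrightarrow>
        loc_prod_map R M K (cotorals K) M K (cotorals L) (\<lambda>L' x. x) n (fac M K n m) =
        (\<Otimes>\<^bsub>loc_prod R M K (cotorals L) n\<^esub>j\<in>{..<k}.
           loc_prod_smult R M K L (cotorals L) (i j) (r j) (n - i j)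
             (loc_prod_map R M L (cotorals L) M K (cotorals L) (\<lambda>L' x. x) (n - i j)
                (fac M L (n - i j) (m' j)))))"

definition F_continuous :: "('g flag \<Rightarrow> 'g coeff graded_ring) \<Rightarrow> ('g, 'm) toral_module \<Rightarrow> bool" where
  "F_continuous R M \<longleftrightarrow>
     (\<forall>K. toral_subgroup K \<longrightarrow> is_factorization R M K) \<and>
     (\<forall>K L. cotoral L K \<longrightarrow> factorizations_compose R M K L)"

definition toral_morphism ::
  "('g flag \<Rightarrow> 'g coeff graded_ring) \<Rightarrow> ('g, 'm) toral_module \<Rightarrow> ('g, 'm) toral_module \<Rightarrow>
   ('g flag \<Rightarrow> 'm \<Rightarrow> 'm) \<Rightarrow> bool" where
  "toral_morphism R M M' f \<longleftrightarrow>
     f \<in> extensional (Collect flag) \<and>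
     (\<forall>E. flag E \<longrightarrow> f E \<in> extensional (carrier (Md M E)) \<and>
        graded_semilinear (R E) (\<lambda>r. r) (Md M E) (Md M' E) (f E)) \<and>
     (\<forall>F E. \<forall>m\<in>carrier (Md M F). flag F \<and> flag E \<and> set F \<subseteq> set E \<longrightarrow>
        f E (str M F E m) = str M' F E (f F m)) \<and>
     (\<forall>w\<in>carrier W. \<forall>E. \<forall>m\<in>carrier (Md M E). flag E \<longrightarrow>
        f (flag_conj w E) (wact M w E m) = wact M' w E (f E m)) \<and>
     (\<forall>K n. \<forall>m\<in>mcomp (Md M [K]) n. toral_subgroup K \<longrightarrow>
        fac M' K n (f [K] m) =
        loc_prod_map R M K (cotorals K) M' K (cotorals K)
          (\<lambda>L. tensor_map (R [L]) (Ra [L]) (\<lambda>r. r) (Md M' [L]) (\<lambda>r. r) (f [L])) n (fac M K n m))"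

definition module_category ::
  "('g flag \<Rightarrow> 'g coeff graded_ring) \<Rightarrow> ('g, 'm) toral_module set \<Rightarrow>
   (('g, 'm) toral_module, 'g flag \<Rightarrow> 'm \<Rightarrow> 'm) cat" where
  "module_category R Obs =
    \<lparr>Ob = Obs,
     Hom = (\<lambda>M M'. {f. M \<in> Obs \<and> M' \<in> Obs \<and> toral_morphism R M M' f}),
     Ident = (\<lambda>M. \<lambda>E\<in>Collect flag. \<lambda>m\<in>carrier (Md M E). m),
     Comp = (\<lambda>M g f. \<lambda>E\<in>Collect flag. compose (carrier (Md M E)) (g E) (f E))\<rparr>"

text \<open>\<open>\<A>(\<Gamma>, toral)\<close>.\<close>

definition toral_model :: "(('g, 'm) toral_module, 'g flag \<Rightarrow> 'm \<Rightarrow> 'm) cat" where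
  "toral_model =
     module_category Rinv
       {M. equivariant_module Rinv M \<and> id_comp_acts_trivially M \<and>
           quasi_coherent Rinv M \<and> extended Rinv M \<and> F_continuous Rinv M}"

text \<open>\<open>\<A>(T)[W]\<close>.\<close>

definition equivariant_model :: "(('g, 'm) toral_module, 'g flag \<Rightarrow> 'm \<Rightarrow> 'm) cat" where
  "equivariant_model =
     module_category Ra
       {M. equivariant_module Ra M \<and> quasi_coherent Ra M \<and> extended Ra M \<and> F_continuous Ra M}"

end

end

theory Submission
  imports Defs
begin

text \<open>
  The torus \<open>T\<close> is open in \<open>N\<close>, so every group \<open>W\<^sub>\<Gamma>(E)\<close> has identity component contained in \<open>T/K\<^sub>s\<close> and the
  Weyl groups of these components are trivial.  The identity of \<open>W\<close> acts trivially on \<open>R\<^sub>a(E)\<close> and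
  on every equivariant module, hence \<open>R\<^bsub>inv\<^esub> = R\<^sub>a\<close> and the triviality condition is empty.

  Openness of \<open>T\<close> is proved without Lie algebras.  In a chart \<open>\<psi>\<close> at the identity the
  multiplication satisfies \<open>norm (\<psi> (x y) - \<psi> x - \<psi> y) \<le> c * norm (\<psi> x) * norm (\<psi> y)\<close>, so there are no small
  subgroups, and elements of \<open>N\<close> near \<open>1\<close> centralize \<open>T\<close>.  If elements of \<open>N - T\<close> converged to
  \<open>1\<close>, a limit of their powers would give a one-parameter group commuting with \<open>T\<close>; it lies in \<open>T\<close> by
  maximality, and dividing by it would bring these elements closer to \<open>1\<close> than their cosets of \<open>T\<close> allow.
\<close>

section \<open>Second differences\<close>

text \<open>The equality of the models is literal, not an equivalence: both are
  \<open>module_category\<close> of a ring system and a set of objects, so \<open>Rinv\<close> and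
  \<open>Ra\<close> have to agree as functions, graded pieces included.

  The chart is taken in \<open>G\<close> itself, so the normalizer never has to be given a smooth
  structure. Smoothness is used once, as a bound on second differences of multiplication: along the
  two axes it is \<open>x \<otimes> \<one>\<close> and \<open>\<one> \<otimes> y\<close>, so its
  deviation from addition is controlled by a product of norms. The radius is normalized by
  \<open>c * r \<le> 1\<close>; the error of a product then never exceeds the norm of either factor,
  and powers \<open>x [^] k\<close> follow \<open>k *\<^sub>R \<psi> x\<close> up to scale
  \<open>r / 2\<close>.

  Two obstacles shape the limit argument. The functions from the reals to a compact group form a
  compact space that need not be sequentially compact, so the one-parameter group is a cluster point
  and each of its properties has to come from closed conditions. And powers with natural exponents
  give additivity for nonnegative times only, so the group is built on a half-line and inverses are
  added by hand.\<close>

lemma norm_linear_le_sum_Basis: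
  fixes f :: "'a::euclidean_space \<Rightarrow> 'b::real_normed_vector"
  assumes "linear f" and "\<And>b. b \<in> Basis \<Longrightarrow> norm (f b) \<le> B b"
  shows "norm (f x) \<le> (\<Sum>b\<in>Basis. B b) * norm x"
proof -
  have "f x = f (\<Sum>b\<in>Basis. (x \<bullet> b) *\<^sub>R b)"
    by (simp add: euclidean_representation)
  also have "\<dots> = (\<Sum>b\<in>Basis. (x \<bullet> b) *\<^sub>R f b)"
    using assms(1) by (simp add: linear_sum linear_scale)
  finally have "norm (f x) \<le> (\<Sum>b\<in>Basis. norm ((x \<bullet> b) *\<^sub>R f b))"
    by (simp only: norm_sum)
  also have "\<dots> \<le> (\<Sum>b\<in>Basis. norm x * B b)"
    by (intro sum_mono) (simp add: mult_mono Basis_le_norm assms(2))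
  finally show ?thesis
    by (simp add: sum_distrib_left mult.commute)
qed

text \<open>\<open>Ck_on\<close> controls the derivative in each fixed direction only. Compactness
  bounds it along the finitely many basis vectors, the sum of these bounds dominates the operator
  norm, and convexity lets the mean value inequality apply.\<close>

lemma C1_lipschitz_on_compact:
  fixes f :: "'a::euclidean_space \<Rightarrow> 'b::real_normed_vector"
  assumes f: "Ck_on (Suc 0) S f" and K: "convex K" "compact K" "K \<subseteq> S"
  obtains M where "0 \<le> M" "\<And>x y. x \<in> K \<Longrightarrow> y \<in> K \<Longrightarrow> norm (f x - f y) \<le> M * norm (x - y)"
proof -
  have "\<exists>B\<ge>0. \<forall>x\<in>K. norm (frechet_derivative f (at x) b) \<le> B" for b
  proof -
    have "continuous_on K (\<lambda>x. frechet_derivative f (at x) b)"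
      using f K(3) by (auto intro: continuous_on_subset)
    then have "bounded ((\<lambda>x. frechet_derivative f (at x) b) ` K)"
      using K(2) by (intro compact_imp_bounded compact_continuous_image)
    then show ?thesis
      unfolding bounded_pos by (meson imageI less_imp_le)
  qed
  then obtain B where B: "\<And>b. 0 \<le> B b" "\<And>b x. x \<in> K \<Longrightarrow> norm (frechet_derivative f (at x) b) \<le> B b"
    by metis
  have der: "(f has_derivative frechet_derivative f (at x)) (at x within K)" if "x \<in> K" for x
    using f K(3) that by (auto simp: subset_iff frechet_derivative_works intro: has_derivative_at_withinI)
  have "norm (f x - f y) \<le> (\<Sum>b\<in>Basis. B b) * norm (x - y)" if "x \<in> K" "y \<in> K" for x y
  proof (rule differentiable_bound[OF K(1) der _ that])
    fix z assume z: "z \<in> K"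
    show "onorm (frechet_derivative f (at z)) \<le> (\<Sum>b\<in>Basis. B b)"
      using has_derivative_linear[OF der[OF z]] B(2)[OF z]
      by (intro onorm_le norm_linear_le_sum_Basis) auto
  qed
  then show thesis
    using that[of "\<Sum>b\<in>Basis. B b"] B(1) by (simp add: sum_nonneg)
qed

text \<open>The second difference is an increment of \<open>f (p + z + k) - f (p + z)\<close> in
  \<open>z\<close>. The derivative of that function compares derivatives of \<open>f\<close> at
  points differing by \<open>k\<close>, which gives the factor \<open>norm k\<close>; the mean value
  inequality contributes \<open>norm h\<close>.\<close>

lemma C2_second_difference:
  fixes f :: "'a::euclidean_space \<Rightarrow> 'b::real_normed_vector"
  assumes f: "Ck_on (Suc (Suc 0)) S f" and S: "cball p r \<subseteq> S"
  obtains c where "0 \<le> c"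
    "\<And>h k. norm h + norm k \<le> r \<Longrightarrow>
       norm (f (p + h + k) - f (p + h) - f (p + k) + f p) \<le> c * norm h * norm k"
proof -
  have "\<exists>M\<ge>0. \<forall>x\<in>cball p r. \<forall>y\<in>cball p r.
      norm (frechet_derivative f (at x) b - frechet_derivative f (at y) b) \<le> M * norm (x - y)" for b
    using C1_lipschitz_on_compact[of S "\<lambda>x. frechet_derivative f (at x) b" "cball p r"] f S
    by (metis Ck_on.simps(2) compact_cball convex_cball)
  then obtain M where M: "\<And>b. 0 \<le> M b"
    "\<And>b x y. x \<in> cball p r \<Longrightarrow> y \<in> cball p r \<Longrightarrow>
      norm (frechet_derivative f (at x) b - frechet_derivative f (at y) b) \<le> M b * norm (x - y)"
    by metis
  have der: "(f has_derivative frechet_derivative f (at x)) (at x)" if "x \<in> cball p r" for x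
    using f S that by (auto simp: subset_iff frechet_derivative_works)
  define c where "c = (\<Sum>b\<in>Basis. M b)"
  have "norm (f (p + h + k) - f (p + h) - f (p + k) + f p) \<le> c * norm h * norm k"
    if hk: "norm h + norm k \<le> r" for h k
  proof -
    define g where "g z = f (p + z + k) - f (p + z)" for z
    define g' where "g' z u = frechet_derivative f (at (p + z + k)) u - frechet_derivative f (at (p + z)) u"
      for z u
    have mem: "p + z + k \<in> cball p r" "p + z \<in> cball p r" if "z \<in> cball 0 (norm h)" for z
      using that hk norm_triangle_ineq[of z k] norm_ge_zero[of k]
      by (auto simp: dist_norm norm_minus_commute add.assoc add.commute[of k z]
          simp del: norm_ge_zero)
    have g: "(g has_derivative g' z) (at z within cball 0 (norm h))" if "z \<in> cball 0 (norm h)" for z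
    proof -
      have sh: "((\<lambda>z. p + z + k) has_derivative (\<lambda>u. u)) (at z within cball 0 (norm h))"
        "((\<lambda>z. p + z) has_derivative (\<lambda>u. u)) (at z within cball 0 (norm h))"
        by (auto intro!: derivative_eq_intros)
      show ?thesis
        unfolding g_def g'_def
        using has_derivative_compose[OF sh(1), where g = f] has_derivative_compose[OF sh(2), where g = f]
          der[OF mem(1)[OF that]] der[OF mem(2)[OF that]]
        by (intro has_derivative_diff) blast+
    qed
    have on: "onorm (g' z) \<le> c * norm k" if z: "z \<in> cball 0 (norm h)" for z
    proof (rule onorm_le)
      fix u
      have "norm (g' z b) \<le> M b * norm k" for b
        using M(2)[OF mem(1)[OF z] mem(2)[OF z], of b] by (simp add: g'_def)
      then show "norm (g' z u) \<le> c * norm k * norm u"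
        using norm_linear_le_sum_Basis[OF has_derivative_linear[OF g[OF z]], of "\<lambda>b. M b * norm k" u]
        by (simp add: c_def sum_distrib_right)
    qed
    have "norm (g h - g 0) \<le> c * norm k * norm (h - 0)"
      by (rule differentiable_bound[OF convex_cball g on]) auto
    then show ?thesis
      by (simp add: g_def algebra_simps)
  qed
  moreover have "0 \<le> c"
    by (simp add: c_def M(1) sum_nonneg)
  ultimately show thesis
    using that by blast
qed

section \<open>Topological groups\<close>

lemma openin_prod_topologyE:
  assumes "openin (prod_topology X Y) W" "(x, y) \<in> W"
  obtains A B where "openin X A" "openin Y B" "x \<in> A" "y \<in> B" "A \<times> B \<subseteq> W"
  using assms unfolding openin_prod_topology_alt by metis

text \<open>The closed sets that eventually contain the sequence have the finite intersection
  property. This replaces convergent subsequences in a power of the group indexed by the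
  reals.\<close>

lemma compact_space_cluster_point:
  assumes "compact_space Y" "range p \<subseteq> topspace Y"
  obtains q where "q \<in> topspace Y"
    "\<And>C. closedin Y C \<Longrightarrow> eventually (\<lambda>n. p n \<in> C) sequentially \<Longrightarrow> q \<in> C"
proof -
  let ?\<U> = "{C. closedin Y C \<and> eventually (\<lambda>n. p n \<in> C) sequentially}"
  have "\<Inter>\<F> \<noteq> {}" if "finite \<F>" "\<F> \<subseteq> ?\<U>" for \<F>
  proof -
    have "eventually (\<lambda>n. \<forall>C\<in>\<F>. p n \<in> C) sequentially"
      using that by (intro eventually_ball_finite) auto
    then obtain n where "\<forall>C\<in>\<F>. p n \<in> C"
      using eventually_happens' sequentially_bot by blast
    then show ?thesis
      by blast
  qed
  then have "\<Inter>?\<U> \<noteq> {}"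
    using assms(1) unfolding compact_space_fip by (metis (no_types, lifting) mem_Collect_eq)
  then obtain q where q: "q \<in> \<Inter>?\<U>"
    by blast
  moreover have "topspace Y \<in> ?\<U>"
    using assms(2) by (auto simp: subset_iff)
  ultimately show thesis
    using that by blast
qed

locale Hausdorff_group = group G for G :: "'a monoid" (structure) +
  fixes X :: "'a topology"
  assumes topological_group: "topological_group G X"
    and Hausdorff_space: "Hausdorff_space X"
begin

lemma topspace: "topspace X = carrier G"
  using topological_group by (simp add: topological_group_def)

lemma continuous_map_mult:
  assumes "continuous_map Y X f" "continuous_map Y X g"
  shows "continuous_map Y X (\<lambda>y. f y \<otimes> g y)"
proof -
  have "continuous_map (prod_topology X X) X (\<lambda>(x, y). x \<otimes> y)"
    using topological_group by (simp add: topological_group_def)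
  from continuous_map_compose[OF continuous_map_pairedI[OF assms] this] show ?thesis
    by (simp add: o_def)
qed

lemma continuous_map_inv:
  assumes "continuous_map Y X f"
  shows "continuous_map Y X (\<lambda>y. inv (f y))"
proof -
  have "continuous_map X X (\<lambda>x. inv x)"
    using topological_group by (simp add: topological_group_def)
  from continuous_map_compose[OF assms this] show ?thesis
    by (simp add: o_def)
qed

lemma continuous_map_const_group: "a \<in> carrier G \<Longrightarrow> continuous_map Y X (\<lambda>y. a)"
  by (simp add: topspace)

lemmas group_continuous_intros = continuous_map_mult continuous_map_inv continuous_map_const_group
  continuous_map_fst continuous_map_snd continuous_map_id[unfolded id_def]

text \<open>A pair from the closure of \<open>S\<close> lies in the closure of
  \<open>S \<times> S\<close>, and the preimage of \<open>A\<close> under \<open>f\<close> is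
  closed. Taking \<open>f\<close> independent of its second argument covers inversion as well as
  multiplication.\<close>

lemma closure_of_eq_on:
  assumes f: "continuous_map (prod_topology X X) X (\<lambda>p. f (fst p) (snd p))"
    and A: "closedin X A" and S: "\<And>x y. x \<in> S \<Longrightarrow> y \<in> S \<Longrightarrow> f x y \<in> A"
    and xy: "x \<in> X closure_of S" "y \<in> X closure_of S"
  shows "f x y \<in> A"
proof -
  have "(x, y) \<in> prod_topology X X closure_of (S \<times> S)"
    using xy by (simp add: closure_of_Times)
  then have "f (fst (x, y)) (snd (x, y)) \<in> A"
    by (rule forall_in_closure_of) (use S closedin_continuous_map_preimage[OF f A] in auto)
  then show ?thesis
    by simp
qed

lemma subgroup_closure_of:
  assumes H: "subgroup H G"
  shows "subgroup (X closure_of H) G"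
proof
  have sub: "H \<subseteq> X closure_of H"
    using subgroup.subset[OF H] topspace by (simp add: closure_of_subset)
  show "X closure_of H \<subseteq> carrier G"
    using closure_of_subset_topspace topspace by metis
  show "x \<otimes> y \<in> X closure_of H" if "x \<in> X closure_of H" "y \<in> X closure_of H" for x y
    by (rule closure_of_eq_on[OF _ _ _ that])
       (use sub subgroup.m_closed[OF H] in \<open>auto intro: group_continuous_intros\<close>)
  show "\<one> \<in> X closure_of H"
    using sub subgroup.one_closed[OF H] by blast
  show "inv x \<in> X closure_of H" if "x \<in> X closure_of H" for x
    by (rule closure_of_eq_on[OF _ _ _ that that, of "\<lambda>x y. inv x"])
       (use sub subgroup.m_inv_closed[OF H] in \<open>auto intro: group_continuous_intros\<close>)
qed

lemma commute_closure_of: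
  assumes H: "subgroup H G" and comm: "\<And>x y. x \<in> H \<Longrightarrow> y \<in> H \<Longrightarrow> x \<otimes> y = y \<otimes> x"
    and xy: "x \<in> X closure_of H" "y \<in> X closure_of H"
  shows "x \<otimes> y = y \<otimes> x"
proof -
  have cl: "closedin (prod_topology X X)
      {p \<in> topspace (prod_topology X X). fst p \<otimes> snd p = snd p \<otimes> fst p}"
    by (intro closedin_continuous_maps_eq[OF Hausdorff_space] group_continuous_intros)
  have "(x, y) \<in> prod_topology X X closure_of (H \<times> H)"
    using xy by (simp add: closure_of_Times)
  then have "fst (x, y) \<otimes> snd (x, y) = snd (x, y) \<otimes> fst (x, y)"
    by (rule forall_in_closure_of[OF _ _ cl]) (use comm in auto)
  then show ?thesis
    by simp
qed

lemma topological_group_subgroup: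
  assumes S: "subgroup S G"
  shows "topological_group (G\<lparr>carrier := S\<rparr>) (subtopology X S)"
proof -
  have SG: "S \<subseteq> carrier G"
    using S by (rule subgroup.subset)
  have "continuous_map (prod_topology (subtopology X S) (subtopology X S)) (subtopology X S)
      (\<lambda>p. fst p \<otimes> snd p)"
    using subgroup.m_closed[OF S] unfolding subtopology_Times[symmetric]
    by (intro continuous_map_into_subtopology continuous_map_from_subtopology group_continuous_intros)
       auto
  moreover have "continuous_map (subtopology X S) (subtopology X S) (\<lambda>x. inv x)"
    using subgroup.m_inv_closed[OF S]
    by (intro continuous_map_into_subtopology continuous_map_from_subtopology group_continuous_intros)
       auto
  then have "continuous_map (subtopology X S) (subtopology X S) (\<lambda>x. inv\<^bsub>G\<lparr>carrier := S\<rparr>\<^esub> x)"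
    by (rule continuous_map_eq) (use m_inv_consistent[OF S] in auto)
  ultimately show ?thesis
    using SG subgroup_imp_group[OF S] by (auto simp: topological_group_def topspace case_prod_unfold)
qed

text \<open>Closure preserves being a subgroup, commutativity and connectedness, and adds
  compactness. This is the source of the tori that are compared with a maximal one.\<close>

lemma torus_in_closure_of:
  assumes "compact_space X" and H: "subgroup H G" "connectedin X H"
    and comm: "\<And>x y. x \<in> H \<Longrightarrow> y \<in> H \<Longrightarrow> x \<otimes> y = y \<otimes> x"
  shows "torus_in G X (X closure_of H)"
proof -
  let ?S = "X closure_of H"
  have S: "subgroup ?S G"
    by (rule subgroup_closure_of[OF H(1)])
  have "comm_group (G\<lparr>carrier := ?S\<rparr>)"
    using subgroup_imp_group[OF S] commute_closure_of[OF H(1) comm]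
    by (intro group.group_comm_groupI) auto
  moreover have "compact_space (subtopology X ?S)"
    using assms(1) closedin_compact_space closedin_closure_of compact_space_subtopology by blast
  moreover have "connected_space (subtopology X ?S)"
    using connectedin_closure_of[OF H(2)] by (simp add: connectedin_def)
  ultimately show ?thesis
    using S topological_group_subgroup[OF S] by (simp add: torus_in_def torus_group_def)
qed

end

section \<open>Charts at the identity\<close>

text \<open>All that is kept of the Lie structure: a centred chart in which multiplication is
  addition up to a bilinear error. The closed set \<open>A\<close> in
  \<open>closedin_chart_ball\<close> lets coordinate estimates pass to cluster points.\<close>

locale group_chart = Hausdorff_group +
  fixes U :: "'a set" and \<psi> :: "'a \<Rightarrow> 'e::euclidean_space" and r c :: real
  assumes compact_space: "compact_space X"
    and one_in: "\<one> \<in> U" and chart_one: "\<psi> \<one> = 0" and r_pos: "0 < r" and c_nonneg: "0 \<le> c"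
    and c_r: "c * r \<le> 1"
    and chart_eq_0: "x \<in> U \<Longrightarrow> \<psi> x = 0 \<Longrightarrow> x = \<one>"
    and closedin_chart_ball: "\<rho> \<le> r \<Longrightarrow> closed A \<Longrightarrow> closedin X {x \<in> U. norm (\<psi> x) \<le> \<rho> \<and> \<psi> x \<in> A}"
    and openin_chart_ball: "\<rho> \<le> r \<Longrightarrow> openin X {x \<in> U. norm (\<psi> x) < \<rho>}"
    and chart_ball_basis: "openin X S \<Longrightarrow> \<one> \<in> S \<Longrightarrow> \<exists>\<rho>>0. \<rho> \<le> r \<and> {x \<in> U. norm (\<psi> x) \<le> \<rho>} \<subseteq> S"
    and mult_in: "x \<in> U \<Longrightarrow> y \<in> U \<Longrightarrow> norm (\<psi> x) \<le> r \<Longrightarrow> norm (\<psi> y) \<le> r \<Longrightarrow> x \<otimes> y \<in> U"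
    and chart_mult: "x \<in> U \<Longrightarrow> y \<in> U \<Longrightarrow> norm (\<psi> x) \<le> r \<Longrightarrow> norm (\<psi> y) \<le> r \<Longrightarrow>
      norm (\<psi> (x \<otimes> y) - \<psi> x - \<psi> y) \<le> c * norm (\<psi> x) * norm (\<psi> y)"

lemma compact_lie_group_chart:
  fixes G :: "'g monoid" and V :: "'e::euclidean_space set"
  assumes lie: "compact_lie_group G X V C"
  shows "\<exists>U (\<psi> :: 'g \<Rightarrow> 'e) r c. group_chart G X U \<psi> r c"
proof -
  interpret group G
    using lie by (simp add: compact_lie_group_def topological_group_def)
  have top: "topological_group G X" "compact_space X" "Hausdorff_space X" "subspace V"
    and carr: "topspace X = carrier G"
    using lie by (auto simp: compact_lie_group_def topological_group_def)
  have "\<one>\<^bsub>G\<^esub> \<in> (\<Union>(U, \<phi>)\<in>C. U)"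
    using lie by (simp add: compact_lie_group_def)
  then obtain U \<phi> where C: "(U, \<phi>) \<in> C" and U1: "\<one>\<^bsub>G\<^esub> \<in> U"
    by auto
  have U: "openin X U" and VU: "openin (top_of_set V) (\<phi> ` U)"
    and hom: "homeomorphic_map (subtopology X U) (top_of_set (\<phi> ` U)) \<phi>"
    and sm: "smooth_map_on {(a, b). a \<in> \<phi> ` U \<and> b \<in> \<phi> ` U \<and> inv_into U \<phi> a \<otimes>\<^bsub>G\<^esub> inv_into U \<phi> b \<in> U}
          (\<lambda>(a, b). \<phi> (inv_into U \<phi> a \<otimes>\<^bsub>G\<^esub> inv_into U \<phi> b))"
    using lie C unfolding compact_lie_group_def by blast+
  have UG: "U \<subseteq> carrier G"
    using U carr openin_subset by blast
  then have topU: "topspace (subtopology X U) = U"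
    using carr by auto
  have inj: "inj_on \<phi> U"
    using homeomorphic_imp_injective_map[OF hom] topU by simp
  have cont: "continuous_map (subtopology X U) (top_of_set (\<phi> ` U)) \<phi>"
    using hom by (simp add: homeomorphic_imp_continuous_map)
  have closedV: "closed V"
    using top(4) by (rule closed_subspace)
  have nbhd: "\<exists>\<delta>>0. V \<inter> cball (\<phi> \<one>\<^bsub>G\<^esub>) \<delta> \<subseteq> \<phi> ` (S \<inter> U)" if "openin X S" "\<one>\<^bsub>G\<^esub> \<in> S" for S
  proof -
    have "openin (subtopology X U) (S \<inter> U)"
      using that(1) by (simp add: openin_subtopology_Int)
    then have "openin (top_of_set (\<phi> ` U)) (\<phi> ` (S \<inter> U))"
      using homeomorphic_map_openness_eq[OF hom] topU by auto
    then have "openin (top_of_set V) (\<phi> ` (S \<inter> U))"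
      using VU openin_trans by blast
    moreover have "\<phi> \<one>\<^bsub>G\<^esub> \<in> \<phi> ` (S \<inter> U)"
      using that U1 by blast
    ultimately show ?thesis
      unfolding openin_contains_cball by blast
  qed
  define \<psi> where "\<psi> x = \<phi> x - \<phi> \<one>\<^bsub>G\<^esub>" for x
  have \<phi>: "\<phi> x = \<phi> \<one>\<^bsub>G\<^esub> + \<psi> x" for x
    by (simp add: \<psi>_def)
  obtain \<delta>0 where \<delta>0: "\<delta>0 > 0" "V \<inter> cball (\<phi> \<one>\<^bsub>G\<^esub>) \<delta>0 \<subseteq> \<phi> ` U"
    using nbhd[OF U U1] by auto
  \<comment> \<open>The set is closed in all of \<open>X\<close>, not just in \<open>U\<close>: it
    corresponds to a compact piece of \<open>V\<close> inside the image of the chart, so it is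
    compact, and \<open>X\<close> is Hausdorff.\<close>
  have closed_ball: "closedin X {x \<in> U. norm (\<psi> x) \<le> \<rho> \<and> \<psi> x \<in> A}"
    if "\<rho> \<le> \<delta>0" "closed A" for \<rho> A
  proof -
    let ?K = "V \<inter> cball (\<phi> \<one>\<^bsub>G\<^esub>) \<rho> \<inter> (\<lambda>a. a - \<phi> \<one>\<^bsub>G\<^esub>) -` A"
    have "\<phi> ` {x \<in> U. norm (\<psi> x) \<le> \<rho> \<and> \<psi> x \<in> A} = ?K"
    proof
      show "\<phi> ` {x \<in> U. norm (\<psi> x) \<le> \<rho> \<and> \<psi> x \<in> A} \<subseteq> ?K"
        using openin_subset[OF VU] by (auto simp: \<psi>_def dist_norm norm_minus_commute)
      show "?K \<subseteq> \<phi> ` {x \<in> U. norm (\<psi> x) \<le> \<rho> \<and> \<psi> x \<in> A}"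
      proof
        fix a assume a: "a \<in> ?K"
        then have "a \<in> V \<inter> cball (\<phi> \<one>\<^bsub>G\<^esub>) \<delta>0"
          using that(1) by auto
        then obtain x where "x \<in> U" "a = \<phi> x"
          using \<delta>0(2) by blast
        then show "a \<in> \<phi> ` {x \<in> U. norm (\<psi> x) \<le> \<rho> \<and> \<psi> x \<in> A}"
          using a by (auto simp: \<psi>_def dist_norm norm_minus_commute)
      qed
    qed
    moreover have "closed ((\<lambda>a. a - \<phi> \<one>\<^bsub>G\<^esub>) -` A)"
      using that(2) by (intro continuous_closed_vimage) auto
    then have "compact ?K"
      using closedV by (simp add: closed_Int_compact compact_Int_closed)
    ultimately have "compactin (top_of_set (\<phi> ` U)) (\<phi> ` {x \<in> U. norm (\<psi> x) \<le> \<rho> \<and> \<psi> x \<in> A})"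
      by (metis (no_types, lifting) compactin_euclidean_iff compactin_subtopology image_mono mem_Collect_eq subsetI)
    then have "compactin (subtopology X U) {x \<in> U. norm (\<psi> x) \<le> \<rho> \<and> \<psi> x \<in> A}"
      using homeomorphic_map_compactness[OF hom] topU by (metis (no_types, lifting) mem_Collect_eq subsetI)
    then show ?thesis
      using compactin_imp_closedin[OF top(3)] compactin_subtopology by blast
  qed
  have open_ball: "openin X {x \<in> U. norm (\<psi> x) < \<rho>}" for \<rho>
  proof -
    have "openin (top_of_set (\<phi> ` U)) (\<phi> ` U \<inter> ball (\<phi> \<one>\<^bsub>G\<^esub>) \<rho>)"
      by (simp add: openin_open_Int)
    from openin_continuous_map_preimage[OF cont this]
    have "openin (subtopology X U) {x \<in> U. \<phi> x \<in> \<phi> ` U \<inter> ball (\<phi> \<one>\<^bsub>G\<^esub>) \<rho>}"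
      unfolding topU .
    moreover have "{x \<in> U. \<phi> x \<in> \<phi> ` U \<inter> ball (\<phi> \<one>\<^bsub>G\<^esub>) \<rho>} = {x \<in> U. norm (\<psi> x) < \<rho>}"
      by (auto simp: \<psi>_def dist_norm norm_minus_commute)
    ultimately have "openin (subtopology X U) {x \<in> U. norm (\<psi> x) < \<rho>}"
      by simp
    then show ?thesis
      using U openin_trans_full by blast
  qed
  have basis: "\<exists>\<rho>>0. \<forall>\<rho>'\<le>\<rho>. {x \<in> U. norm (\<psi> x) \<le> \<rho>'} \<subseteq> S" if S: "openin X S" "\<one>\<^bsub>G\<^esub> \<in> S" for S
  proof -
    obtain \<delta> where \<delta>: "\<delta> > 0" "V \<inter> cball (\<phi> \<one>\<^bsub>G\<^esub>) \<delta> \<subseteq> \<phi> ` (S \<inter> U)"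
      using nbhd[OF S] by blast
    have "x \<in> S" if "x \<in> U" "norm (\<psi> x) \<le> \<delta>" for x
    proof -
      have "\<phi> x \<in> V \<inter> cball (\<phi> \<one>\<^bsub>G\<^esub>) \<delta>"
        using that openin_subset[OF VU] by (auto simp: \<psi>_def dist_norm norm_minus_commute)
      then obtain y where "y \<in> S" "y \<in> U" "\<phi> y = \<phi> x"
        using \<delta>(2) by (smt (verit) IntE image_iff subset_eq)
      then show ?thesis
        using inj that(1) by (metis inj_onD)
    qed
    then show ?thesis
      using \<delta>(1) by (intro exI[of _ \<delta>]) auto
  qed
  let ?A = "{(a, b). a \<in> \<phi> ` U \<and> b \<in> \<phi> ` U \<and> inv_into U \<phi> a \<otimes>\<^bsub>G\<^esub> inv_into U \<phi> b \<in> U}"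
  let ?m = "\<lambda>(a, b). \<phi> (inv_into U \<phi> a \<otimes>\<^bsub>G\<^esub> inv_into U \<phi> b)"
  let ?p = "(\<phi> \<one>\<^bsub>G\<^esub>, \<phi> \<one>\<^bsub>G\<^esub>)"
  have inv\<phi>: "inv_into U \<phi> (\<phi> x) = x" if "x \<in> U" for x
    using inj that by simp
  have "?p \<in> ?A"
    using U1 inv\<phi> by auto
  \<comment> \<open>\<open>V\<close> may be a proper subspace, so derivatives are taken of the
    ambient extension \<open>F\<close>; in the end only its values at chart points enter.\<close>
  then obtain O' F where O': "open O'" "?p \<in> O'" and F: "\<And>k. Ck_on k O' F" "\<And>y. y \<in> O' \<inter> ?A \<Longrightarrow> F y = ?m y"
    using sm unfolding smooth_map_on_def by (metis (no_types, lifting))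
  obtain \<delta>1 where \<delta>1: "\<delta>1 > 0" "cball ?p \<delta>1 \<subseteq> O'"
    using O' open_contains_cball by blast
  obtain c where c: "0 \<le> c" "\<And>h k. norm h + norm k \<le> \<delta>1 \<Longrightarrow>
       norm (F (?p + h + k) - F (?p + h) - F (?p + k) + F ?p) \<le> c * norm h * norm k"
    by (rule C2_second_difference[OF F(1) \<delta>1(2)]) (rule that)
  have "continuous_map (prod_topology X X) X (\<lambda>(x, y). x \<otimes>\<^bsub>G\<^esub> y)"
    using top(1) by (simp add: topological_group_def)
  from openin_continuous_map_preimage[OF this U]
  have "openin (prod_topology X X) {p \<in> carrier G \<times> carrier G. fst p \<otimes>\<^bsub>G\<^esub> snd p \<in> U}"
    by (simp add: carr case_prod_unfold)
  moreover have "(\<one>\<^bsub>G\<^esub>, \<one>\<^bsub>G\<^esub>) \<in> {p \<in> carrier G \<times> carrier G. fst p \<otimes>\<^bsub>G\<^esub> snd p \<in> U}"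
    using U1 by simp
  ultimately obtain S S' where S: "openin X S" "openin X S'" "\<one>\<^bsub>G\<^esub> \<in> S" "\<one>\<^bsub>G\<^esub> \<in> S'"
    "S \<times> S' \<subseteq> {p \<in> carrier G \<times> carrier G. fst p \<otimes>\<^bsub>G\<^esub> snd p \<in> U}"
    by (rule openin_prod_topologyE)
  then have "openin X (S \<inter> S')" "\<one>\<^bsub>G\<^esub> \<in> S \<inter> S'"
    by auto
  from basis[OF this] obtain \<delta>2 where \<delta>2: "\<delta>2 > 0" "\<And>\<rho>. \<rho> \<le> \<delta>2 \<Longrightarrow> {x \<in> U. norm (\<psi> x) \<le> \<rho>} \<subseteq> S \<inter> S'"
    by blast
  \<comment> \<open>The four bounds: balls stay inside the image of the chart, two displacements of
    norm at most \<open>r\<close> add up to at most \<open>\<delta>1\<close>, products stay in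
    \<open>U\<close>, and \<open>c * r \<le> 1\<close>.\<close>
  define r where "r = min (min \<delta>0 (\<delta>1 / 2)) (min \<delta>2 (1 / (c + 1)))"
  have r: "0 < r" "r \<le> \<delta>0" "r \<le> \<delta>1 / 2" "r \<le> \<delta>2" "r \<le> 1 / (c + 1)"
    using \<delta>0(1) \<delta>1(1) \<delta>2(1) c(1) by (auto simp: r_def)
  have in_U: "x \<otimes>\<^bsub>G\<^esub> y \<in> U" if "x \<in> U" "y \<in> U" "norm (\<psi> x) \<le> r" "norm (\<psi> y) \<le> r" for x y
  proof -
    have "(x, y) \<in> S \<times> S'"
      using that \<delta>2(2)[OF r(4)] by auto
    then show ?thesis
      using S(5) by auto
  qed
  have est: "norm (\<psi> (x \<otimes>\<^bsub>G\<^esub> y) - \<psi> x - \<psi> y) \<le> c * norm (\<psi> x) * norm (\<psi> y)"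
    if xy: "x \<in> U" "y \<in> U" "norm (\<psi> x) \<le> r" "norm (\<psi> y) \<le> r" for x y
  proof -
    have mem: "F (?p + (\<psi> a, 0) + (0, \<psi> b)) = \<phi> (a \<otimes>\<^bsub>G\<^esub> b)"
      if "a \<in> U" "b \<in> U" "norm (\<psi> a) \<le> r" "norm (\<psi> b) \<le> r" for a b
    proof -
      have eq: "?p + (\<psi> a, 0) + (0, \<psi> b) = (\<phi> a, \<phi> b)"
        by (simp add: \<psi>_def)
      have "dist ?p (\<phi> a, \<phi> b) \<le> norm (\<psi> a) + norm (\<psi> b)"
        using norm_triangle_ineq[of "(\<psi> a, 0)" "(0, \<psi> b)"] eq
        by (simp add: dist_norm norm_minus_commute \<psi>_def)
           (simp add: norm_Pair norm_minus_commute)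
      then have "(\<phi> a, \<phi> b) \<in> O'"
        using \<delta>1(2) that r(3) by (auto simp: subset_iff)
      moreover have "(\<phi> a, \<phi> b) \<in> ?A"
        using that in_U inv\<phi> by auto
      ultimately show ?thesis
        using F(2)[of "(\<phi> a, \<phi> b)"] eq inv\<phi> that by simp
    qed
    have \<psi>1: "\<psi> \<one>\<^bsub>G\<^esub> = 0"
      by (simp add: \<psi>_def)
    \<comment> \<open>The other three corners of the square are the products
      \<open>x \<otimes> \<one>\<close>, \<open>\<one> \<otimes> y\<close> and
      \<open>\<one> \<otimes> \<one>\<close>, so the second difference of \<open>F\<close> is
      \<open>\<psi> (x \<otimes> y) - \<psi> x - \<psi> y\<close>.\<close>
    have "norm (\<psi> x, 0 :: 'e) + norm (0 :: 'e, \<psi> y) \<le> \<delta>1"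
      using xy r(3) by simp
    from c(2)[OF this] show ?thesis
      using mem[of x y] mem[of x "\<one>\<^bsub>G\<^esub>"] mem[of "\<one>\<^bsub>G\<^esub>" y] mem[of "\<one>\<^bsub>G\<^esub>" "\<one>\<^bsub>G\<^esub>"] xy U1 UG r(1)

      by (auto simp: \<psi>1 \<phi>[of "x \<otimes>\<^bsub>G\<^esub> y"] \<phi>[of x] \<phi>[of y] zero_prod_def[symmetric] subset_iff algebra_simps)
  qed
  have "group_chart G X U \<psi> r c"
  proof
    show "c * r \<le> 1"
      using r(1,5) c(1) by (simp add: field_simps)
    show "\<exists>\<rho>>0. \<rho> \<le> r \<and> {x \<in> U. norm (\<psi> x) \<le> \<rho>} \<subseteq> S"
      if "openin X S" "\<one>\<^bsub>G\<^esub> \<in> S" for S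
    proof -
      obtain \<rho> where "\<rho> > 0" and \<rho>: "\<And>\<rho>'. \<rho>' \<le> \<rho> \<Longrightarrow> {x \<in> U. norm (\<psi> x) \<le> \<rho>'} \<subseteq> S"
        using basis[OF \<open>openin X S\<close> \<open>\<one>\<^bsub>G\<^esub> \<in> S\<close>] by blast
      then show ?thesis
        using r(1) \<rho>[of "min r \<rho>"] by (intro exI[of _ "min r \<rho>"] conjI) linarith+
    qed
    show "x = \<one>\<^bsub>G\<^esub>" if "x \<in> U" "\<psi> x = 0" for x
      using that inj U1 by (auto simp: \<psi>_def dest: inj_onD)
    show "closedin X {x \<in> U. norm (\<psi> x) \<le> \<rho> \<and> \<psi> x \<in> A}" if "\<rho> \<le> r" "closed A" for \<rho> A
      using closed_ball that r(2) by simp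
  qed (use top U1 r(1) c(1) open_ball in_U est in \<open>simp_all add: \<psi>_def\<close>)
  then show ?thesis
    by blast
qed

section \<open>Powers in the chart, small subgroups, and normalizing elements near the
  identity\<close>

context group_chart
begin

lemma chart_carrier: "x \<in> U \<Longrightarrow> norm (\<psi> x) \<le> r \<Longrightarrow> x \<in> carrier G"
  using closedin_subset[OF closedin_chart_ball[of r UNIV]] topspace by auto

text \<open>A further factor \<open>x\<close> adds an error of at most
  \<open>c * norm (\<psi> (x [^] k)) * norm (\<psi> x)\<close>, where the norm of the power is at
  most \<open>2 * (real k * norm (\<psi> x))\<close>. The errors sum to the stated square because
  \<open>k\<^sup>2 + 2 * k \<le> (k + 1)\<^sup>2\<close>. The bound \<open>r / 2\<close> keeps every
  power within the radius \<open>r\<close>.\<close>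

lemma chart_power:
  assumes x: "x \<in> U" "real k * norm (\<psi> x) \<le> r / 2"
  shows "x [^] k \<in> U" "norm (\<psi> (x [^] k) - real k *\<^sub>R \<psi> x) \<le> c * (real k * norm (\<psi> x))\<^sup>2"
proof -
  let ?a = "norm (\<psi> x)"
  have "x [^] k \<in> U \<and> norm (\<psi> (x [^] k) - real k *\<^sub>R \<psi> x) \<le> c * (real k * ?a)\<^sup>2"
    using x(2)
  proof (induction k)
    case 0
    then show ?case
      by (simp add: one_in chart_one)
  next
    case (Suc k)
    have le: "real k * ?a \<le> r / 2" "?a \<le> r"
    proof -
      show "real k * ?a \<le> r / 2"
        using Suc.prems norm_ge_zero[of "\<psi> x"] by (simp add: algebra_simps del: norm_ge_zero)
      have "1 * ?a \<le> real (Suc k) * ?a"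
        by (intro mult_right_mono) auto
      then show "?a \<le> r"
        using Suc.prems r_pos by linarith
    qed
    have IH: "x [^] k \<in> U" "norm (\<psi> (x [^] k) - real k *\<^sub>R \<psi> x) \<le> c * (real k * ?a)\<^sup>2"
      using Suc.IH[OF le(1)] by auto
    have "c * (real k * ?a) \<le> c * r"
      using le(1) r_pos c_nonneg by (intro mult_left_mono) auto
    then have "c * (real k * ?a) * (real k * ?a) \<le> 1 * (real k * ?a)"
      using c_r by (intro mult_right_mono) auto
    moreover have "norm (\<psi> (x [^] k)) \<le> norm (\<psi> (x [^] k) - real k *\<^sub>R \<psi> x) + real k * ?a"
      using norm_triangle_sub[of "\<psi> (x [^] k)" "real k *\<^sub>R \<psi> x"] by simp
    ultimately have le2: "norm (\<psi> (x [^] k)) \<le> 2 * (real k * ?a)"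
      using IH(2) by (simp add: power2_eq_square algebra_simps)
    then have r2: "norm (\<psi> (x [^] k)) \<le> r"
      using le(1) by linarith
    have "norm (\<psi> (x [^] Suc k) - real (Suc k) *\<^sub>R \<psi> x) =
        norm ((\<psi> (x [^] k \<otimes> x) - \<psi> (x [^] k) - \<psi> x) + (\<psi> (x [^] k) - real k *\<^sub>R \<psi> x))"
      by (simp add: algebra_simps)
    also have "\<dots> \<le> norm (\<psi> (x [^] k \<otimes> x) - \<psi> (x [^] k) - \<psi> x) + norm (\<psi> (x [^] k) - real k *\<^sub>R \<psi> x)"
      by (rule norm_triangle_ineq)
    also have "\<dots> \<le> c * norm (\<psi> (x [^] k)) * ?a + c * (real k * ?a)\<^sup>2"
      by (intro add_mono chart_mult IH x(1) r2 le(2))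
    also have "\<dots> \<le> c * (2 * (real k * ?a)) * ?a + c * (real k * ?a)\<^sup>2"
      using le2 c_nonneg by (intro add_mono mult_right_mono mult_left_mono) auto
    also have "\<dots> \<le> c * (real (Suc k) * ?a)\<^sup>2"
      using c_nonneg by (simp add: power2_eq_square algebra_simps)
    finally show ?case
      using mult_in[OF IH(1) x(1) r2 le(2)] by simp
  qed
  then show "x [^] k \<in> U" "norm (\<psi> (x [^] k) - real k *\<^sub>R \<psi> x) \<le> c * (real k * norm (\<psi> x))\<^sup>2"
    by auto
qed

lemma no_small_subgroups:
  assumes x: "\<And>k::nat. x [^] k \<in> U \<and> norm (\<psi> (x [^] k)) \<le> r / 8" and xG: "x \<in> carrier G"
  shows "x = \<one>"
proof (rule ccontr)
  assume "x \<noteq> \<one>"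
  moreover have U: "x \<in> U" "norm (\<psi> x) \<le> r / 8"
    using x[of 1] xG by auto
  ultimately have pos: "0 < norm (\<psi> x)"
    using chart_eq_0 by auto
  \<comment> \<open>The last exponent that \<open>chart_power\<close> allows. Since
    \<open>norm (\<psi> x) \<le> r / 8\<close>, the product \<open>real k * norm (\<psi> x)\<close>
    exceeds \<open>3 * r / 8\<close>; at least half of it survives in the norm of
    \<open>\<psi> (x [^] k)\<close>, which is more than \<open>r / 8\<close>.\<close>
  define k where "k = nat \<lfloor>r / 2 / norm (\<psi> x)\<rfloor>"
  have "real k \<le> r / 2 / norm (\<psi> x)" "r / 2 / norm (\<psi> x) < real k + 1"
    using pos r_pos by (auto simp: k_def of_nat_floor)
  then have k: "real k * norm (\<psi> x) \<le> r / 2" "r / 2 < real k * norm (\<psi> x) + norm (\<psi> x)"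
    using pos by (auto simp: field_simps)
  have "c * (real k * norm (\<psi> x)) \<le> c * (r / 2)"
    using k(1) c_nonneg by (rule mult_left_mono)
  then have "c * (real k * norm (\<psi> x)) \<le> 1 / 2"
    using c_r by simp
  then have "c * (real k * norm (\<psi> x)) * (real k * norm (\<psi> x)) \<le> 1 / 2 * (real k * norm (\<psi> x))"
    by (intro mult_right_mono) auto
  then have "norm (\<psi> (x [^] k) - real k *\<^sub>R \<psi> x) \<le> 1 / 2 * (real k * norm (\<psi> x))"
    using chart_power(2)[OF U(1) k(1)] by (simp add: power2_eq_square mult.assoc)
  moreover have "real k * norm (\<psi> x) \<le> norm (\<psi> (x [^] k)) + norm (\<psi> (x [^] k) - real k *\<^sub>R \<psi> x)"
    using norm_triangle_sub[of "real k *\<^sub>R \<psi> x" "\<psi> (x [^] k)"] by (simp add: norm_minus_commute)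
  ultimately show False
    using x[of k] k(2) U(2) r_pos by linarith
qed

lemma normalizer_conj:
  assumes T: "subgroup T G" and n: "n \<in> normalizer G T" and t: "t \<in> T"
  shows "n \<in> carrier G" "n \<otimes> t \<otimes> inv n \<in> T"
proof -
  have TG: "T \<subseteq> carrier G"
    using T by (rule subgroup.subset)
  then have "n \<in> carrier G" "n <# T #> inv n = T"
    using n by (auto simp: normalizer_def stabilizer_def)
  then show "n \<in> carrier G" "n \<otimes> t \<otimes> inv n \<in> T"
    using t by (auto simp: l_coset_def r_coset_def)
qed

text \<open>For \<open>n\<close> near \<open>1\<close> the map \<open>t \<mapsto> n t n\<^sup>-\<^sup>1 t\<^sup>-\<^sup>1\<close> is an endomorphism of \<open>T\<close> with arbitrarily small image.\<close>

lemma normalizer_centralizes_near_one: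
  assumes T: "subgroup T G" "closedin X T" and comm: "\<And>s t. s \<in> T \<Longrightarrow> t \<in> T \<Longrightarrow> s \<otimes> t = t \<otimes> s"
  obtains S where "openin X S" "\<one> \<in> S"
    "\<And>n t. n \<in> S \<Longrightarrow> n \<in> normalizer G T \<Longrightarrow> t \<in> T \<Longrightarrow> n \<otimes> t = t \<otimes> n"
proof -
  have TG: "T \<subseteq> carrier G"
    using T(1) by (rule subgroup.subset)
  let ?f = "\<lambda>p. fst p \<otimes> snd p \<otimes> inv (fst p) \<otimes> inv (snd p)"
  define W where "W = {p \<in> topspace (prod_topology X X). ?f p \<in> {x \<in> U. norm (\<psi> x) < r / 8}}"
  have "openin X {x \<in> U. norm (\<psi> x) < r / 8}"
    using r_pos by (intro openin_chart_ball) simp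
  then have W: "openin (prod_topology X X) W"
    unfolding W_def by (rule openin_continuous_map_preimage[rotated]) (intro group_continuous_intros)
  have "{\<one>} \<times> T \<subseteq> W"
    using TG r_pos by (auto simp: W_def topspace one_in chart_one subset_iff)
  \<comment> \<open>Compactness of \<open>T\<close> gives one neighbourhood of \<open>\<one>\<close>
    that works for every \<open>t\<close> at once, hence for all powers \<open>t [^] k\<close> as
    well.\<close>
  then obtain S S' where S: "openin X S" "\<one> \<in> S" "T \<subseteq> S'" "S \<times> S' \<subseteq> W"
    using tube_lemma_right[OF W closedin_compact_space[OF compact_space T(2)], of \<one>] topspace
    by (metis one_closed)
  have "n \<otimes> t = t \<otimes> n" if n: "n \<in> S" "n \<in> normalizer G T" and t: "t \<in> T" for n t
  proof -
    have nG: "n \<in> carrier G" and tG: "t \<in> carrier G"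
      using normalizer_conj(1)[OF T(1) n(2) t] TG t by auto
    let ?b = "n \<otimes> t \<otimes> inv n \<otimes> inv t"
    have conj: "n \<otimes> s \<otimes> inv n \<in> T" if "s \<in> T" for s
      by (rule normalizer_conj(2)[OF T(1) n(2) that])
    \<comment> \<open>The conjugate of \<open>t\<close> lies in \<open>T\<close> and so commutes
      with \<open>inv (t [^] k)\<close>. Hence a power of the commutator is again a commutator, with
      \<open>t [^] k\<close> in place of \<open>t\<close>, and lies in the same ball.\<close>
    have pow: "?b [^] k = n \<otimes> t [^] k \<otimes> inv n \<otimes> inv (t [^] k)" for k :: nat
    proof (induction k)
      case (Suc k)
      have tk: "t [^] k \<in> T"
        using T(1) t by (induction k) (auto simp: subgroup.one_closed subgroup.m_closed)
      have in_T: "inv (t [^] k) \<in> T" "inv t \<in> T"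
        using T(1) tk t by (auto simp: subgroup.m_inv_closed)
      let ?u = "n \<otimes> t [^] k \<otimes> inv n" and ?v = "n \<otimes> t \<otimes> inv n"
      have mem: "?u \<in> carrier G" "?v \<in> carrier G" "inv (t [^] k) \<in> carrier G" "inv t \<in> carrier G"
        using nG tG by auto
      have "?b [^] Suc k = (?u \<otimes> inv (t [^] k)) \<otimes> (?v \<otimes> inv t)"
        using Suc.IH by simp
      also have "\<dots> = ?u \<otimes> (inv (t [^] k) \<otimes> ?v) \<otimes> inv t"
        using mem by (simp add: m_assoc)
      also have "inv (t [^] k) \<otimes> ?v = ?v \<otimes> inv (t [^] k)"
        by (rule comm[OF in_T(1) conj[OF t]])
      also have "?u \<otimes> (?v \<otimes> inv (t [^] k)) \<otimes> inv t = (?u \<otimes> ?v) \<otimes> (inv (t [^] k) \<otimes> inv t)"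
        using mem by (simp add: m_assoc)
      also have "?u \<otimes> ?v = n \<otimes> t [^] Suc k \<otimes> inv n"
      proof -
        have "inv n \<otimes> (n \<otimes> z) = z" if "z \<in> carrier G" for z
          using that nG by (simp add: m_assoc[symmetric])
        then show ?thesis
          using nG tG by (simp add: m_assoc)
      qed
      also have "inv (t [^] k) \<otimes> inv t = inv (t [^] Suc k)"
        using comm[OF in_T] tG by (simp add: inv_mult_group)
      finally show ?case .
    qed (use nG tG in simp)
    have "?b [^] k \<in> U \<and> norm (\<psi> (?b [^] k)) \<le> r / 8" for k :: nat
    proof -
      have "t [^] k \<in> T"
        using T(1) t by (induction k) (auto simp: subgroup.one_closed subgroup.m_closed)
      then have "(n, t [^] k) \<in> W"
        using n(1) S by auto
      then show ?thesis
        unfolding pow by (auto simp: W_def)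
    qed
    then have "?b = \<one>"
      using no_small_subgroups[of ?b] nG tG by simp
    then show ?thesis
      using nG tG by (metis inv_closed inv_equality inv_inv m_closed inv_solve_right)
  qed
  with S(1,2) show thesis
    using that by blast
qed

end

section \<open>One-parameter subgroups\<close>

text \<open>The possible carry in a sum of two floors. In the limit below it costs one extra factor
  \<open>x j\<close>, which tends to \<open>\<one>\<close>.\<close>

lemma nat_floor_add_cases:
  assumes "0 \<le> s" "0 \<le> (t :: real)"
  shows "nat \<lfloor>s + t\<rfloor> = nat \<lfloor>s\<rfloor> + nat \<lfloor>t\<rfloor> \<or> nat \<lfloor>s + t\<rfloor> = nat \<lfloor>s\<rfloor> + nat \<lfloor>t\<rfloor> + 1"
  using assms by (simp add: floor_add nat_add_distrib)

lemma (in monoid) commute_nat_pow: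
  assumes "x \<in> carrier G" "t \<in> carrier G" "x \<otimes> t = t \<otimes> x"
  shows "x [^] (n :: nat) \<otimes> t = t \<otimes> x [^] n"
proof (induction n)
  case (Suc n)
  have "x [^] Suc n \<otimes> t = x [^] n \<otimes> (x \<otimes> t)"
    using assms by (simp add: m_assoc)
  also have "\<dots> = (x [^] n \<otimes> t) \<otimes> x"
    unfolding assms(3) using assms by (simp add: m_assoc)
  finally show ?case
    unfolding Suc.IH using assms by (simp add: m_assoc)
qed (use assms in simp)

context group_chart
begin

text \<open>\<open>T\<close> is closed and does not contain \<open>x\<close>, so the coset of
  \<open>x\<close> stays away from \<open>\<one>\<close> and the infimum of its norms in the chart
  is positive. Twice the infimum is then strictly larger, so some representative lies below
  it.\<close>

lemma near_minimal_representative: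
  assumes T: "subgroup T G" "closedin X T" and x: "x \<in> U" "norm (\<psi> x) \<le> r" "x \<notin> T"
  obtains t where "t \<in> T" "t \<otimes> x \<in> U" "norm (\<psi> (t \<otimes> x)) \<le> 2 * norm (\<psi> x)"
    "\<And>s. s \<in> T \<Longrightarrow> s \<otimes> (t \<otimes> x) \<in> U \<Longrightarrow> norm (\<psi> (s \<otimes> (t \<otimes> x))) \<le> r \<Longrightarrow>
      norm (\<psi> (t \<otimes> x)) \<le> 2 * norm (\<psi> (s \<otimes> (t \<otimes> x)))"
proof -
  have TG: "T \<subseteq> carrier G"
    using T(1) by (rule subgroup.subset)
  have xG: "x \<in> carrier G"
    using chart_carrier x by blast
  let ?M = "{norm (\<psi> (t \<otimes> x)) | t. t \<in> T \<and> t \<otimes> x \<in> U \<and> norm (\<psi> (t \<otimes> x)) \<le> r}"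
  have "closedin X {y \<in> topspace X. y \<otimes> inv x \<in> T}"
    using xG by (intro closedin_continuous_map_preimage[OF _ T(2)] group_continuous_intros) auto
  then have "openin X (topspace X - {y \<in> topspace X. y \<otimes> inv x \<in> T})"
    by blast
  moreover have "\<one> \<in> topspace X - {y \<in> topspace X. y \<otimes> inv x \<in> T}"
    using xG x(3) subgroup.m_inv_closed[OF T(1), of "inv x"] by (auto simp: topspace)
  ultimately obtain \<delta> where \<delta>: "\<delta> > 0"
    "{y \<in> U. norm (\<psi> y) \<le> \<delta>} \<subseteq> topspace X - {y \<in> topspace X. y \<otimes> inv x \<in> T}"
    using chart_ball_basis by meson
  have ge: "\<delta> \<le> m" if m: "m \<in> ?M" for m
  proof (rule ccontr)
    assume "\<not> \<delta> \<le> m"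
    then obtain t where t: "t \<in> T" "t \<otimes> x \<in> U" "norm (\<psi> (t \<otimes> x)) \<le> \<delta>"
      using m by auto
    then have "t \<otimes> x \<otimes> inv x \<notin> T"
      using \<delta>(2) TG xG by (auto simp: topspace subset_iff)
    then show False
      using t(1) TG xG by (auto simp: m_assoc subset_iff)
  qed
  have "norm (\<psi> x) \<in> ?M"
    using x(1,2) xG subgroup.one_closed[OF T(1)] by (auto intro!: exI[of _ \<one>])
  moreover have bdd: "bdd_below ?M"
    using ge by (rule bdd_belowI)
  ultimately have Inf: "\<delta> \<le> Inf ?M" "Inf ?M \<le> norm (\<psi> x)"
    using ge by (auto intro!: cInf_greatest cInf_lower)
  then have "Inf ?M < 2 * Inf ?M"
    using \<delta>(1) by linarith
  moreover have "?M \<noteq> {}"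
    using \<open>norm (\<psi> x) \<in> ?M\<close> by blast
  ultimately obtain m where "m \<in> ?M" "m < 2 * Inf ?M"
    using cInf_lessD[of ?M "2 * Inf ?M"] by blast
  then obtain t where t: "t \<in> T" "t \<otimes> x \<in> U" "norm (\<psi> (t \<otimes> x)) < 2 * Inf ?M"
    by blast
  show thesis
  proof (rule that[OF t(1,2)])
    show "norm (\<psi> (t \<otimes> x)) \<le> 2 * norm (\<psi> x)"
      using t(3) Inf(2) by linarith
    fix s assume s: "s \<in> T" "s \<otimes> (t \<otimes> x) \<in> U" "norm (\<psi> (s \<otimes> (t \<otimes> x))) \<le> r"
    have eq: "s \<otimes> (t \<otimes> x) = (s \<otimes> t) \<otimes> x"
      using s(1) t(1) TG xG by (auto simp: m_assoc subset_iff)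
    have "norm (\<psi> (s \<otimes> (t \<otimes> x))) \<in> ?M"
      using s subgroup.m_closed[OF T(1) s(1) t(1)] unfolding eq by blast
    then have "Inf ?M \<le> norm (\<psi> (s \<otimes> (t \<otimes> x)))"
      using bdd by (rule cInf_lower)
    then show "norm (\<psi> (t \<otimes> x)) \<le> 2 * norm (\<psi> (s \<otimes> (t \<otimes> x)))"
      using t(3) by linarith
  qed
qed

text \<open>A cluster point, in the compact space of all functions from the reals to \<open>G\<close>, of the functions
  \<open>s \<mapsto> x\<^sub>j [^] \<lfloor>s / norm (\<psi> x\<^sub>j)\<rfloor>\<close>.\<close>

lemma one_parameter_limit:
  assumes x: "\<And>j. x j \<in> U" "\<And>j. 0 < norm (\<psi> (x j))" "\<And>j. norm (\<psi> (x j)) \<le> r"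
    and lim0: "(\<lambda>j. norm (\<psi> (x j))) \<longlonglongrightarrow> 0"
    and limv: "(\<lambda>j. \<psi> (x j) /\<^sub>R norm (\<psi> (x j))) \<longlonglongrightarrow> v"
  obtains \<gamma> :: "real \<Rightarrow> 'a" where "\<And>s. \<gamma> s \<in> carrier G"
    "\<And>s t. 0 \<le> s \<Longrightarrow> 0 \<le> t \<Longrightarrow> \<gamma> (s + t) = \<gamma> s \<otimes> \<gamma> t"
    "\<And>s. 0 \<le> s \<Longrightarrow> s \<le> r / 2 \<Longrightarrow> \<gamma> s \<in> U"
    "\<And>s. 0 \<le> s \<Longrightarrow> s \<le> r / 2 \<Longrightarrow> norm (\<psi> (\<gamma> s) - s *\<^sub>R v) \<le> c * s\<^sup>2"
    "\<And>s t. t \<in> carrier G \<Longrightarrow> \<forall>j. x j \<otimes> t = t \<otimes> x j \<Longrightarrow> \<gamma> s \<otimes> t = t \<otimes> \<gamma> s"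
proof -
  have xG: "x j \<in> carrier G" for j
    using chart_carrier x by blast
  define a where "a j = norm (\<psi> (x j))" for j
  have a: "0 < a j" for j
    using x(2) by (simp add: a_def)
  \<comment> \<open>The number of steps of length \<open>a j\<close> that fit into \<open>s\<close>.
    For negative \<open>s\<close> it is 0, which is why additivity is claimed on the half-line
    only.\<close>
  define k where "k s j = nat \<lfloor>s / a j\<rfloor>" for s j
  define p where "p j s = x j [^] k s j" for j s
  define Y where "Y = product_topology (\<lambda>_ :: real. X) UNIV"
  have "compact_space Y"
    using compact_space by (simp add: Y_def compact_space_product_topology)
  moreover have "range p \<subseteq> topspace Y"
    using xG by (auto simp: Y_def topspace p_def)
  ultimately obtain \<gamma> where \<gamma>: "\<gamma> \<in> topspace Y"
    "\<And>C. closedin Y C \<Longrightarrow> eventually (\<lambda>j. p j \<in> C) sequentially \<Longrightarrow> \<gamma> \<in> C"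
    using compact_space_cluster_point by metis
  have proj: "continuous_map Y X (\<lambda>q. q s)" for s
    unfolding Y_def by (rule continuous_map_product_projection) simp
  have pY: "p j \<in> topspace Y" for j
    using \<open>range p \<subseteq> topspace Y\<close> by blast
  have lim: "f \<gamma> \<in> C" if "continuous_map Y X f" "closedin X C" "eventually (\<lambda>j. f (p j) \<in> C) sequentially"
    for f C
    using \<gamma>(2)[OF closedin_continuous_map_preimage[OF that(1,2)]] that(3) pY by simp
  have carr: "\<gamma> s \<in> carrier G" for s
    using \<gamma>(1) by (auto simp: Y_def topspace PiE_iff)
  have add: "\<gamma> (s + t) = \<gamma> s \<otimes> \<gamma> t" if st: "0 \<le> s" "0 \<le> t" for s t
  proof -
    \<comment> \<open>The defect of additivity. For \<open>p j\<close> it is \<open>\<one>\<close>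
      or the carry \<open>x j\<close>, so it eventually stays in every closed chart ball and equals
      \<open>\<one>\<close> at the cluster point.\<close>
    let ?f = "\<lambda>q. inv (q s \<otimes> q t) \<otimes> q (s + t)"
    have ball: "?f \<gamma> \<in> {y \<in> U. norm (\<psi> y) \<le> \<rho> \<and> \<psi> y \<in> UNIV}" if \<rho>: "0 < \<rho>" "\<rho> \<le> r" for \<rho>
    proof (rule lim)
      show "continuous_map Y X ?f"
        by (intro group_continuous_intros proj)
      show "closedin X {y \<in> U. norm (\<psi> y) \<le> \<rho> \<and> \<psi> y \<in> UNIV}"
        using \<rho>(2) by (rule closedin_chart_ball) simp
      have "eventually (\<lambda>j. norm (\<psi> (x j)) < \<rho>) sequentially"
        using order_tendstoD(2)[OF lim0 \<rho>(1)] .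
      then show "eventually (\<lambda>j. ?f (p j) \<in> {y \<in> U. norm (\<psi> y) \<le> \<rho> \<and> \<psi> y \<in> UNIV}) sequentially"
      proof eventually_elim
        case (elim j)
        have eq: "k (s + t) j = k s j + k t j \<or> k (s + t) j = k s j + k t j + 1"
          using nat_floor_add_cases[of "s / a j" "t / a j"] st a[of j]
          by (simp add: k_def add_divide_distrib)
        have "inv y \<otimes> (y \<otimes> z) = z" if "y \<in> carrier G" "z \<in> carrier G" for y z
          using that by (simp add: m_assoc[symmetric])
        then have "inv (p j s \<otimes> p j t) \<otimes> (p j s \<otimes> p j t \<otimes> z) = z" if "z \<in> carrier G" for z
          using that xG by (simp add: p_def)
        from this[of \<one>] this[of "x j"] have "?f (p j) = \<one> \<or> ?f (p j) = x j"
          using eq xG by (auto simp: p_def nat_pow_mult[symmetric])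
        then show ?case
          using one_in chart_one x(1) elim \<rho>(1) by auto
      qed
    qed
    have "norm (\<psi> (?f \<gamma>)) \<le> 0"
    proof (rule field_le_epsilon)
      fix e :: real assume "0 < e"
      then show "norm (\<psi> (?f \<gamma>)) \<le> 0 + e"
        using ball[of "min e r"] r_pos by auto
    qed
    then have "?f \<gamma> = \<one>"
      using chart_eq_0[of "?f \<gamma>"] ball[of r] r_pos by simp
    then show ?thesis
      using carr inv_equality[of "inv (\<gamma> s \<otimes> \<gamma> t)" "\<gamma> (s + t)"]
      by (metis inv_closed inv_comm inv_equality inv_inv m_closed)
  qed
  have est: "\<gamma> s \<in> {y \<in> U. norm (\<psi> y) \<le> r \<and> \<psi> y \<in> cball (s *\<^sub>R v) (c * s\<^sup>2 + e)}"
    if s: "0 \<le> s" "s \<le> r / 2" and e: "0 < e" for s e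
  proof (rule lim[OF proj])
    show "closedin X {y \<in> U. norm (\<psi> y) \<le> r \<and> \<psi> y \<in> cball (s *\<^sub>R v) (c * s\<^sup>2 + e)}"
      by (rule closedin_chart_ball) auto
    let ?u = "\<lambda>j. \<psi> (x j) /\<^sub>R norm (\<psi> (x j))"
    \<comment> \<open>The two errors of \<open>real (k s j) *\<^sub>R \<psi> (x j)\<close> against
      \<open>s *\<^sub>R v\<close>: rounding \<open>s\<close> down costs at most \<open>a j\<close>,
      and replacing the direction \<open>?u j\<close> by \<open>v\<close> costs the rest. The slack
      \<open>e\<close> absorbs both.\<close>
    have "(\<lambda>j. a j + s * norm (?u j - v)) \<longlonglongrightarrow> 0 + s * norm (v - v)"
      unfolding a_def by (intro tendsto_intros lim0 limv)
    then have "eventually (\<lambda>j. a j + s * norm (?u j - v) < e) sequentially"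
      using e by (intro order_tendstoD(2)) auto
    then show "eventually (\<lambda>j. p j s \<in> {y \<in> U. norm (\<psi> y) \<le> r \<and> \<psi> y \<in> cball (s *\<^sub>R v) (c * s\<^sup>2 + e)}) sequentially"
    proof eventually_elim
      case (elim j)
      have "real (k s j) \<le> s / a j" "s / a j < real (k s j) + 1"
        using s(1) a[of j] by (auto simp: k_def of_nat_floor)
      then have ka: "real (k s j) * a j \<le> s" "s < real (k s j) * a j + a j"
        using a[of j] by (auto simp: field_simps)
      have "real (k s j) * norm (\<psi> (x j)) \<le> r / 2"
        using ka(1) s(2) by (simp add: a_def)
      note pow = chart_power[OF x(1) this]
      have "(real (k s j) * a j)\<^sup>2 \<le> s\<^sup>2"
        using ka(1) a[of j] by (intro power_mono) auto
      then have "c * (real (k s j) * a j)\<^sup>2 \<le> c * s\<^sup>2"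
        using c_nonneg by (rule mult_left_mono)
      then have 1: "norm (\<psi> (p j s) - real (k s j) *\<^sub>R \<psi> (x j)) \<le> c * s\<^sup>2"
        using pow(2) by (simp add: p_def a_def)
      have "c * s \<le> c * r"
        using s r_pos c_nonneg by (intro mult_left_mono) auto
      then have "c * s * s \<le> 1 * s"
        using c_r s(1) by (intro mult_right_mono) auto
      moreover have "norm (\<psi> (p j s)) \<le> norm (\<psi> (p j s) - real (k s j) *\<^sub>R \<psi> (x j)) + real (k s j) * a j"
        using norm_triangle_sub[of "\<psi> (p j s)" "real (k s j) *\<^sub>R \<psi> (x j)"] by (simp add: a_def)
      ultimately have "norm (\<psi> (p j s)) \<le> r"
        using 1 ka(1) s(2) by (simp add: power2_eq_square mult.assoc)
      moreover have "norm (\<psi> (p j s) - s *\<^sub>R v) \<le> c * s\<^sup>2 + e"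
      proof -
        have "real (k s j) *\<^sub>R \<psi> (x j) - s *\<^sub>R v = (real (k s j) * a j - s) *\<^sub>R ?u j + s *\<^sub>R (?u j - v)"
          using a[of j] by (simp add: a_def algebra_simps)
        then have "norm (real (k s j) *\<^sub>R \<psi> (x j) - s *\<^sub>R v) \<le>
            norm ((real (k s j) * a j - s) *\<^sub>R ?u j) + norm (s *\<^sub>R (?u j - v))"
          by (metis norm_triangle_ineq)
        also have "\<dots> = \<bar>real (k s j) * a j - s\<bar> * norm (?u j) + s * norm (?u j - v)"
          using s(1) by (simp only: norm_scaleR abs_of_nonneg)
        also have "norm (?u j) = 1"
          using a[of j] by (simp add: a_def)
        also have "\<bar>real (k s j) * a j - s\<bar> * 1 + s * norm (?u j - v) \<le> a j + s * norm (?u j - v)"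
          using ka a[of j] by (intro add_right_mono) (simp add: abs_le_iff)
        finally show ?thesis
          using 1 elim norm_triangle_ineq[of "\<psi> (p j s) - real (k s j) *\<^sub>R \<psi> (x j)" "real (k s j) *\<^sub>R \<psi> (x j) - s *\<^sub>R v"]
          by simp
      qed
      ultimately show ?case
        using pow(1) by (simp add: p_def dist_norm norm_minus_commute)
    qed
  qed
  show thesis
  proof (rule that[of \<gamma>, OF carr add])
    fix s :: real assume s: "0 \<le> s" "s \<le> r / 2"
    show "\<gamma> s \<in> U"
      using est[OF s, of 1] by simp
    show "norm (\<psi> (\<gamma> s) - s *\<^sub>R v) \<le> c * s\<^sup>2"
    proof (rule field_le_epsilon)
      fix e :: real assume "0 < e"
      then show "norm (\<psi> (\<gamma> s) - s *\<^sub>R v) \<le> c * s\<^sup>2 + e"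
        using est[OF s, of e] by (simp add: dist_norm norm_minus_commute)
    qed
  next
    fix s t assume t: "t \<in> carrier G" "\<forall>j. x j \<otimes> t = t \<otimes> x j"
    have "p j s \<otimes> t = t \<otimes> p j s" for j s
      unfolding p_def by (rule commute_nat_pow[OF xG t(1)]) (simp add: t(2))
    moreover have "closedin Y {q \<in> topspace Y. q s \<otimes> t = t \<otimes> q s}"
      by (intro closedin_continuous_maps_eq[OF Hausdorff_space] group_continuous_intros proj t(1))
    ultimately show "\<gamma> s \<otimes> t = t \<otimes> \<gamma> s"
      using \<gamma>(2)[of "{q \<in> topspace Y. q s \<otimes> t = t \<otimes> q s}"] pY by simp
  qed
qed

end

lemma (in group) commute_inv:
  assumes "x \<in> carrier G" "y \<in> carrier G" "x \<otimes> y = y \<otimes> x"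
  shows "inv x \<otimes> y = y \<otimes> inv x"
proof -
  have "inv x \<otimes> (x \<otimes> y) \<otimes> inv x = inv x \<otimes> (y \<otimes> x) \<otimes> inv x"
    using assms(3) by simp
  moreover have "inv x \<otimes> (x \<otimes> y) \<otimes> inv x = y \<otimes> inv x"
    using assms(1,2) by (simp add: m_assoc[symmetric])
  moreover have "inv x \<otimes> (y \<otimes> x) \<otimes> inv x = inv x \<otimes> y"
    using assms(1,2) by (simp add: m_assoc)
  ultimately show ?thesis
    by simp
qed

lemma (in monoid) mult_interchange:
  assumes "a \<in> carrier G" "b \<in> carrier G" "x \<in> carrier G" "y \<in> carrier G" "b \<otimes> x = x \<otimes> b"
  shows "(a \<otimes> b) \<otimes> (x \<otimes> y) = (a \<otimes> x) \<otimes> (b \<otimes> y)"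
proof -
  have "(a \<otimes> b) \<otimes> (x \<otimes> y) = a \<otimes> (b \<otimes> x) \<otimes> y"
    using assms(1-4) by (simp add: m_assoc)
  then show ?thesis
    using assms by (simp add: m_assoc)
qed

text \<open>\<open>T\<close> and the values of \<open>\<gamma>\<close> generate a connected abelian
  subgroup. Its closure is a torus containing \<open>T\<close>, hence equal to
  \<open>T\<close>.\<close>

lemma (in Hausdorff_group) one_parameter_in_maximal_torus:
  assumes "compact_space X" and T: "maximal_torus G X T"
    and cont: "continuous_map (top_of_set {0..}) X \<gamma>"
    and add: "\<And>s t :: real. 0 \<le> s \<Longrightarrow> 0 \<le> t \<Longrightarrow> \<gamma> (s + t) = \<gamma> s \<otimes> \<gamma> t"
    and comm: "\<And>s t. 0 \<le> s \<Longrightarrow> t \<in> T \<Longrightarrow> \<gamma> s \<otimes> t = t \<otimes> \<gamma> s"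
    and s: "0 \<le> s"
  shows "\<gamma> s \<in> T"
proof -
  have tor: "subgroup T G" "connected_space (subtopology X T)" "comm_group (G\<lparr>carrier := T\<rparr>)"
    using T by (auto simp: maximal_torus_def torus_in_def torus_group_def)
  have TG: "T \<subseteq> carrier G"
    using tor(1) by (rule subgroup.subset)
  have carr: "\<gamma> s \<in> carrier G" if "0 \<le> s" for s
    using continuous_map_image_subset_topspace[OF cont] that by (auto simp: topspace)
  have Tcomm: "t \<otimes> u = u \<otimes> t" if "t \<in> T" "u \<in> T" for t u
    using comm_monoid.m_comm[OF comm_group.axioms(1)[OF tor(3)], of t u] that by simp
  \<comment> \<open>Since \<open>\<gamma>\<close> is additive on a half-line, closure under inverses
    takes a second parameter: elements are \<open>t\<close> times a quotient of two values of
    \<open>\<gamma>\<close>.\<close>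
  define h where "h t s s' = t \<otimes> (\<gamma> s \<otimes> inv \<gamma> s')" for t s s'
  have hG: "h t s s' \<in> carrier G" if "t \<in> T" "0 \<le> s" "0 \<le> s'" for t s s'
    using that carr TG by (auto simp: h_def)
  have \<gamma>comm: "\<gamma> s \<otimes> \<gamma> t = \<gamma> t \<otimes> \<gamma> s" if "0 \<le> s" "0 \<le> t" for s t
    using add[OF that] add[OF that(2,1)] by (simp add: add.commute)
  have h_mult: "h t s s' \<otimes> h u q q' = h (t \<otimes> u) (s + q) (s' + q')"
    if "t \<in> T" "0 \<le> s" "0 \<le> s'" "u \<in> T" "0 \<le> q" "0 \<le> q'" for t s s' u q q'
  proof -
    have mem: "t \<in> carrier G" "u \<in> carrier G" "\<gamma> s \<in> carrier G" "\<gamma> s' \<in> carrier G"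
      "\<gamma> q \<in> carrier G" "\<gamma> q' \<in> carrier G"
      using that TG carr by auto
    have "\<gamma> s \<otimes> inv \<gamma> s' \<otimes> u = \<gamma> s \<otimes> (u \<otimes> inv \<gamma> s')"
      using commute_inv[OF mem(4,2) comm[OF that(3,4)]] mem by (simp add: m_assoc)
    also have "\<dots> = \<gamma> s \<otimes> u \<otimes> inv \<gamma> s'"
      using mem by (simp add: m_assoc)
    also have "\<dots> = u \<otimes> (\<gamma> s \<otimes> inv \<gamma> s')"
      unfolding comm[OF that(2,4)] using mem by (simp add: m_assoc)
    finally have "h t s s' \<otimes> h u q q' = (t \<otimes> u) \<otimes> ((\<gamma> s \<otimes> inv \<gamma> s') \<otimes> (\<gamma> q \<otimes> inv \<gamma> q'))"
      unfolding h_def using mem by (intro mult_interchange) auto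
    also have "(\<gamma> s \<otimes> inv \<gamma> s') \<otimes> (\<gamma> q \<otimes> inv \<gamma> q') = (\<gamma> s \<otimes> \<gamma> q) \<otimes> (inv \<gamma> s' \<otimes> inv \<gamma> q')"
      using mem commute_inv[OF mem(4,5) \<gamma>comm[OF that(3,5)]] by (intro mult_interchange) auto
    also have "inv \<gamma> s' \<otimes> inv \<gamma> q' = inv \<gamma> (s' + q')"
      using mem \<gamma>comm[OF that(3,6)] add[OF that(3,6)] by (simp add: inv_mult_group)
    also have "\<gamma> s \<otimes> \<gamma> q = \<gamma> (s + q)"
      using add[OF that(2,5)] by simp
    finally show ?thesis
      by (simp add: h_def)
  qed
  have h_one: "h \<one> s s = \<one>" if "0 \<le> s" for s
    using carr[OF that] by (simp add: h_def)
  define H where "H = {h t s s' | t s s'. t \<in> T \<and> 0 \<le> s \<and> 0 \<le> s'}"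
  have H_I: "h t s s' \<in> H" if "t \<in> T" "0 \<le> s" "0 \<le> s'" for t s s'
    using that unfolding H_def by blast
  have one_T: "\<one> \<in> T"
    using tor(1) by (rule subgroup.one_closed)
  have "subgroup H G"
  proof
    show "H \<subseteq> carrier G"
      using hG by (auto simp: H_def)
    show "x \<otimes> y \<in> H" if xy: "x \<in> H" "y \<in> H" for x y
    proof -
      obtain t s s' u q q' where "x = h t s s'" "t \<in> T" "0 \<le> s" "0 \<le> s'"
        "y = h u q q'" "u \<in> T" "0 \<le> q" "0 \<le> q'"
        using xy by (auto simp: H_def)
      moreover from this have "x \<otimes> y = h (t \<otimes> u) (s + q) (s' + q')"
        using h_mult by simp
      moreover have "t \<otimes> u \<in> T"
        using subgroup.m_closed[OF tor(1)] calculation by blast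
      ultimately show ?thesis
        using H_I by simp
    qed
    show "\<one> \<in> H"
      using h_one[of 0] H_I[OF one_T, of 0 0] by simp
    show "inv x \<in> H" if xH: "x \<in> H" for x
    proof -
      obtain t s s' where x: "x = h t s s'" "t \<in> T" "0 \<le> s" "0 \<le> s'"
        using xH by (auto simp: H_def)
      have inv_T: "inv t \<in> T"
        using subgroup.m_inv_closed[OF tor(1) x(2)] .
      have "h (inv t) s' s \<otimes> x = h \<one> (s' + s) (s + s')"
        unfolding x(1) using h_mult[OF inv_T x(4,3) x(2,3,4)] x(2) TG by (auto simp: subset_iff)
      also have "\<dots> = \<one>"
        using h_one[of "s' + s"] x(3,4) by (simp add: add.commute)
      finally have "inv x = h (inv t) s' s"
        using hG x inv_T by (intro inv_equality) auto
      then show ?thesis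
        using H_I[OF inv_T x(4,3)] by simp
    qed
  qed
  moreover have "x \<otimes> y = y \<otimes> x" if xy: "x \<in> H" "y \<in> H" for x y
  proof -
    obtain t s s' u q q' where "x = h t s s'" "t \<in> T" "0 \<le> s" "0 \<le> s'"
      "y = h u q q'" "u \<in> T" "0 \<le> q" "0 \<le> q'"
      using xy by (auto simp: H_def)
    then show ?thesis
      using h_mult Tcomm by (simp add: add.commute)
  qed
  moreover have "connectedin X H"
  proof -
    let ?R = "top_of_set {0 :: real..}"
    let ?Y = "prod_topology (subtopology X T) (prod_topology ?R ?R)"
    have "connectedin euclidean {0 :: real..}"
      by simp
    then have "connected_space ?R"
      unfolding connectedin_def by blast
    then have "connected_space ?Y"
      unfolding connected_space_prod_topology using tor(2) by blast
    moreover have "continuous_map ?Y X (\<lambda>p. fst p \<otimes> (\<gamma> (fst (snd p)) \<otimes> inv \<gamma> (snd (snd p))))"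
    proof (intro continuous_map_mult continuous_map_inv)
      show "continuous_map ?Y X fst"
        using continuous_map_fst continuous_map_into_fulltopology by blast
      show "continuous_map ?Y X (\<lambda>p. \<gamma> (fst (snd p)))"
        by (rule continuous_map_compose[OF
              continuous_map_compose[OF continuous_map_snd continuous_map_fst] cont, unfolded o_def])
      show "continuous_map ?Y X (\<lambda>p. \<gamma> (snd (snd p)))"
        by (rule continuous_map_compose[OF
              continuous_map_compose[OF continuous_map_snd continuous_map_snd] cont, unfolded o_def])
    qed
    ultimately have "connectedin X ((\<lambda>p. fst p \<otimes> (\<gamma> (fst (snd p)) \<otimes> inv \<gamma> (snd (snd p)))) ` topspace ?Y)"
      using connectedin_continuous_map_image connectedin_topspace by blast
    moreover have "(\<lambda>p. fst p \<otimes> (\<gamma> (fst (snd p)) \<otimes> inv \<gamma> (snd (snd p)))) ` topspace ?Y = H"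
      using TG by (auto simp: H_def h_def image_def topspace)
    ultimately show ?thesis
      by simp
  qed
  ultimately have "torus_in G X (X closure_of H)"
    using torus_in_closure_of assms(1) by blast
  moreover have sub: "H \<subseteq> X closure_of H"
    using closure_of_subset[of H X] hG topspace by (auto simp: H_def)
  have "h t 0 0 = t" if "t \<in> T" for t
    using that TG carr[of 0] by (auto simp: h_def)
  then have "T \<subseteq> H"
    using H_I[of _ 0 0] by fastforce
  ultimately have "X closure_of H = T"
    using T sub by (auto simp: maximal_torus_def)
  moreover have "\<gamma> 0 = \<one>"
    using add[of 0 0] carr[of 0] by (metis add_0 l_cancel_one' order_refl)
  then have "h \<one> s 0 = \<gamma> s"
    using carr[OF s] by (simp add: h_def)
  then have "\<gamma> s \<in> H"
    using H_I[OF one_T s, of 0] by simp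
  ultimately show ?thesis
    using sub by blast
qed

context group_chart
begin

text \<open>The bound at small times gives continuity at 0, and additivity carries it to every
  \<open>s\<close>.\<close>

lemma one_parameter_continuous:
  assumes carr: "\<And>s. \<gamma> s \<in> carrier G"
    and add: "\<And>s t. 0 \<le> s \<Longrightarrow> 0 \<le> t \<Longrightarrow> \<gamma> (s + t) = \<gamma> s \<otimes> \<gamma> t"
    and small: "\<And>s. 0 \<le> s \<Longrightarrow> s \<le> r / 2 \<Longrightarrow> \<gamma> s \<in> U \<and> norm (\<psi> (\<gamma> s)) \<le> 2 * s"
  shows "continuous_map (top_of_set {0..}) X \<gamma>"
proof -
  have "openin (top_of_set {0..}) {s \<in> {0..}. \<gamma> s \<in> S}" if S: "openin X S" for S
    unfolding openin_euclidean_subtopology_iff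
  proof (intro conjI ballI)
    fix s assume s: "s \<in> {s \<in> {0..}. \<gamma> s \<in> S}"
    \<comment> \<open>The second set serves the times \<open>s' < s\<close>, where
      \<open>\<gamma> s' = \<gamma> s \<otimes> inv \<gamma> (s - s')\<close>.\<close>
    let ?S = "{y \<in> topspace X. \<gamma> s \<otimes> y \<in> S} \<inter> {y \<in> topspace X. \<gamma> s \<otimes> inv y \<in> S}"
    have "openin X ?S"
      by (intro openin_Int openin_continuous_map_preimage[OF _ S] group_continuous_intros carr)
    moreover have "\<one> \<in> ?S"
      using s carr by (auto simp: topspace)
    ultimately obtain \<rho> where \<rho>: "\<rho> > 0" "\<rho> \<le> r" "{x \<in> U. norm (\<psi> x) \<le> \<rho>} \<subseteq> ?S"
      using chart_ball_basis by meson
    have small': "\<gamma> q \<in> ?S" if "0 \<le> q" "q < \<rho> / 2" for q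
      using small[of q] that \<rho> by auto
    have "s' \<in> {s \<in> {0..}. \<gamma> s \<in> S}" if s': "s' \<in> {0..}" "dist s' s < \<rho> / 2" for s'
    proof (cases "s \<le> s'")
      case True
      then have "\<gamma> (s' - s) \<in> ?S"
        using s' by (intro small') (auto simp: dist_real_def)
      then show ?thesis
        using add[of s "s' - s"] s s' True by auto
    next
      case False
      then have "\<gamma> (s - s') \<in> ?S"
        using s' by (intro small') (auto simp: dist_real_def)
      moreover have "\<gamma> s \<otimes> inv \<gamma> (s - s') = \<gamma> s'"
        using add[of s' "s - s'"] s s' False carr by (simp add: m_assoc)
      ultimately show ?thesis
        using s' by auto
    qed
    then show "\<exists>e>0. \<forall>s'\<in>{0..}. dist s' s < e \<longrightarrow> s' \<in> {s \<in> {0..}. \<gamma> s \<in> S}"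
      using \<rho>(1) by (intro exI[of _ "\<rho> / 2"]) auto
  qed auto
  then show ?thesis
    using carr by (auto simp: continuous_map_def topspace)
qed

end

section \<open>The maximal torus is open in its normalizer\<close>

lemma (in group) commuting_in_normalizer:
  assumes "K \<subseteq> carrier G" "a \<in> carrier G" "\<And>k. k \<in> K \<Longrightarrow> a \<otimes> k = k \<otimes> a"
  shows "a \<in> normalizer G K"
proof -
  have "a \<otimes> k \<otimes> inv a = k" if "k \<in> K" for k
    using assms that by (auto simp: m_assoc)
  then have "a <# K #> inv a = K"
    by (auto simp: l_coset_def r_coset_def)
  then show ?thesis
    using assms(1,2) by (simp add: normalizer_def stabilizer_def)
qed

context group_chart
begin

text \<open>Otherwise there are \<open>x\<^sub>j \<rightarrow> 1\<close> in the normalizer, outside \<open>T\<close> and of nearly minimal norm in their cosets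
  of \<open>T\<close>.  They commute with \<open>T\<close>, so that the limiting one-parameter group \<open>\<gamma>\<close> lies in \<open>T\<close> by maximality,
  and then \<open>\<gamma>(norm (\<psi> x\<^sub>j))\<^sup>-\<^sup>1 x\<^sub>j\<close> has much smaller norm than \<open>x\<^sub>j\<close>.\<close>

lemma normalizer_subset_torus_near_one:
  assumes T: "maximal_torus G X T"
  obtains S where "openin X S" "\<one> \<in> S" "S \<inter> normalizer G T \<subseteq> T"
proof (rule ccontr)
  assume "\<not> thesis"
  then have out: "\<exists>n. n \<in> S \<and> n \<in> normalizer G T \<and> n \<notin> T" if "openin X S" "\<one> \<in> S" for S
    using that \<open>\<And>S. openin X S \<Longrightarrow> \<one> \<in> S \<Longrightarrow> S \<inter> normalizer G T \<subseteq> T \<Longrightarrow> thesis\<close> by blast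
  have tor: "subgroup T G" "closedin X T" "comm_group (G\<lparr>carrier := T\<rparr>)"
    using T by (auto simp: maximal_torus_def torus_in_def torus_group_def)
  have TG: "T \<subseteq> carrier G"
    using tor(1) by (rule subgroup.subset)
  have Tcomm: "t \<otimes> u = u \<otimes> t" if "t \<in> T" "u \<in> T" for t u
    using comm_monoid.m_comm[OF comm_group.axioms(1)[OF tor(3)], of t u] that by simp
  obtain S0 where S0: "openin X S0" "\<one> \<in> S0"
    "\<And>n t. n \<in> S0 \<Longrightarrow> n \<in> normalizer G T \<Longrightarrow> t \<in> T \<Longrightarrow> n \<otimes> t = t \<otimes> n"
    using normalizer_centralizes_near_one[OF tor(1,2) Tcomm] by blast
  \<comment> \<open>The last clause is near minimality: within the radius \<open>r\<close>, left
    multiplication by an element of \<open>T\<close> can at best halve the norm.\<close>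
  define D where "D x \<longleftrightarrow> x \<in> U \<and> 0 < norm (\<psi> x) \<and> norm (\<psi> x) \<le> r \<and> (\<forall>t\<in>T. x \<otimes> t = t \<otimes> x) \<and>
    (\<forall>s\<in>T. s \<otimes> x \<in> U \<longrightarrow> norm (\<psi> (s \<otimes> x)) \<le> r \<longrightarrow> norm (\<psi> x) \<le> 2 * norm (\<psi> (s \<otimes> x)))" for x
  have D: "\<exists>x. D x \<and> norm (\<psi> x) < e" if e: "0 < e" for e
  proof -
    \<comment> \<open>The halved radii compensate for \<open>near_minimal_representative\<close>,
      which may double the norm.\<close>
    let ?S = "S0 \<inter> {x \<in> U. norm (\<psi> x) < min (e / 2) (r / 2)}"
    have "openin X {x \<in> U. norm (\<psi> x) < min (e / 2) (r / 2)}"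
      using r_pos by (intro openin_chart_ball) linarith
    then have "openin X ?S"
      using S0(1) by (rule openin_Int[rotated])
    moreover have "\<one> \<in> ?S"
      using S0(2) e r_pos one_in chart_one by simp
    ultimately obtain n where n: "n \<in> S0" "n \<in> U" "norm (\<psi> n) < e / 2" "norm (\<psi> n) < r / 2"
      "n \<in> normalizer G T" "n \<notin> T"
      using out[of ?S] by auto
    have "norm (\<psi> n) \<le> r"
      using n(4) r_pos by linarith
    then obtain t where t: "t \<in> T" "t \<otimes> n \<in> U" "norm (\<psi> (t \<otimes> n)) \<le> 2 * norm (\<psi> n)"
      "\<And>s. s \<in> T \<Longrightarrow> s \<otimes> (t \<otimes> n) \<in> U \<Longrightarrow> norm (\<psi> (s \<otimes> (t \<otimes> n))) \<le> r \<Longrightarrow>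
        norm (\<psi> (t \<otimes> n)) \<le> 2 * norm (\<psi> (s \<otimes> (t \<otimes> n)))"
      using near_minimal_representative[OF tor(1,2) n(2) _ n(6)] by metis
    have nG: "n \<in> carrier G" and tG: "t \<in> carrier G"
      using chart_carrier n(2) \<open>norm (\<psi> n) \<le> r\<close> t(1) TG by auto
    have "t \<otimes> n \<noteq> \<one>"
    proof
      assume "t \<otimes> n = \<one>"
      then have "n = inv t"
        using nG tG by (metis inv_equality inv_inv inv_closed)
      then show False
        using n(6) subgroup.m_inv_closed[OF tor(1) t(1)] by simp
    qed
    then have "0 < norm (\<psi> (t \<otimes> n))"
      using chart_eq_0[OF t(2)] by auto
    moreover have "t \<otimes> n \<otimes> u = u \<otimes> (t \<otimes> n)" if u: "u \<in> T" for u
    proof -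
      have uG: "u \<in> carrier G"
        using u TG by blast
      have "t \<otimes> n \<otimes> u = t \<otimes> (n \<otimes> u)"
        using nG tG uG by (simp add: m_assoc)
      also have "n \<otimes> u = u \<otimes> n"
        by (rule S0(3)[OF n(1,5) u])
      also have "t \<otimes> (u \<otimes> n) = (t \<otimes> u) \<otimes> n"
        using nG tG uG by (simp add: m_assoc)
      also have "t \<otimes> u = u \<otimes> t"
        by (rule Tcomm[OF t(1) u])
      finally show ?thesis
        using nG tG uG by (simp add: m_assoc)
    qed
    ultimately have "D (t \<otimes> n)"
      using t n(4) by (auto simp: D_def)
    moreover have "norm (\<psi> (t \<otimes> n)) < e"
      using t(3) n(3) by linarith
    ultimately show ?thesis
      by blast
  qed
  have "\<exists>x. D x \<and> norm (\<psi> x) < inverse (real (Suc j))" for j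
    by (rule D) simp
  then obtain y where y: "\<And>j. D (y j)" "\<And>j. norm (\<psi> (y j)) < inverse (real (Suc j))"
    by metis
  let ?u = "\<lambda>x. \<psi> x /\<^sub>R norm (\<psi> x)"
  have unit: "?u x \<in> sphere 0 1" if "D x" for x
    using that by (auto simp: D_def)
  \<comment> \<open>Directions lie in a Euclidean sphere, so here a convergent subsequence does
    exist.\<close>
  have "seq_compact (sphere (0 :: 'e) 1)"
    by (intro compact_imp_seq_compact compact_sphere)
  then obtain v \<sigma> where v: "v \<in> sphere 0 1" and \<sigma>: "strict_mono \<sigma>" "((\<lambda>j. ?u (y j)) \<circ> \<sigma>) \<longlonglongrightarrow> v"
    using unit[OF y(1)] by (elim seq_compactE[where f = "\<lambda>j. ?u (y j)"]) auto
  define x where "x j = y (\<sigma> j)" for j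
  have Dx: "D (x j)" for j
    using y(1) by (simp add: x_def)
  have x_D: "\<And>j. x j \<in> U" "\<And>j. 0 < norm (\<psi> (x j))" "\<And>j. norm (\<psi> (x j)) \<le> r"
    using Dx by (auto simp: D_def)
  have "(\<lambda>j. norm (\<psi> (y j))) \<longlonglongrightarrow> 0"
    using y(2) less_imp_le
    by (intro real_tendsto_sandwich[OF _ _ tendsto_const LIMSEQ_inverse_real_of_nat] always_eventually) auto
  then have lim0: "(\<lambda>j. norm (\<psi> (x j))) \<longlonglongrightarrow> 0"
    using LIMSEQ_subseq_LIMSEQ[OF _ \<sigma>(1)] by (auto simp: x_def o_def)
  have limv: "(\<lambda>j. ?u (x j)) \<longlonglongrightarrow> v"
    using \<sigma>(2) by (simp add: x_def o_def)
  obtain \<gamma> :: "real \<Rightarrow> 'a" where \<gamma>: "\<And>s. \<gamma> s \<in> carrier G"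
    "\<And>s t. 0 \<le> s \<Longrightarrow> 0 \<le> t \<Longrightarrow> \<gamma> (s + t) = \<gamma> s \<otimes> \<gamma> t"
    "\<And>s. 0 \<le> s \<Longrightarrow> s \<le> r / 2 \<Longrightarrow> \<gamma> s \<in> U"
    "\<And>s. 0 \<le> s \<Longrightarrow> s \<le> r / 2 \<Longrightarrow> norm (\<psi> (\<gamma> s) - s *\<^sub>R v) \<le> c * s\<^sup>2"
    "\<And>s t. t \<in> carrier G \<Longrightarrow> \<forall>j. x j \<otimes> t = t \<otimes> x j \<Longrightarrow> \<gamma> s \<otimes> t = t \<otimes> \<gamma> s"
    by (rule one_parameter_limit[OF x_D lim0 limv]) (rule that)
  have small: "\<gamma> s \<in> U \<and> norm (\<psi> (\<gamma> s)) \<le> 2 * s" if s: "0 \<le> s" "s \<le> r / 2" for s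
  proof -
    have "c * s \<le> c * r"
      using s r_pos c_nonneg by (intro mult_left_mono) auto
    then have "c * s * s \<le> 1 * s"
      using c_r s(1) by (intro mult_right_mono) auto
    moreover have "norm (\<psi> (\<gamma> s)) \<le> norm (\<psi> (\<gamma> s) - s *\<^sub>R v) + s"
      using norm_triangle_sub[of "\<psi> (\<gamma> s)" "s *\<^sub>R v"] v s(1) by simp
    ultimately show ?thesis
      using \<gamma>(3,4)[OF s] by (simp add: power2_eq_square mult.assoc)
  qed
  have "continuous_map (top_of_set {0..}) X \<gamma>"
    using \<gamma>(1,2) small by (rule one_parameter_continuous)
  moreover have "\<gamma> s \<otimes> t = t \<otimes> \<gamma> s" if "t \<in> T" for s t
    using \<gamma>(5)[of t] Dx that TG by (auto simp: D_def)
  ultimately have \<gamma>T: "\<gamma> s \<in> T" if "0 \<le> s" for s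
    using one_parameter_in_maximal_torus[OF compact_space T _ \<gamma>(2)] that by blast
  \<comment> \<open>A quotient of two elements near \<open>\<one>\<close> stays in the chart with
    norm below \<open>r\<close>; this makes both near minimality and \<open>chart_mult\<close>
    applicable to \<open>z\<close> below.\<close>
  let ?W = "{p \<in> topspace (prod_topology X X). inv (fst p) \<otimes> snd p \<in> {y \<in> U. norm (\<psi> y) < r}}"
  have "openin (prod_topology X X) ?W"
    by (rule openin_continuous_map_preimage[OF _ openin_chart_ball[OF order_refl]])
       (intro group_continuous_intros)
  moreover have "(\<one>, \<one>) \<in> ?W"
    using r_pos one_in chart_one by (simp add: topspace)
  ultimately obtain A B where AB: "openin X A" "openin X B" "\<one> \<in> A" "\<one> \<in> B" "A \<times> B \<subseteq> ?W"
    by (rule openin_prod_topologyE)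
  then obtain \<rho> where \<rho>: "\<rho> > 0" "{x \<in> U. norm (\<psi> x) \<le> \<rho>} \<subseteq> A \<inter> B"
    using chart_ball_basis[of "A \<inter> B"] by auto
  have "(\<lambda>j. norm (?u (x j) - v)) \<longlonglongrightarrow> norm (v - v)"
    by (intro tendsto_intros limv)
  \<comment> \<open>The bound \<open>\<rho> / 2\<close> puts \<open>\<gamma> s\<close>, of norm at
    most \<open>2 * s\<close>, into \<open>A\<close>. The bounds \<open>1 / 8\<close> and
    \<open>r / 8\<close> make the error terms below \<open>s / 8\<close>, \<open>s / 8\<close> and a
    quarter of \<open>norm (\<psi> z)\<close>.\<close>
  then have "eventually (\<lambda>j. norm (?u (x j) - v) < 1 / 8) sequentially"
    by (rule order_tendstoD(2)) simp
  moreover have "eventually (\<lambda>j. norm (\<psi> (x j)) < min (\<rho> / 2) (r / 8)) sequentially"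
    using \<rho>(1) r_pos by (intro order_tendstoD(2)[OF lim0]) simp
  ultimately have "eventually (\<lambda>j. norm (?u (x j) - v) < 1 / 8 \<and> norm (\<psi> (x j)) < min (\<rho> / 2) (r / 8)) sequentially"
    by (rule eventually_conj)
  then obtain j where j: "norm (?u (x j) - v) < 1 / 8" "norm (\<psi> (x j)) < min (\<rho> / 2) (r / 8)"
    using eventually_happens' sequentially_bot by blast
  define s where "s = norm (\<psi> (x j))"
  have s: "0 < s" "s < \<rho> / 2" "s < r / 8" "0 \<le> s" "s \<le> r / 2"
    using j(2) Dx[of j] by (auto simp: s_def D_def)
  define z where "z = inv (\<gamma> s) \<otimes> x j"
  have gU: "\<gamma> s \<in> U" "norm (\<psi> (\<gamma> s)) \<le> 2 * s"
    using small s(4,5) by auto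
  have xU: "x j \<in> U" "norm (\<psi> (x j)) \<le> r"
    using Dx[of j] by (auto simp: D_def)
  have xG: "x j \<in> carrier G"
    using chart_carrier xU by blast
  have "norm (\<psi> (\<gamma> s)) \<le> \<rho>" "norm (\<psi> (x j)) \<le> \<rho>"
    using gU(2) s(1,2) by (auto simp flip: s_def)
  then have "\<gamma> s \<in> A" "x j \<in> B"
    using \<rho>(2) gU(1) xU(1) by auto
  then have "(\<gamma> s, x j) \<in> ?W"
    using AB(5) by blast
  then have z: "z \<in> U" "norm (\<psi> z) \<le> r"
    by (auto simp: z_def)
  have "inv (\<gamma> s) \<in> T"
    using subgroup.m_inv_closed[OF tor(1) \<gamma>T[OF s(4)]] .
  then have "s \<le> 2 * norm (\<psi> z)"
    using Dx[of j] z by (auto simp: D_def z_def s_def)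
  \<comment> \<open>Both \<open>\<psi> (x j)\<close> and \<open>\<psi> (\<gamma> s)\<close> are
    within \<open>s / 8\<close> of \<open>s *\<^sub>R v\<close>, so \<open>norm (\<psi> z)\<close>
    is at most \<open>s / 4\<close> plus a quarter of itself. Near minimality demands at least
    \<open>s / 2\<close>.\<close>
  moreover have "norm (\<psi> z) \<le> s / 3"
  proof -
    have "\<gamma> s \<otimes> z = x j"
      using xG \<gamma>(1) by (simp add: z_def m_assoc[symmetric])
    moreover have "norm (\<psi> (\<gamma> s)) \<le> r"
      using gU(2) s(3) r_pos by linarith
    ultimately have "norm (\<psi> (x j) - \<psi> (\<gamma> s) - \<psi> z) \<le> c * norm (\<psi> (\<gamma> s)) * norm (\<psi> z)"
      using chart_mult[OF gU(1) z(1) _ z(2)] by simp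
    also have "\<dots> \<le> 1 / 4 * norm (\<psi> z)"
    proof (rule mult_right_mono)
      have "c * norm (\<psi> (\<gamma> s)) \<le> c * (r / 4)"
        using gU(2) s(3) c_nonneg by (intro mult_left_mono) auto
      then show "c * norm (\<psi> (\<gamma> s)) \<le> 1 / 4"
        using c_r by simp
    qed simp
    finally have 1: "norm (\<psi> (x j) - \<psi> (\<gamma> s) - \<psi> z) \<le> 1 / 4 * norm (\<psi> z)" .
    have "\<psi> (x j) - s *\<^sub>R v = s *\<^sub>R (?u (x j) - v)"
      using s(1) by (simp add: s_def scaleR_diff_right)
    then have "norm (\<psi> (x j) - s *\<^sub>R v) = s * norm (?u (x j) - v)"
      using s(4) by (simp only: norm_scaleR abs_of_nonneg)
    also have "\<dots> \<le> s * (1 / 8)"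
      using j(1) s(4) by (intro mult_left_mono) auto
    finally have 2: "norm (\<psi> (x j) - s *\<^sub>R v) \<le> s * (1 / 8)" .
    have "c * s \<le> c * (r / 8)"
      using s(3) c_nonneg by (intro mult_left_mono) auto
    then have "c * s * s \<le> 1 / 8 * s"
      using c_r s(4) by (intro mult_right_mono) auto
    then have 3: "norm (\<psi> (\<gamma> s) - s *\<^sub>R v) \<le> 1 / 8 * s"
      using \<gamma>(4)[OF s(4,5)] by (simp add: power2_eq_square mult.assoc)
    let ?a = "\<psi> (x j) - s *\<^sub>R v" and ?b = "\<psi> (\<gamma> s) - s *\<^sub>R v" and ?d = "\<psi> (x j) - \<psi> (\<gamma> s) - \<psi> z"
    have "norm (\<psi> z) = norm (?a - ?b - ?d)"
      by simp
    then have "norm (\<psi> z) \<le> norm ?a + norm ?b + norm ?d"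
      using norm_triangle_ineq4[of "?a - ?b" ?d] norm_triangle_ineq4[of ?a ?b] by linarith
    then show ?thesis
      using 1 2 3 by linarith
  qed
  ultimately show False
    using s(1) by linarith
qed

end

text \<open>Left translation by \<open>t \<in> T\<close> carries the neighbourhood found at
  \<open>\<one>\<close> to \<open>t\<close>.\<close>

lemma maximal_torus_open_in_normalizer:
  fixes G :: "'g monoid" and V :: "'e::euclidean_space set"
  assumes "compact_lie_group G X V C" and T: "maximal_torus G X T"
  shows "openin (subtopology X (normalizer G T)) T"
proof -
  obtain U r c and \<psi> :: "'g \<Rightarrow> 'e" where "group_chart G X U \<psi> r c"
    using compact_lie_group_chart[OF assms(1)] by blast
  then interpret group_chart G X U \<psi> r c .
  have tor: "subgroup T G" "comm_group (G\<lparr>carrier := T\<rparr>)"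
    using T by (auto simp: maximal_torus_def torus_in_def torus_group_def)
  have TG: "T \<subseteq> carrier G"
    using tor(1) by (rule subgroup.subset)
  have N: "subgroup (normalizer G T) G"
    using TG by (rule normalizer_imp_subgroup)
  have "t \<otimes>\<^bsub>G\<^esub> u = u \<otimes>\<^bsub>G\<^esub> t" if "t \<in> T" "u \<in> T" for t u
    using comm_monoid.m_comm[OF comm_group.axioms(1)[OF tor(2)], of t u] that by simp
  then have TN: "T \<subseteq> normalizer G T"
    using TG commuting_in_normalizer[OF TG] by blast
  obtain S where S: "openin X S" "\<one>\<^bsub>G\<^esub> \<in> S" "S \<inter> normalizer G T \<subseteq> T"
    using normalizer_subset_torus_near_one[OF T] by blast
  have "\<exists>O'. openin (subtopology X (normalizer G T)) O' \<and> t \<in> O' \<and> O' \<subseteq> T" if t: "t \<in> T" for t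
  proof (intro exI conjI)
    let ?S = "{x \<in> topspace X. inv\<^bsub>G\<^esub> t \<otimes>\<^bsub>G\<^esub> x \<in> S}"
    have tG: "t \<in> carrier G"
      using t TG by blast
    have "openin X ?S"
      using tG by (intro openin_continuous_map_preimage[OF _ S(1)] group_continuous_intros) auto
    then show "openin (subtopology X (normalizer G T)) (?S \<inter> normalizer G T)"
      by (simp add: openin_subtopology_Int)
    show "t \<in> ?S \<inter> normalizer G T"
      using t tG TN S(2) by (auto simp: topspace)
    show "?S \<inter> normalizer G T \<subseteq> T"
    proof
      fix x assume x: "x \<in> ?S \<inter> normalizer G T"
      then have xG: "x \<in> carrier G"
        by (auto simp: topspace)
      have "inv\<^bsub>G\<^esub> t \<in> normalizer G T"
        using subgroup.m_inv_closed[OF tor(1) t] TN by blast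
      then have "inv\<^bsub>G\<^esub> t \<otimes>\<^bsub>G\<^esub> x \<in> normalizer G T"
        using x subgroup.m_closed[OF N] by blast
      then have "inv\<^bsub>G\<^esub> t \<otimes>\<^bsub>G\<^esub> x \<in> T"
        using S(3) x by blast
      then have "t \<otimes>\<^bsub>G\<^esub> (inv\<^bsub>G\<^esub> t \<otimes>\<^bsub>G\<^esub> x) \<in> T"
        by (rule subgroup.m_closed[OF tor(1) t])
      then show "x \<in> T"
        using xG tG by (simp add: m_assoc[symmetric])
    qed
  qed
  then show ?thesis
    by (subst openin_subopen) blast
qed

section \<open>Maps induced by the identity\<close>

lemma openin_quotient_topology:
  "openin (quotient_topology X q) U \<longleftrightarrow> U \<subseteq> q ` topspace X \<and> openin X {x \<in> topspace X. q x \<in> U}"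
proof -
  have "istopology (\<lambda>U. U \<subseteq> q ` topspace X \<and> openin X {x \<in> topspace X. q x \<in> U})"
    unfolding istopology_def
  proof (intro conjI allI impI)
    fix S T assume "S \<subseteq> q ` topspace X \<and> openin X {x \<in> topspace X. q x \<in> S}"
      "T \<subseteq> q ` topspace X \<and> openin X {x \<in> topspace X. q x \<in> T}"
    moreover have "{x \<in> topspace X. q x \<in> S \<inter> T} = {x \<in> topspace X. q x \<in> S} \<inter> {x \<in> topspace X. q x \<in> T}"
      by blast
    ultimately show "S \<inter> T \<subseteq> q ` topspace X" "openin X {x \<in> topspace X. q x \<in> S \<inter> T}"
      by (auto intro: openin_Int)
  next
    fix \<K> assume K: "\<forall>S\<in>\<K>. S \<subseteq> q ` topspace X \<and> openin X {x \<in> topspace X. q x \<in> S}"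
    then show "\<Union>\<K> \<subseteq> q ` topspace X"
      by blast
    have "{x \<in> topspace X. q x \<in> \<Union>\<K>} = (\<Union>S\<in>\<K>. {x \<in> topspace X. q x \<in> S})"
      by blast
    then show "openin X {x \<in> topspace X. q x \<in> \<Union>\<K>}"
      using K by (auto intro: openin_Union)
  qed
  then show ?thesis
    by (simp add: quotient_topology_def topology_inverse')
qed

lemma topspace_quotient_topology: "topspace (quotient_topology X q) = q ` topspace X"
proof
  show "topspace (quotient_topology X q) \<subseteq> q ` topspace X"
    using openin_topspace[of "quotient_topology X q"] unfolding openin_quotient_topology by blast
  have "{x \<in> topspace X. q x \<in> q ` topspace X} = topspace X"
    by blast
  then show "q ` topspace X \<subseteq> topspace (quotient_topology X q)"
    by (intro openin_subset) (simp add: openin_quotient_topology)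
qed

section \<open>Cohomology classes under maps that fix a space pointwise\<close>

lemma coboundary_add:
  "coboundary Y (\<lambda>p \<sigma>. \<phi> p \<sigma> + \<phi>' p \<sigma>) n \<sigma> = coboundary Y \<phi> n \<sigma> + coboundary Y \<phi>' n \<sigma>"
  by (simp add: coboundary_def distrib_left sum.distrib)

lemma cochain_add_closed:
  assumes "\<phi> \<in> carrier (cochain_ring Y)" "\<phi>' \<in> carrier (cochain_ring Y)"
  shows "(\<lambda>p \<sigma>. \<phi> p \<sigma> + \<phi>' p \<sigma>) \<in> carrier (cochain_ring Y)"
proof -
  have "{p. (\<lambda>\<sigma>. \<phi> p \<sigma> + \<phi>' p \<sigma>) \<noteq> (\<lambda>_. 0)} \<subseteq> {p. \<phi> p \<noteq> (\<lambda>_. 0)} \<union> {p. \<phi>' p \<noteq> (\<lambda>_. 0)}"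
    by auto
  then show ?thesis
    using assms by (auto simp: cochain_ring_def intro: finite_subset)
qed

lemma coboundary_closed:
  assumes "\<phi> \<in> carrier (cochain_ring Y)"
  shows "coboundary Y \<phi> \<in> carrier (cochain_ring Y)"
proof -
  have "{n. coboundary Y \<phi> n \<noteq> (\<lambda>_. 0)} \<subseteq> Suc ` {p. \<phi> p \<noteq> (\<lambda>_. 0)}"
  proof
    fix n assume "n \<in> {n. coboundary Y \<phi> n \<noteq> (\<lambda>_. 0)}"
    then obtain \<sigma> where "coboundary Y \<phi> n \<sigma> \<noteq> 0"
      by auto
    then have "0 < n" "\<phi> (n - 1) \<noteq> (\<lambda>_. 0)"
      by (auto simp: coboundary_def split: if_splits)
    then show "n \<in> Suc ` {p. \<phi> p \<noteq> (\<lambda>_. 0)}"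
      by (intro image_eqI[of _ _ "n - 1"]) auto
  qed
  moreover have "finite {p. \<phi> p \<noteq> (\<lambda>_. 0)}"
    using assms by (simp add: cochain_ring_def)
  ultimately have "finite {n. coboundary Y \<phi> n \<noteq> (\<lambda>_. 0)}"
    by (meson finite_imageI finite_subset)
  then show ?thesis
    by (simp add: cochain_ring_def coboundary_def)
qed

lemma cohomology_class_alt:
  "cohomology_class Y \<phi> = {(\<lambda>p \<sigma>. coboundary Y \<beta> p \<sigma> + \<phi> p \<sigma>) | \<beta>. \<beta> \<in> carrier (cochain_ring Y)}"
  by (auto simp: cohomology_class_def coboundaries_def a_r_coset_def r_coset_def cochain_ring_def)

lemma cohomology_class_subset:
  assumes "\<phi> \<in> carrier (cochain_ring Y)"
  shows "cohomology_class Y \<phi> \<subseteq> carrier (cochain_ring Y)"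
  using assms by (auto simp: cohomology_class_alt intro!: cochain_add_closed coboundary_closed)

lemma cohomology_class_self: "\<phi> \<in> cohomology_class Y \<phi>"
proof -
  have "(\<lambda>p \<sigma>. 0) \<in> carrier (cochain_ring Y)"
    by (simp add: cochain_ring_def)
  moreover have "coboundary Y (\<lambda>p \<sigma>. 0) p \<sigma> = 0" for p \<sigma>
    by (simp add: coboundary_def)
  ultimately show ?thesis
    unfolding cohomology_class_alt by force
qed

lemma cohomology_class_mono:
  assumes "\<phi> \<in> cohomology_class Y \<phi>'"
  shows "cohomology_class Y \<phi> \<subseteq> cohomology_class Y \<phi>'"
proof
  obtain \<beta>' where \<beta>': "\<beta>' \<in> carrier (cochain_ring Y)" "\<phi> = (\<lambda>p \<sigma>. coboundary Y \<beta>' p \<sigma> + \<phi>' p \<sigma>)"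
    using assms by (auto simp: cohomology_class_alt)
  fix \<theta> assume "\<theta> \<in> cohomology_class Y \<phi>"
  then obtain \<beta> where \<beta>: "\<beta> \<in> carrier (cochain_ring Y)" "\<theta> = (\<lambda>p \<sigma>. coboundary Y \<beta> p \<sigma> + \<phi> p \<sigma>)"
    by (auto simp: cohomology_class_alt)
  have "\<theta> = (\<lambda>p \<sigma>. coboundary Y (\<lambda>p \<sigma>. \<beta> p \<sigma> + \<beta>' p \<sigma>) p \<sigma> + \<phi>' p \<sigma>)"
    unfolding \<beta>(2) \<beta>'(2) coboundary_add by (simp add: add.assoc)
  then show "\<theta> \<in> cohomology_class Y \<phi>'"
    unfolding cohomology_class_alt using cochain_add_closed[OF \<beta>(1) \<beta>'(1)] by blast
qed

text \<open>A singular simplex takes values in \<open>topspace Y\<close> and is extensional, so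
  composing it with \<open>f\<close> changes nothing; on all other functions both cochains are
  zero.\<close>

lemma cochain_pullback_ident:
  assumes \<phi>: "\<phi> \<in> carrier (cochain_ring Y)" and f: "\<And>y. y \<in> topspace Y \<Longrightarrow> f y = y"
  shows "cochain_pullback Y f \<phi> = \<phi>"
proof (intro ext)
  fix p \<sigma>
  show "cochain_pullback Y f \<phi> p \<sigma> = \<phi> p \<sigma>"
  proof (cases "singular_simplex p Y \<sigma>")
    case True
    then have "continuous_map (subtopology (powertop_real UNIV) (standard_simplex p)) Y \<sigma>"
      and ext: "\<sigma> \<in> extensional (standard_simplex p)"
      by (auto simp: singular_simplex_def)
    then have "\<sigma> t \<in> topspace Y" if "t \<in> standard_simplex p" for t
      using that by (auto simp: continuous_map_def)
    then have "simplex_map p f \<sigma> = \<sigma>"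
      using ext f by (auto simp: simplex_map_def fun_eq_iff extensional_def)
    then show ?thesis
      using True by (simp add: cochain_pullback_def)
  next
    case False
    then show ?thesis
      using \<phi> by (simp add: cochain_pullback_def cochain_ring_def)
  qed
qed

text \<open>Stated for unions of classes because \<open>euler_class\<close> is such a union, over
  all Thom cocycles; in this form the uniqueness of the Thom class does not have to be
  proved.\<close>

lemma cohomology_map_ident:
  assumes S: "S \<subseteq> carrier (cochain_ring Y)" and f: "\<And>y. y \<in> topspace Y \<Longrightarrow> f y = y"
  shows "cohomology_map Y f (\<Union>(cohomology_class Y ` S)) = \<Union>(cohomology_class Y ` S)"
proof -
  have "cohomology_map Y f (\<Union>(cohomology_class Y ` S)) =
      (\<Union>\<phi>\<in>\<Union>(cohomology_class Y ` S). cohomology_class Y \<phi>)"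
    unfolding cohomology_map_def using S cohomology_class_subset[of _ Y] f
    by (intro SUP_cong refl arg_cong[of _ _ "cohomology_class Y"] cochain_pullback_ident) blast+
  also have "\<dots> = \<Union>(cohomology_class Y ` S)"
    using cohomology_class_mono[of _ Y] cohomology_class_self[of _ Y] by blast
  finally show ?thesis .
qed

text \<open>A pullback vanishes by definition off the singular simplices of \<open>Y\<close>, so
  only the support in degrees is left to check. It is applied to Thom cocycles, which live on the
  total space of the bundle.\<close>

lemma cochain_pullback_closed:
  assumes "finite {p. \<phi> p \<noteq> (\<lambda>_. 0)}"
  shows "cochain_pullback Y f \<phi> \<in> carrier (cochain_ring Y)"
proof -
  have "{p. cochain_pullback Y f \<phi> p \<noteq> (\<lambda>_. 0)} \<subseteq> {p. \<phi> p \<noteq> (\<lambda>_. 0)}"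
    by (auto simp: cochain_pullback_def fun_eq_iff)
  then show ?thesis
    using assms by (auto simp: cochain_ring_def cochain_pullback_def intro: finite_subset)
qed

lemma cohomology_map_ident_cohomology:
  assumes c: "c \<in> carrier (cohomology Y)" and f: "\<And>y. y \<in> topspace Y \<Longrightarrow> f y = y"
  shows "cohomology_map Y f c = c"
proof -
  obtain \<phi> where \<phi>: "\<phi> \<in> cocycles Y" "c = cohomology_class Y \<phi>"
    using c by (auto simp: cohomology_def Let_def FactRing_def A_RCOSETS_def' cohomology_class_def
        a_r_coset_def r_coset_def)
  then have "{\<phi>} \<subseteq> carrier (cochain_ring Y)"
    by (auto simp: cocycles_def)
  from cohomology_map_ident[OF this f] show ?thesis
    using \<phi>(2) by simp
qed

lemma cohomology_map_ident_euler_class: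
  assumes f: "\<And>y. y \<in> topspace (classifying_space A Y) \<Longrightarrow> f y = y"
  shows "cohomology_map (classifying_space A Y) f (euler_class A Y \<rho>) = euler_class A Y \<rho>"
proof -
  let ?S = "cochain_pullback (classifying_space A Y) zero_section ` Collect (thom_cocycle A Y \<rho>)"
  have "?S \<subseteq> carrier (cochain_ring (classifying_space A Y))"
  proof clarify
    fix \<phi> assume "thom_cocycle A Y \<rho> \<phi>"
    then have "finite {p. \<phi> p \<noteq> (\<lambda>_. 0)}"
      by (simp add: thom_cocycle_def cocycles_def cochain_ring_def)
    then show "cochain_pullback (classifying_space A Y) zero_section \<phi> \<in>
        carrier (cochain_ring (classifying_space A Y))"
      by (rule cochain_pullback_closed)
  qed
  moreover have "euler_class A Y \<rho> = \<Union>(cohomology_class (classifying_space A Y) ` ?S)"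
    by (auto simp: euler_class_def)
  ultimately show ?thesis
    using cohomology_map_ident[OF _ f] by metis
qed

section \<open>Classifying spaces and localizations\<close>

lemma topspace_classifying_space_subset:
  "topspace (classifying_space A Y) \<subseteq> milnor_orbit A ` milnor_points A"
  by (auto simp: classifying_space_def topspace_quotient_topology universal_space_def
      topology_generated_by_topspace)

lemma milnor_act_act:
  assumes "group A" "x \<in> milnor_points A" "a \<in> carrier A" "b \<in> carrier A"
  shows "milnor_act A (milnor_act A x a) b = milnor_act A x (a \<otimes>\<^bsub>A\<^esub> b)"
proof
  fix i
  show "milnor_act A (milnor_act A x a) b i = milnor_act A x (a \<otimes>\<^bsub>A\<^esub> b) i"
    using assms(2) monoid.m_assoc[OF group.is_monoid[OF assms(1)] _ assms(3,4)]
    by (cases "x i") (auto simp: milnor_act_def milnor_points_def)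
qed

text \<open>Every point of the orbit \<open>b\<close> has its coordinates in
  \<open>carrier A\<close>, where \<open>f\<close> is the identity, and the orbits of the points of
  \<open>b\<close> together make up \<open>b\<close> again.\<close>

lemma classifying_map_ident:
  assumes A: "group A" and f: "\<And>a. a \<in> carrier A \<Longrightarrow> f a = a"
    and b: "b \<in> topspace (classifying_space A Y)"
  shows "classifying_map A f b = b"
proof -
  interpret A: group A by (rule A)
  obtain x where x: "x \<in> milnor_points A" "b = milnor_orbit A x"
    using b topspace_classifying_space_subset by blast
  have map: "(\<lambda>i. map_option (\<lambda>(s, g). (s, f g)) (y i)) = y" if "y \<in> b" for y
  proof
    fix i
    show "map_option (\<lambda>(s, g). (s, f g)) (y i) = y i"
      using x that f by (cases "x i") (auto simp: milnor_orbit_def milnor_act_def milnor_points_def)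
  qed
  have "classifying_map A f b = (\<Union>y\<in>b. milnor_orbit A y)"
    unfolding classifying_map_def using map by simp
  also have "\<dots> = b"
  proof
    show "(\<Union>y\<in>b. milnor_orbit A y) \<subseteq> b"
      using x milnor_act_act[OF A x(1)] by (auto simp: milnor_orbit_def)
    have "y \<in> milnor_orbit A y" if yb: "y \<in> b" for y
    proof -
      obtain a where "a \<in> carrier A" "y = milnor_act A x a"
        using yb x(2) by (auto simp: milnor_orbit_def)
      then have "milnor_act A y \<one>\<^bsub>A\<^esub> = y"
        using milnor_act_act[OF A x(1)] by simp
      then show ?thesis
        unfolding milnor_orbit_def by force
    qed
    then show "b \<subseteq> (\<Union>y\<in>b. milnor_orbit A y)"
      by blast
  qed
  finally show ?thesis .
qed

text \<open>\<open>loc_map\<close> is a union over all ways of writing \<open>P\<close> as a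
  fraction, and each contributes \<open>P\<close> itself. Denominators have their own assumption
  because Euler classes are treated apart from the elements of the cohomology ring.\<close>

lemma loc_map_ident:
  assumes "\<And>r. r \<in> carrier R \<Longrightarrow> f r = r" "\<And>s. s \<in> S \<Longrightarrow> f s = s" and P: "P \<in> carrier (loc_ring R S)"
  shows "loc_map R S R S f P = P"
proof -
  have "{fraction R S (f r) (f s) | r s. r \<in> carrier R \<and> s \<in> S \<and> P = fraction R S r s} = {P}"
    using assms by (auto simp: loc_ring_def) metis
  then show ?thesis
    unfolding loc_map_def by simp
qed

section \<open>The two models\<close>

locale open_torus_setup = toral_setup + group \<Gamma> +
  assumes topspace: "topspace X = carrier \<Gamma>"
    and subgroup_T: "subgroup T \<Gamma>"
    and T_commute: "s \<in> T \<Longrightarrow> t \<in> T \<Longrightarrow> s \<otimes> t = t \<otimes> s"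
    and openin_T: "openin X T" and closedin_T: "closedin X T"
begin

lemma T_carrier: "T \<subseteq> carrier \<Gamma>"
  using subgroup_T by (rule subgroup.subset)

lemma T_conj: "t \<in> T \<Longrightarrow> u \<in> T \<Longrightarrow> t \<otimes> u \<otimes> inv t = u" "t \<in> T \<Longrightarrow> u \<in> T \<Longrightarrow> inv t \<otimes> u \<otimes> t = u"
proof -
  assume tu: "t \<in> T" "u \<in> T"
  then have G: "t \<in> carrier \<Gamma>" "u \<in> carrier \<Gamma>"
    using T_carrier by auto
  show "t \<otimes> u \<otimes> inv t = u"
    using T_commute[OF tu] G by (simp add: m_assoc)
  have "inv t \<otimes> u \<otimes> t = inv t \<otimes> (t \<otimes> u)"
    using T_commute[OF tu] G by (simp add: m_assoc)
  then show "inv t \<otimes> u \<otimes> t = u"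
    using G by (simp add: m_assoc[symmetric])
qed

section \<open>Identity components of the flag groups\<close>

lemma flag_members: "flag E \<Longrightarrow> K \<in> set E \<Longrightarrow> subgroup K \<Gamma> \<and> K \<subseteq> T"
  by (auto simp: flag_def toral_subgroup_def)

lemma last_flag: "flag E \<Longrightarrow> subgroup (last E) \<Gamma> \<and> last E \<subseteq> T"
  by (intro flag_members) (auto simp: flag_def)

lemma T_subset_flag_normalizer:
  assumes "flag E"
  shows "T \<subseteq> flag_normalizer E"
proof
  fix t assume t: "t \<in> T"
  have "t \<in> normalizer \<Gamma> K" if "K \<in> set E" for K
    using flag_members[OF assms that] t T_carrier T_commute
    by (intro commuting_in_normalizer) auto
  then show "t \<in> flag_normalizer E"
    by (simp add: flag_normalizer_def)
qed

lemma coset_subset_T: "K \<subseteq> T \<Longrightarrow> t \<in> T \<Longrightarrow> K #> t \<subseteq> T"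
  using subgroup.m_closed[OF subgroup_T] by (auto simp: r_coset_def)

text \<open>The cosets of \<open>last E\<close> by elements of \<open>T\<close> form a clopen set of
  the flag group, because its preimage is \<open>T\<close>; connected sets through the identity
  cannot leave it.\<close>

lemma flag_group_id_comp_subset:
  assumes E: "flag E"
  shows "carrier (flag_group_id_comp E) \<subseteq> (\<lambda>t. last E #> t) ` T"
proof -
  let ?K = "last E" and ?N = "flag_normalizer E" and ?Y = "flag_group_topology E"
  let ?S = "(\<lambda>t. ?K #> t) ` T"
  have K: "subgroup ?K \<Gamma>" "?K \<subseteq> T"
    using last_flag[OF E] by auto
  have TN: "T \<subseteq> ?N"
    using E by (rule T_subset_flag_normalizer)
  have top: "topspace (subtopology X ?N) = ?N \<inter> carrier \<Gamma>"
    using topspace by auto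
  \<comment> \<open>\<open>last E\<close> is contained in \<open>T\<close>, so \<open>T\<close> is a
    union of its cosets and the preimage of \<open>?S\<close> is no larger than
    \<open>T\<close>.\<close>
  have mem: "?K #> x \<in> ?S \<longleftrightarrow> x \<in> T" if "x \<in> carrier \<Gamma>" for x
  proof
    assume "?K #> x \<in> ?S"
    then obtain t where "t \<in> T" "?K #> x = ?K #> t"
      by blast
    moreover have "x \<in> ?K #> x"
      using that subgroup.one_closed[OF K(1)] by (auto simp: r_coset_def intro!: bexI[of _ \<one>])
    ultimately show "x \<in> T"
      using coset_subset_T[OF K(2)] by blast
  qed blast
  have pre: "{x \<in> topspace (subtopology X ?N). ?K #> x \<in> ?S} = T"
    unfolding top using mem TN T_carrier by blast
  have "openin (subtopology X ?N) T"
    unfolding openin_subtopology using openin_T TN by blast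
  moreover have "?S \<subseteq> (\<lambda>g. ?K #> g) ` topspace (subtopology X ?N)"
    unfolding top using TN T_carrier by blast
  ultimately have "openin ?Y ?S"
    unfolding flag_group_topology_def openin_quotient_topology pre by blast
  moreover have "closedin ?Y ?S"
  proof -
    have "topspace ?Y - ?S \<subseteq> (\<lambda>g. ?K #> g) ` topspace (subtopology X ?N)"
      by (auto simp: flag_group_topology_def topspace_quotient_topology)
    moreover have "{x \<in> topspace (subtopology X ?N). ?K #> x \<in> topspace ?Y - ?S} = topspace (subtopology X ?N) - T"
      unfolding flag_group_topology_def topspace_quotient_topology using pre by blast
    moreover have "closedin (subtopology X ?N) T"
      using closedin_T TN by (metis closedin_subset_topspace)
    ultimately have "openin ?Y (topspace ?Y - ?S)"
      by (simp add: flag_group_topology_def openin_quotient_topology closedin_def)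
    moreover have "?S \<subseteq> topspace ?Y"
      using \<open>openin ?Y ?S\<close> by (rule openin_subset)
    ultimately show ?thesis
      by (simp add: closedin_def)
  qed
  ultimately have cases: "C \<subseteq> ?S \<or> disjnt C ?S" if "connectedin ?Y C" for C
    using connectedin_clopen_cases that by blast
  have "\<one>\<^bsub>flag_group E\<^esub> = ?K #> \<one>"
    using coset_mult_one[OF subgroup.subset[OF K(1)]] by (simp add: flag_group_def FactGroup_def)
  then have one: "\<one>\<^bsub>flag_group E\<^esub> \<in> ?S"
    using subgroup.one_closed[OF subgroup_T] by blast
  show ?thesis
  proof
    fix D assume "D \<in> carrier (flag_group_id_comp E)"
    then obtain C where "connectedin ?Y C" "\<one>\<^bsub>flag_group E\<^esub> \<in> C" "D \<in> C"
      by (auto simp: flag_group_id_comp_def connected_component_of_def)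
    then show "D \<in> ?S"
      using cases one by (meson disjnt_iff subsetD)
  qed
qed

text \<open>A normalizing element of the identity component is already a coset
  \<open>last E #> t\<close> with \<open>t \<in> T\<close>. Its own coset is therefore all of
  \<open>?S\<close>, whose union is \<open>T\<close>, the identity of \<open>W\<close>.\<close>

lemma W_id_comp_subset:
  assumes E: "flag E"
  shows "W_id_comp E \<subseteq> {T}"
proof
  let ?K = "last E" and ?A = "flag_group_id_comp E"
  let ?S = "(\<lambda>t. ?K #> t) ` T"
  have K: "subgroup ?K \<Gamma>" "?K \<subseteq> T"
    using last_flag[OF E] by auto
  fix w assume "w \<in> W_id_comp E"
  then obtain a where a: "a \<in> normalizer ?A ?S" "w = \<Union>(?S #>\<^bsub>?A\<^esub> a)"
    by (auto simp: W_id_comp_def weyl_def FactGroup_def RCOSETS_def r_coset_def)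
  then have "a \<in> carrier ?A"
    by (simp add: normalizer_def stabilizer_def)
  then obtain t where t: "t \<in> T" "a = ?K #> t"
    using flag_group_id_comp_subset[OF E] by blast
  have w: "w = (\<Union>u\<in>T. (?K #> u) <#> (?K #> t))"
    unfolding a(2) t(2) by (auto simp: r_coset_def flag_group_id_comp_def flag_group_def FactGroup_def set_mult_def)
  have "w = T"
  proof
    show "w \<subseteq> T"
    proof
      fix x assume "x \<in> w"
      then obtain u h k where "u \<in> T" "h \<in> ?K #> u" "k \<in> ?K #> t" "x = h \<otimes> k"
        by (auto simp: w set_mult_def)
      then show "x \<in> T"
        using coset_subset_T[OF K(2)] t(1) subgroup.m_closed[OF subgroup_T] by blast
    qed
    show "T \<subseteq> w"
    proof
      fix x assume x: "x \<in> T"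
      have G: "x \<in> carrier \<Gamma>" "t \<in> carrier \<Gamma>"
        using x t(1) T_carrier by auto
      have self: "u \<in> ?K #> u" if "u \<in> carrier \<Gamma>" for u
        using that subgroup.one_closed[OF K(1)] by (auto simp: r_coset_def intro!: bexI[of _ \<one>])
      have "x = (x \<otimes> inv t) \<otimes> t"
        using G by (simp add: m_assoc)
      moreover have "x \<otimes> inv t \<in> T"
        using x t(1) subgroup.m_closed[OF subgroup_T] subgroup.m_inv_closed[OF subgroup_T] by blast
      ultimately show "x \<in> w"
        unfolding w set_mult_def using self[of "x \<otimes> inv t"] self[of t] G by blast
    qed
  qed
  then show "w \<in> {T}"
    by simp
qed

section \<open>Trivial action of the coset \<open>T\<close> on the coefficient rings\<close>

lemma group_quot:
  assumes K: "subgroup K \<Gamma>" "K \<subseteq> T"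
  shows "group (quot K)"
proof -
  have T: "group (\<Gamma>\<lparr>carrier := T\<rparr>)"
    using subgroup_T by (rule subgroup_imp_group)
  have "comm_group (\<Gamma>\<lparr>carrier := T\<rparr>)"
    using T T_commute by (intro group.group_comm_groupI) auto
  moreover have "subgroup K (\<Gamma>\<lparr>carrier := T\<rparr>)"
    using K subgroup_T by (simp add: subgroup_incl)
  ultimately have "normal K (\<Gamma>\<lparr>carrier := T\<rparr>)"
    by (rule comm_group.subgroup_imp_normal)
  then show ?thesis
    unfolding quot_def by (rule normal.factorgroup_is_group)
qed

lemma coset_conj_T:
  assumes K: "K \<subseteq> T" and D: "D \<in> carrier (quot K)"
  shows "coset_conj T D = D"
proof -
  have "D \<subseteq> T"
    using D coset_subset_T[OF K] by (auto simp: quot_def FactGroup_def RCOSETS_def r_coset_def)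
  moreover have "\<one> \<in> T"
    using subgroup_T by (rule subgroup.one_closed)
  ultimately have "n \<otimes> d \<otimes> inv n = d" if "n \<in> T" "d \<in> D" for n d
    using T_conj(1) that by blast
  then have "coset_conj T D = {d | n d. n \<in> T \<and> d \<in> D}"
    unfolding coset_conj_def by (intro Collect_cong ex_cong1) auto
  then show ?thesis
    using \<open>\<one> \<in> T\<close> by auto
qed

lemma flag_conj_T:
  assumes E: "flag E"
  shows "flag_conj T E = E"
proof -
  have "subgroup_conj T K = K" if K: "K \<in> set E" for K
  proof -
    have "inv n \<otimes> k \<otimes> n = k" if "n \<in> T" "k \<in> K" for n k
      using T_conj(2) that flag_members[OF E K] by blast
    then have "subgroup_conj T K = {k | n k. n \<in> T \<and> k \<in> K}"
      unfolding subgroup_conj_def by (intro Collect_cong ex_cong1) auto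
    then show ?thesis
      using subgroup.one_closed[OF subgroup_T] by auto
  qed
  then show ?thesis
    by (simp add: flag_conj_def map_idI)
qed

text \<open>\<open>T\<close> is abelian, so conjugation by it is the identity on
  \<open>quot (last E)\<close>, and this persists through classifying space, cohomology and
  localization. \<open>flag_conj_T\<close> makes source and target literally the same ring.\<close>

lemma Ra_conj_T:
  assumes E: "flag E" and x: "x \<in> carrier (Ra E)"
  shows "Ra_conj T E x = x"
proof -
  let ?K = "last E"
  have K: "subgroup ?K \<Gamma>" "?K \<subseteq> T"
    using last_flag[OF E] by auto
  let ?f = "classifying_map (quot ?K) (coset_conj T)"
  have f: "?f b = b" if "b \<in> topspace (B ?K)" for b
    using that coset_conj_T[OF K(2)] unfolding B_def by (intro classifying_map_ident[OF group_quot[OF K]])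
  have "loc_map (H ?K) (Eul (hd E) ?K) (H ?K) (Eul (hd E) ?K) (cohomology_map (B ?K) ?f) x = x"
  proof (rule loc_map_ident)
    show "cohomology_map (B ?K) ?f r = r" if "r \<in> carrier (H ?K)" for r
      using that unfolding H_def by (rule cohomology_map_ident_cohomology[OF _ f])
    show "cohomology_map (B ?K) ?f s = s" if "s \<in> Eul (hd E) ?K" for s
    proof -
      obtain V where "s = euler ?K V"
        using \<open>s \<in> Eul (hd E) ?K\<close> by (auto simp: Eul_def)
      then show ?thesis
        using cohomology_map_ident_euler_class[OF f[unfolded B_def]] by (simp only: euler_def B_def)
    qed
    show "x \<in> carrier (loc_ring (H ?K) (Eul (hd E) ?K))"
      using x E by (simp add: Ra_def)
  qed
  then show ?thesis
    by (simp add: Ra_conj_def flag_conj_T[OF E] Let_def)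
qed

text \<open>The invariance condition ranges over the identity of \<open>W\<close> at most, so the
  invariants are the whole ring.\<close>

lemma Rinv_eq_Ra: "Rinv = Ra"
proof
  fix E
  show "Rinv E = Ra E"
  proof (cases "flag E")
    case True
    have I: "{x \<in> carrier (Ra E). \<forall>w\<in>W_id_comp E. Ra_conj w E x = x} = carrier (Ra E)"
      using W_id_comp_subset[OF True] Ra_conj_T[OF True] by blast
    \<comment> \<open>Equality of records also requires the graded pieces to survive the
      intersection with the invariants.\<close>
    have "rcomp (Ra E) n \<subseteq> carrier (Ra E)" for n
      using True by (auto simp: Ra_def loc_ring_def)
    then have "rcomp (Ra E) n \<inter> carrier (Ra E) = rcomp (Ra E) n" for n
      by blast
    then show ?thesis
      using True by (simp add: Rinv_def I)
  next
    \<comment> \<open>Off flags both restricted functions are \<open>undefined\<close>.\<close>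
    case False
    then show ?thesis
      by (simp add: Rinv_def Ra_def)
  qed
qed

text \<open>The only possible element of \<open>W_id_comp E\<close> is \<open>T\<close>, the unit of
  \<open>W\<close>, and equivariance already makes the unit act as the identity.\<close>

lemma id_comp_acts_trivially: "equivariant_module R M \<Longrightarrow> id_comp_acts_trivially M"
proof -
  assume M: "equivariant_module R M"
  have "\<one>\<^bsub>W\<^esub> = T"
    by (simp add: W_def weyl_def FactGroup_def)
  then show ?thesis
    using M W_id_comp_subset unfolding id_comp_acts_trivially_def equivariant_module_def by fastforce
qed

lemma toral_model_eq_equivariant_model: "toral_model = equivariant_model"
  unfolding toral_model_def equivariant_model_def Rinv_eq_Ra
  using id_comp_acts_trivially by (intro arg_cong[of _ _ "module_category Ra"]) blast

end

theorem lemma6p10: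
  fixes G :: "'g monoid" and X :: "'g topology"
    and V :: "'e::euclidean_space set" and C :: "('g set \<times> ('g \<Rightarrow> 'e)) set"
    and T :: "'g set" and N :: "'g monoid" and XN :: "'g topology"
  assumes "compact_lie_group G X V C"
    and "maximal_torus G X T"
    and "N = G\<lparr>carrier := normalizer G T\<rparr>"
    and "XN = subtopology X (normalizer G T)"
  shows "(toral_setup.toral_model N XN T :: (('g, 'm) toral_module, 'g flag \<Rightarrow> 'm \<Rightarrow> 'm) cat) =
         toral_setup.equivariant_model N XN T"
proof -
  have group: "group G" "topspace X = carrier G"
    using assms(1) by (auto simp: compact_lie_group_def topological_group_def)
  interpret G: group G
    by (rule group(1))
  have T: "subgroup T G" "closedin X T" "comm_group (G\<lparr>carrier := T\<rparr>)"
    using assms(2) by (auto simp: maximal_torus_def torus_in_def torus_group_def)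
  have TG: "T \<subseteq> carrier G"
    using T(1) by (rule subgroup.subset)
  have comm: "s \<otimes>\<^bsub>G\<^esub> t = t \<otimes>\<^bsub>G\<^esub> s" if "s \<in> T" "t \<in> T" for s t
    using comm_monoid.m_comm[OF comm_group.axioms(1)[OF T(3)], of s t] that by simp
  have N: "subgroup (normalizer G T) G"
    using TG by (rule G.normalizer_imp_subgroup)
  have TN: "T \<subseteq> normalizer G T"
    using G.commuting_in_normalizer[OF TG] TG comm by blast
  \<comment> \<open>Maximality of \<open>T\<close> in \<open>G\<close> enters through openness
    alone; the other conditions are inherited from \<open>G\<close>.\<close>
  interpret open_torus_setup N XN T
  proof (intro open_torus_setup.intro open_torus_setup_axioms.intro)
    show "group N"
      unfolding assms(3) using N by (rule G.subgroup_imp_group)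
    show "topspace XN = carrier N"
      using subgroup.subset[OF N] group(2) by (auto simp: assms(3,4))
    show "subgroup T N"
      unfolding assms(3) using T(1) N TN by (rule G.subgroup_incl)
    show "s \<otimes>\<^bsub>N\<^esub> t = t \<otimes>\<^bsub>N\<^esub> s" if "s \<in> T" "t \<in> T" for s t
      using comm that by (simp add: assms(3))
    show "openin XN T"
      unfolding assms(4) using assms(1,2) by (rule maximal_torus_open_in_normalizer)
    show "closedin XN T"
      unfolding assms(4) using T(2) TN by (rule closedin_subset_topspace)
  qed
  show ?thesis
    by (rule toral_model_eq_equivariant_model)
qed

end
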